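(* Let $G$ be a connected, locally finite, simple graph which is Ricci-flat (in the sense of the Lin–Lu–Yau curvature, i.e. $\kappa(x,y)=0$ for every edge $xy$ of $G$) and has girth $g(G)\geq 5$. Then $G$ is isomorphic to one of the following graphs: (1) the infinite path (two-sided, with vertex set $\mathbb{Z}$ and edges $\{i,i+1\}$); (2) the cycle $C_n$ with $n\geq 6$; (3) the dodecahedral graph; (4) the Petersen graph; (5) the half-dodecahedral graph; (6) the Triplex graph.
   Context: For a locally finite graph $G=(V,E)$ with graph distance $d$ and vertex degrees $d_x$, and for $\alpha\in[0,1]$, define the probability measure $\mu_x^\alpha$ by $\mu_x^\alpha(x)=\alpha$, $\mu_x^\alpha(z)=(1-\alpha)/d_x$ for each neighbor $z$ of $x$, and $\mu_x^\alpha(z)=0$ otherwise. Let $W$ denote the $L^1$-Wasserstein (optimal transport) distance between probability measures on $V$ with respect to $d$. Set $\kappa_\alpha(x,y)=1-W(\mu_x^\alpha,\mu_y^\alpha)/d(x,y)$; the Lin–Lu–Yau curvature is $\kappa(x,y)=\lim_{\alpha\to 1}\kappa_\alpha(x,y)/(1-\alpha)$. A graph is Ricci-flat if $\kappa(x,y)=0$ for every edge $xy$. The girth $g(G)$ is the length of a shortest cycle (infinite if $G$ has no cycle). The half-dodecahedral graph has 15 vertices $a_i,b_i,c_i$ ($i\in\mathbb{Z}/5\mathbb{Z}$) and edges $a_ia_{i+1}$, $a_ib_i$, $b_ic_i$, $c_ib_{i+1}$ for all $i$ (an inner $5$-cycle, each of whose vertices is joined to a vertex of an outer $10$-cycle $b_0c_0b_1c_1\cdots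 b_4c_4$, with the $c_i$ of degree $2$). The Triplex graph has 12 vertices $v_1,\dots,v_{12}$ with edges $v_iv_{i+1}$ (indices mod $12$) forming a $12$-cycle, together with the six chords $v_1v_7$, $v_2v_{10}$, $v_3v_8$, $v_4v_{12}$, $v_5v_9$, $v_6v_{11}$. The dodecahedral graph is the 1-skeleton of the regular dodecahedron, and the Petersen graph is the usual 10-vertex Petersen graph.
   Formalization: The graph is assumed to have at least one edge; the single-vertex graph (and the empty graph) is connected, vacuously Ricci-flat and of infinite girth, but is not isomorphic to any graph in the list. *)

theory Defs
  imports "HOL-Probability.Probability" "HOL-Library.Extended_Nat"
begin

section \<open>Graphs\<close>

record 'a graph =
  verts :: "'a set"
  edges :: "'a set set"

definition simple_graph :: "'a graph \<Rightarrow> bool" where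
  "simple_graph G \<longleftrightarrow> (\<forall>e\<in>edges G. e \<subseteq> verts G \<and> card e = 2)"

definition neighbours :: "'a graph \<Rightarrow> 'a \<Rightarrow> 'a set" where
  "neighbours G x = {y. {x, y} \<in> edges G}"

definition vertex_degree :: "'a graph \<Rightarrow> 'a \<Rightarrow> nat" where
  "vertex_degree G x = card (neighbours G x)"

definition locally_finite_graph :: "'a graph \<Rightarrow> bool" where
  "locally_finite_graph G \<longleftrightarrow> (\<forall>x\<in>verts G. finite (neighbours G x))"

text \<open>A walk is the list of its vertices, so it has \<open>length p - 1\<close> edges.\<close>

definition walk :: "'a graph \<Rightarrow> 'a list \<Rightarrow> bool" where
  "walk G p \<longleftrightarrow> p \<noteq> [] \<and> set p \<subseteq> verts G \<and> successively (\<lambda>u v. {u, v} \<in> edges G) p"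

definition connected_graph :: "'a graph \<Rightarrow> bool" where
  "connected_graph G \<longleftrightarrow>
     (\<forall>x\<in>verts G. \<forall>y\<in>verts G. \<exists>p. walk G p \<and> hd p = x \<and> last p = y)"

definition graph_dist :: "'a graph \<Rightarrow> 'a \<Rightarrow> 'a \<Rightarrow> nat" where
  "graph_dist G x y = (LEAST n. \<exists>p. walk G p \<and> hd p = x \<and> last p = y \<and> length p = Suc n)"

text \<open>A cycle is the list of its distinct vertices; its length is the number of entries.\<close>

definition cycle :: "'a graph \<Rightarrow> 'a list \<Rightarrow> bool" where
  "cycle G c \<longleftrightarrow> walk G c \<and> distinct c \<and> length c \<ge> 3 \<and> {last c, hd c} \<in> edges G"

text \<open>The infimum of the empty set in \<^typ>\<open>enat\<close> is \<open>\<infinity>\<close>.\<close>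

definition girth :: "'a graph \<Rightarrow> enat" where
  "girth G = (INF c\<in>{c. cycle G c}. enat (length c))"

definition graph_isomorphic :: "'a graph \<Rightarrow> 'b graph \<Rightarrow> bool" where
  "graph_isomorphic G H \<longleftrightarrow> (\<exists>f. bij_betw f (verts G) (verts H) \<and>
     (\<forall>x\<in>verts G. \<forall>y\<in>verts G. {x, y} \<in> edges G \<longleftrightarrow> {f x, f y} \<in> edges H))"


section \<open>Lin--Lu--Yau curvature\<close>

text \<open>The mass function below sums to \<open>1\<close> provided that \<open>0 \<le> \<alpha> \<le> 1\<close> and that \<open>x\<close> has finite
  positive degree in a simple graph; \<^const>\<open>embed_pmf\<close> is unspecified otherwise.\<close>

definition lazy_walk_pmf :: "'a graph \<Rightarrow> real \<Rightarrow> 'a \<Rightarrow> 'a pmf" where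
  "lazy_walk_pmf G \<alpha> x = embed_pmf (\<lambda>z.
     if z = x then \<alpha>
     else if z \<in> neighbours G x then (1 - \<alpha>) / real (vertex_degree G x)
     else 0)"

definition couplings :: "'a pmf \<Rightarrow> 'a pmf \<Rightarrow> ('a \<times> 'a) pmf set" where
  "couplings \<mu> \<nu> = {\<pi>. map_pmf fst \<pi> = \<mu> \<and> map_pmf snd \<pi> = \<nu>}"

text \<open>The integrability condition excludes couplings of infinite cost, whose Bochner integral
  would be \<open>0\<close> by convention.\<close>

definition wasserstein :: "('a \<Rightarrow> 'a \<Rightarrow> real) \<Rightarrow> 'a pmf \<Rightarrow> 'a pmf \<Rightarrow> real" where
  "wasserstein d \<mu> \<nu> = Inf {measure_pmf.expectation \<pi> (\<lambda>(u, v). d u v) |\<pi>.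
     \<pi> \<in> couplings \<mu> \<nu> \<and> integrable (measure_pmf \<pi>) (\<lambda>(u, v). d u v)}"

definition alpha_curvature :: "'a graph \<Rightarrow> real \<Rightarrow> 'a \<Rightarrow> 'a \<Rightarrow> real" where
  "alpha_curvature G \<alpha> x y =
     1 - wasserstein (\<lambda>u v. real (graph_dist G u v)) (lazy_walk_pmf G \<alpha> x) (lazy_walk_pmf G \<alpha> y)
         / real (graph_dist G x y)"

definition lly_curvature :: "'a graph \<Rightarrow> 'a \<Rightarrow> 'a \<Rightarrow> real" where
  "lly_curvature G x y = Lim (at_left 1) (\<lambda>\<alpha>. alpha_curvature G \<alpha> x y / (1 - \<alpha>))"

definition ricci_flat :: "'a graph \<Rightarrow> bool" where
  "ricci_flat G \<longleftrightarrow> (\<forall>x y. {x, y} \<in> edges G \<longrightarrow> lly_curvature G x y = 0)"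


section \<open>The graphs in the classification\<close>

definition infinite_path :: "int graph" where
  "infinite_path = \<lparr>verts = UNIV, edges = {{i, i + 1} |i. True}\<rparr>"

definition cycle_graph :: "nat \<Rightarrow> nat graph" where
  "cycle_graph n = \<lparr>verts = {..<n}, edges = {{i, Suc i mod n} |i. i < n}\<rparr>"

text \<open>A regular dodecahedron centred at the origin with edge length \<open>2 / \<phi>\<close>, where \<open>\<phi>\<close> is the
  golden ratio.\<close>

definition golden_ratio :: real where
  "golden_ratio = (1 + sqrt 5) / 2"

definition regular_dodecahedron :: "(real ^ 3) set" where
  "regular_dodecahedron = convex hull
     ({vector [x, y, z] |x y z. x \<in> {-1, 1} \<and> y \<in> {-1, 1} \<and> z \<in> {-1, 1}} \<union>
      {vector [0, s / golden_ratio, t * golden_ratio] |s t. s \<in> {-1, 1} \<and> t \<in> {-1, 1}} \<union>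
      {vector [s / golden_ratio, t * golden_ratio, 0] |s t. s \<in> {-1, 1} \<and> t \<in> {-1, 1}} \<union>
      {vector [t * golden_ratio, 0, s / golden_ratio] |s t. s \<in> {-1, 1} \<and> t \<in> {-1, 1}})"

definition one_skeleton :: "'v::euclidean_space set \<Rightarrow> 'v graph" where
  "one_skeleton P = \<lparr>verts = {v. v extreme_point_of P},
     edges = {{u, v} |u v. u \<noteq> v \<and> closed_segment u v edge_of P}\<rparr>"

definition dodecahedral_graph :: "(real ^ 3) graph" where
  "dodecahedral_graph = one_skeleton regular_dodecahedron"

datatype petersen_vertex = Outer nat | Inner nat

text \<open>An outer pentagon, an inner pentagram, and five spokes.\<close>

definition petersen_graph :: "petersen_vertex graph" where
  "petersen_graph = \<lparr>verts = Outer ` {..<5} \<union> Inner ` {..<5},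
     edges = {{Outer i, Outer ((i + 1) mod 5)} |i. i < 5} \<union>
             {{Outer i, Inner i} |i. i < 5} \<union>
             {{Inner i, Inner ((i + 2) mod 5)} |i. i < 5}\<rparr>"

datatype half_dodecahedral_vertex = Va nat | Vb nat | Vc nat

definition half_dodecahedral_graph :: "half_dodecahedral_vertex graph" where
  "half_dodecahedral_graph = \<lparr>verts = Va ` {..<5} \<union> Vb ` {..<5} \<union> Vc ` {..<5},
     edges = {{Va i, Va ((i + 1) mod 5)} |i. i < 5} \<union>
             {{Va i, Vb i} |i. i < 5} \<union>
             {{Vb i, Vc i} |i. i < 5} \<union>
             {{Vc i, Vb ((i + 1) mod 5)} |i. i < 5}\<rparr>"

definition triplex_graph :: "nat graph" where
  "triplex_graph = \<lparr>verts = {1..12},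
     edges = {{i, i + 1} |i. 1 \<le> i \<and> i < 12} \<union> {{12, 1}} \<union>
             {{1, 7}, {2, 10}, {3, 8}, {4, 12}, {5, 9}, {6, 11}}\<rparr>"

end

theory Submission
  imports Defs
begin

text \<open>The quotient \<open>\<kappa>\<^sub>\<alpha> / (1 - \<alpha>)\<close> is monotone and bounded, so vanishing curvature means that every
  coupling of the lazy walks at the ends of an edge has cost at least \<open>1\<close>, and that every Lipschitz
  potential increasing by \<open>1\<close> along the edge \<open>xy\<close> satisfies \<open>\<Delta>f(y) \<le> \<Delta>f(x)\<close>. For girth at least five,
  well-chosen couplings and potentials leave only the degree pairs \<open>(2,2)\<close>, \<open>(2,3)\<close>, \<open>(2,4)\<close>,
  \<open>(3,3)\<close> and prescribe which pairs of neighbours of \<open>x\<close> and \<open>y\<close> lie on a common pentagon with \<open>xy\<close>;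
  on an edge of type \<open>(3,3)\<close> these pairs contain a perfect matching.

  A vertex of degree four would force a square. If all degrees are two, the graph is a path or a
  cycle. If the degrees two and three both occur, the pentagons around the vertices of degree two
  line up along an outer cycle whose inner counterpart closes up after five steps. In the cubic case,
  the matching condition is strong enough for a finite search that starts with one edge and its two
  pentagons and branches on missing neighbours and on the matchings across edges.\<close>

section \<open>Transport between finitely supported measures\<close>

text \<open>A connected graph without edges is vacuously Ricci-flat and has infinite girth;
  \<open>edges G \<noteq> {}\<close> excludes it. The curvature is never computed. One coupling, at
  one idleness of choice, bounds it from below, and one potential bounds it from above, so each
  forbidden local configuration is refuted by a single cheap coupling or a single steep potential.
  The idleness is chosen so that all masses are multiples of a common unit; a coupling is then a
  finite list of moves of that unit. The obstacle in the cubic case is that the matchings across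
  different edges can be combined in several ways, and three different graphs survive. The search
  records only edges known to be present; an edge is known to be absent only through a full degree
  or through the girth. The dodecahedron is given as a polytope, so both its edges and its non-edges
  must be derived from supporting functionals. Exact arithmetic with integers
  \<open>a + b \<phi>\<close> reduces this to finitely many evaluations.\<close>

lemma set_pmf_coupling:
  assumes "\<pi> \<in> couplings \<mu> \<nu>"
  shows "set_pmf \<pi> \<subseteq> set_pmf \<mu> \<times> set_pmf \<nu>"
  using assms unfolding couplings_def by (auto simp: image_iff) force+

lemma finite_coupling:
  assumes "\<pi> \<in> couplings \<mu> \<nu>" "finite (set_pmf \<mu>)" "finite (set_pmf \<nu>)"
  shows "finite (set_pmf \<pi>)"
  by (rule finite_subset[OF set_pmf_coupling[OF assms(1)]]) (use assms in auto)

lemma wasserstein_le_coupling: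
  assumes "\<pi> \<in> couplings \<mu> \<nu>" "finite (set_pmf \<mu>)" "finite (set_pmf \<nu>)" "\<And>u v. d u v \<ge> 0"
  shows "wasserstein d \<mu> \<nu> \<le> measure_pmf.expectation \<pi> (\<lambda>(u, v). d u v)"
  unfolding wasserstein_def
proof (rule cInf_lower)
  show "bdd_below {measure_pmf.expectation \<pi> (\<lambda>(u, v). d u v) |\<pi>.
     \<pi> \<in> couplings \<mu> \<nu> \<and> integrable (measure_pmf \<pi>) (\<lambda>(u, v). d u v)}"
    by (rule bdd_belowI[of _ 0]) (auto intro!: integral_nonneg_AE AE_I2 simp: assms(4))
qed (use assms in \<open>auto intro!: integrable_measure_pmf_finite finite_coupling\<close>)

lemma le_wassersteinI:
  assumes "finite (set_pmf \<mu>)" "finite (set_pmf \<nu>)"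
    and "\<And>\<pi>. \<pi> \<in> couplings \<mu> \<nu> \<Longrightarrow> c \<le> measure_pmf.expectation \<pi> (\<lambda>(u, v). d u v)"
  shows "c \<le> wasserstein d \<mu> \<nu>"
  unfolding wasserstein_def
proof (rule cInf_greatest)
  \<comment> \<open>The product coupling keeps the set of costs nonempty; the infimum of the empty
    set of reals is unspecified.\<close>
  have "pair_pmf \<mu> \<nu> \<in> couplings \<mu> \<nu>"
    by (simp add: couplings_def map_fst_pair_pmf map_snd_pair_pmf)
  then show "{measure_pmf.expectation \<pi> (\<lambda>(u, v). d u v) |\<pi>.
     \<pi> \<in> couplings \<mu> \<nu> \<and> integrable (measure_pmf \<pi>) (\<lambda>(u, v). d u v)} \<noteq> {}"
    using assms(1,2) by (auto intro!: exI[of _ "pair_pmf \<mu> \<nu>"] integrable_measure_pmf_finite)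
qed (use assms(3) in auto)

text \<open>The easy half of Kantorovich duality: integrating the Lipschitz bound against any
  coupling leaves only the two marginals on the left.\<close>

lemma kantorovich_le_wasserstein:
  assumes "finite (set_pmf \<mu>)" "finite (set_pmf \<nu>)"
    and lip: "\<And>u v. u \<in> set_pmf \<mu> \<Longrightarrow> v \<in> set_pmf \<nu> \<Longrightarrow> f v - f u \<le> d u v"
  shows "measure_pmf.expectation \<nu> f - measure_pmf.expectation \<mu> f \<le> wasserstein d \<mu> \<nu>"
proof (rule le_wassersteinI[OF assms(1,2)])
  fix \<pi> assume \<pi>: "\<pi> \<in> couplings \<mu> \<nu>"
  note fin = finite_coupling[OF \<pi> assms(1,2)]
  have "measure_pmf.expectation \<nu> f - measure_pmf.expectation \<mu> f
      = measure_pmf.expectation \<pi> (\<lambda>p. f (snd p)) - measure_pmf.expectation \<pi> (\<lambda>p. f (fst p))"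
    using \<pi> unfolding couplings_def by (auto simp flip: integral_map_pmf)
  also have "\<dots> = measure_pmf.expectation \<pi> (\<lambda>p. f (snd p) - f (fst p))"
    by (rule Bochner_Integration.integral_diff[symmetric])
       (auto intro: integrable_measure_pmf_finite fin)
  also have "\<dots> \<le> measure_pmf.expectation \<pi> (\<lambda>(u, v). d u v)"
    using set_pmf_coupling[OF \<pi>] lip
    by (intro integral_mono_AE integrable_measure_pmf_finite fin) (auto simp: AE_measure_pmf_iff)
  finally show "measure_pmf.expectation \<nu> f - measure_pmf.expectation \<mu> f
    \<le> measure_pmf.expectation \<pi> (\<lambda>(u, v). d u v)" .
qed


section \<open>The curvature of an edge as a limit\<close>

locale conn_graph =
  fixes G :: "'a graph"
  assumes simple: "simple_graph G"
    and locally_finite: "locally_finite_graph G"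
    and connected: "connected_graph G"
begin

abbreviation adj :: "'a \<Rightarrow> 'a \<Rightarrow> bool" where "adj u v \<equiv> {u, v} \<in> edges G"
abbreviation N :: "'a \<Rightarrow> 'a set" where "N \<equiv> neighbours G"
abbreviation gdist :: "'a \<Rightarrow> 'a \<Rightarrow> real" where "gdist u v \<equiv> real (graph_dist G u v)"

lemma adj_sym: "adj u v \<Longrightarrow> adj v u"
  by (simp add: insert_commute)

lemma adj_irrefl [simp]: "{u} \<notin> edges G"
  using simple unfolding simple_graph_def by force

lemma adj_neq: "adj u v \<Longrightarrow> u \<noteq> v"
  by auto

lemma adj_verts: "adj u v \<Longrightarrow> u \<in> verts G" "adj u v \<Longrightarrow> v \<in> verts G"
  using simple unfolding simple_graph_def by blast+

lemma mem_N [simp]: "v \<in> N u \<longleftrightarrow> adj u v"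
  by (simp add: neighbours_def)

lemma finite_N [simp]: "finite (N u)"
proof (cases "u \<in> verts G")
  case False
  then have "N u = {}" using adj_verts by auto
  then show ?thesis by simp
qed (use locally_finite in \<open>auto simp: locally_finite_graph_def\<close>)

lemma dist_le_walk: "walk G p \<Longrightarrow> hd p = u \<Longrightarrow> last p = v \<Longrightarrow> graph_dist G u v \<le> length p - 1"
  unfolding graph_dist_def by (rule Least_le) (auto simp: walk_def)

lemma dist_self [simp]: "u \<in> verts G \<Longrightarrow> graph_dist G u u = 0"
  using dist_le_walk[of "[u]" u u] by (simp add: walk_def)

lemma dist_walk:
  assumes "u \<in> verts G" "v \<in> verts G"
  obtains p where "walk G p" "hd p = u" "last p = v" "length p = Suc (graph_dist G u v)"
proof -
  obtain p where "walk G p" "hd p = u" "last p = v"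
    using connected assms unfolding connected_graph_def by blast
  then have "\<exists>n p. walk G p \<and> hd p = u \<and> last p = v \<and> length p = Suc n"
    by (intro exI[of _ "length p - 1"] exI[of _ p]) (auto simp: walk_def)
  from LeastI_ex[OF this] show ?thesis using that unfolding graph_dist_def by blast
qed

lemma dist_0_D: "u \<in> verts G \<Longrightarrow> v \<in> verts G \<Longrightarrow> graph_dist G u v = 0 \<Longrightarrow> u = v"
  by (erule (1) dist_walk) (auto simp: length_Suc_conv)

lemma dist_1_D: "u \<in> verts G \<Longrightarrow> v \<in> verts G \<Longrightarrow> graph_dist G u v = 1 \<Longrightarrow> adj u v"
  by (erule (1) dist_walk) (auto simp: length_Suc_conv walk_def)

lemma dist_2_D: "u \<in> verts G \<Longrightarrow> v \<in> verts G \<Longrightarrow> graph_dist G u v = 2 \<Longrightarrow> \<exists>w. adj u w \<and> adj w v"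
  by (erule (1) dist_walk) (auto simp: length_Suc_conv walk_def numeral_eq_Suc)

lemma dist_adj: "adj u v \<Longrightarrow> graph_dist G u v = 1"
proof -
  assume a: "adj u v"
  have "graph_dist G u v \<le> 1"
    using dist_le_walk[of "[u, v]" u v] a adj_verts[OF a] by (simp add: walk_def)
  moreover have "graph_dist G u v \<noteq> 0" using dist_0_D[of u v] a adj_verts[OF a] adj_neq[OF a] by blast
  ultimately show ?thesis by simp
qed

lemma dist_common: "adj u w \<Longrightarrow> adj w v \<Longrightarrow> graph_dist G u v \<le> 2"
  using dist_le_walk[of "[u, w, v]" u v] adj_verts by (auto simp: walk_def)

lemma dist_ge_1: "u \<in> verts G \<Longrightarrow> v \<in> verts G \<Longrightarrow> u \<noteq> v \<Longrightarrow> gdist u v \<ge> 1"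
  using dist_0_D[of u v] by (cases "graph_dist G u v") auto

lemma dist_ge_2:
  "u \<in> verts G \<Longrightarrow> v \<in> verts G \<Longrightarrow> u \<noteq> v \<Longrightarrow> \<not> adj u v \<Longrightarrow> gdist u v \<ge> 2"
  using dist_0_D[of u v] dist_1_D[of u v] by (cases "graph_dist G u v = 0"; cases "graph_dist G u v = 1") auto

lemma dist_ge_3:
  "u \<in> verts G \<Longrightarrow> v \<in> verts G \<Longrightarrow> u \<noteq> v \<Longrightarrow> \<not> adj u v \<Longrightarrow> \<nexists>w. adj u w \<and> adj w v
    \<Longrightarrow> gdist u v \<ge> 3"
  using dist_0_D[of u v] dist_1_D[of u v] dist_2_D[of u v]
  by (cases "graph_dist G u v = 0"; cases "graph_dist G u v = 1"; cases "graph_dist G u v = 2") auto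

lemma pmf_lazy_walk:
  assumes "N x \<noteq> {}" "0 \<le> \<alpha>" "\<alpha> \<le> 1"
  shows "pmf (lazy_walk_pmf G \<alpha> x) z =
    (if z = x then \<alpha> else if adj x z then (1 - \<alpha>) / real (card (N x)) else 0)"
proof -
  let ?f = "\<lambda>z. if z = x then \<alpha> else if z \<in> N x then (1 - \<alpha>) / real (vertex_degree G x) else 0"
  have nonneg: "\<And>z. 0 \<le> ?f z" using assms by auto
  have "(\<Sum>z\<in>insert x (N x). ?f z) = \<alpha> + (\<Sum>z\<in>N x. ?f z)"
    by (subst sum.insert) auto
  also have "(\<Sum>z\<in>N x. ?f z) = (\<Sum>z\<in>N x. (1 - \<alpha>) / real (card (N x)))"
    by (rule sum.cong) (auto simp: vertex_degree_def)
  also have "\<dots> = 1 - \<alpha>" using assms(1) by simp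
  finally have sum1: "(\<Sum>z\<in>insert x (N x). ?f z) = 1" by simp
  have "(\<integral>\<^sup>+ z. ennreal (?f z) \<partial>count_space UNIV) = (\<integral>\<^sup>+ z. ennreal (?f z) \<partial>count_space (insert x (N x)))"
    by (rule nn_integral_count_space_eq) auto
  also have "\<dots> = (\<Sum>z\<in>insert x (N x). ennreal (?f z))"
    by (rule nn_integral_count_space_finite) simp
  also have "\<dots> = ennreal (\<Sum>z\<in>insert x (N x). ?f z)"
    by (rule sum_ennreal) (rule nonneg)
  finally have "(\<integral>\<^sup>+ z. ennreal (?f z) \<partial>count_space UNIV) = 1"
    using sum1 by simp
  then show ?thesis
    unfolding lazy_walk_pmf_def by (subst pmf_embed_pmf[OF nonneg]) (auto simp: vertex_degree_def)
qed

lemma set_lazy_walk: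
  assumes "N x \<noteq> {}" "0 \<le> \<alpha>" "\<alpha> \<le> 1"
  shows "set_pmf (lazy_walk_pmf G \<alpha> x) \<subseteq> insert x (N x)"
  by (auto simp: set_pmf_iff pmf_lazy_walk[OF assms] split: if_splits)

lemma finite_set_lazy_walk:
  assumes "N x \<noteq> {}" "0 \<le> \<alpha>" "\<alpha> \<le> 1"
  shows "finite (set_pmf (lazy_walk_pmf G \<alpha> x))"
  by (rule finite_subset[OF set_lazy_walk[OF assms]]) simp

lemma expectation_lazy_walk:
  assumes "N x \<noteq> {}" "0 \<le> \<alpha>" "\<alpha> \<le> 1"
  shows "measure_pmf.expectation (lazy_walk_pmf G \<alpha> x) f
    = \<alpha> * f x + (1 - \<alpha>) / real (card (N x)) * (\<Sum>z\<in>N x. f z)"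
proof -
  have "measure_pmf.expectation (lazy_walk_pmf G \<alpha> x) f
      = (\<Sum>z\<in>insert x (N x). f z * pmf (lazy_walk_pmf G \<alpha> x) z)"
    by (rule integral_measure_pmf_real) (use set_lazy_walk[OF assms] in auto)
  also have "\<dots> = \<alpha> * f x + (\<Sum>z\<in>N x. f z * pmf (lazy_walk_pmf G \<alpha> x) z)"
    by (subst sum.insert) (auto simp: pmf_lazy_walk[OF assms])
  also have "(\<Sum>z\<in>N x. f z * pmf (lazy_walk_pmf G \<alpha> x) z) = (\<Sum>z\<in>N x. f z * ((1 - \<alpha>) / real (card (N x))))"
    by (rule sum.cong) (auto simp: pmf_lazy_walk[OF assms])
  finally show ?thesis by (simp only: sum_distrib_right[symmetric] mult.commute)
qed

text \<open>Performing the \<alpha>-walk only with probability \<open>t\<close> leaves the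
  probability \<open>t * (1 - \<alpha>)\<close> of moving. Every idleness in [\<alpha>, 1) therefore
  arises from \<alpha> by mixing with a point mass.\<close>

lemma lazy_walk_mix:
  assumes "N x \<noteq> {}" "0 \<le> \<alpha>" "\<alpha> \<le> 1" "0 \<le> t" "t \<le> 1"
  shows "lazy_walk_pmf G (1 - t * (1 - \<alpha>)) x
    = bernoulli_pmf t \<bind> (\<lambda>b. if b then lazy_walk_pmf G \<alpha> x else return_pmf x)"
proof (rule pmf_eqI)
  fix z
  have "0 \<le> t * (1 - \<alpha>)" "t * (1 - \<alpha>) \<le> 1"
    using assms by (auto intro!: mult_le_one)
  then show "pmf (lazy_walk_pmf G (1 - t * (1 - \<alpha>)) x) z
    = pmf (bernoulli_pmf t \<bind> (\<lambda>b. if b then lazy_walk_pmf G \<alpha> x else return_pmf x)) z"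
    using assms by (auto simp: pmf_bind pmf_lazy_walk) (auto simp: algebra_simps)
qed

abbreviation transport :: "real \<Rightarrow> 'a \<Rightarrow> 'a \<Rightarrow> real" where
  "transport \<alpha> x y \<equiv> wasserstein gdist (lazy_walk_pmf G \<alpha> x) (lazy_walk_pmf G \<alpha> y)"

lemma transport_mix:
  assumes xy: "adj x y" and \<alpha>: "0 \<le> \<alpha>" "\<alpha> \<le> 1" and t: "0 < t" "t \<le> 1"
  shows "transport (1 - t * (1 - \<alpha>)) x y \<le> t * transport \<alpha> x y + (1 - t)"
proof -
  have ne: "N x \<noteq> {}" "N y \<noteq> {}" using xy adj_sym[OF xy] by auto
  have tb: "0 \<le> t * (1 - \<alpha>)" "t * (1 - \<alpha>) \<le> 1"
    using \<alpha> t by (auto intro!: mult_le_one)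
  let ?\<mu> = "lazy_walk_pmf G \<alpha> x" and ?\<nu> = "lazy_walk_pmf G \<alpha> y"
  let ?\<mu>' = "lazy_walk_pmf G (1 - t * (1 - \<alpha>)) x" and ?\<nu>' = "lazy_walk_pmf G (1 - t * (1 - \<alpha>)) y"
  have "(transport (1 - t * (1 - \<alpha>)) x y - (1 - t)) / t \<le> transport \<alpha> x y"
  proof (rule le_wassersteinI)
    fix \<pi> assume \<pi>: "\<pi> \<in> couplings ?\<mu> ?\<nu>"
    let ?\<pi> = "bernoulli_pmf t \<bind> (\<lambda>b. if b then \<pi> else return_pmf (x, y))"
    have fin: "finite (set_pmf \<pi>)"
      by (rule finite_coupling[OF \<pi>]) (use ne \<alpha> in \<open>auto intro: finite_set_lazy_walk\<close>)
    have "?\<pi> \<in> couplings ?\<mu>' ?\<nu>'"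
      using \<pi> ne \<alpha> t by (simp add: couplings_def map_bind_pmf lazy_walk_mix if_distrib cong: if_cong)
    then have "transport (1 - t * (1 - \<alpha>)) x y \<le> measure_pmf.expectation ?\<pi> (\<lambda>(u, v). gdist u v)"
      by (rule wasserstein_le_coupling) (use ne tb in \<open>auto intro!: finite_set_lazy_walk\<close>)
    also have "\<dots> = t * measure_pmf.expectation \<pi> (\<lambda>(u, v). gdist u v) + (1 - t) * gdist x y"
      using t fin by (subst pmf_expectation_bind[where A = UNIV]) (auto simp: UNIV_bool split: if_splits)
    finally show "(transport (1 - t * (1 - \<alpha>)) x y - (1 - t)) / t
        \<le> measure_pmf.expectation \<pi> (\<lambda>(u, v). gdist u v)"
      using t dist_adj[OF xy] by (simp add: field_simps)
  qed (use ne \<alpha> in \<open>auto intro: finite_set_lazy_walk\<close>)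
  then show ?thesis using t by (simp add: field_simps)
qed

abbreviation laplacian :: "('a \<Rightarrow> real) \<Rightarrow> 'a \<Rightarrow> real" where
  "laplacian f x \<equiv> (\<Sum>z\<in>N x. f z - f x) / real (card (N x))"

text \<open>As \<open>f\<close> rises by one along the edge, the difference of its two expectations
  is 1 + (1 - \<alpha>) times the difference of the Laplacians; duality bounds this by the transport
  cost, and the factor 1 - \<alpha> cancels.\<close>

lemma alpha_curvature_le:
  assumes xy: "adj x y" and \<alpha>: "0 \<le> \<alpha>" "\<alpha> < 1" and f: "f y = f x + 1"
    and lip: "\<And>u v. u \<in> insert x (N x) \<Longrightarrow> v \<in> insert y (N y) \<Longrightarrow> f v - f u \<le> gdist u v"
  shows "alpha_curvature G \<alpha> x y / (1 - \<alpha>) \<le> laplacian f x - laplacian f y"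
proof -
  have ne: "N x \<noteq> {}" "N y \<noteq> {}" using xy adj_sym[OF xy] by auto
  have E: "measure_pmf.expectation (lazy_walk_pmf G \<alpha> z) f = f z + (1 - \<alpha>) * laplacian f z"
    if "N z \<noteq> {}" for z
    using that \<alpha> by (subst expectation_lazy_walk) (auto simp: sum_subtractf field_simps)
  have "measure_pmf.expectation (lazy_walk_pmf G \<alpha> y) f - measure_pmf.expectation (lazy_walk_pmf G \<alpha> x) f
      \<le> transport \<alpha> x y"
    by (rule kantorovich_le_wasserstein)
       (use ne \<alpha> set_lazy_walk[of x \<alpha>] set_lazy_walk[of y \<alpha>] in \<open>auto intro!: finite_set_lazy_walk lip\<close>)
  then have "alpha_curvature G \<alpha> x y \<le> (1 - \<alpha>) * (laplacian f x - laplacian f y)"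
    using f by (simp add: E ne alpha_curvature_def dist_adj[OF xy] right_diff_distrib)
  then show ?thesis using \<alpha> by (simp add: field_simps)
qed

lemma alpha_curvature_mono:
  assumes xy: "adj x y" and "0 \<le> \<alpha>" "\<alpha> \<le> \<beta>" "\<beta> < 1"
  shows "alpha_curvature G \<alpha> x y / (1 - \<alpha>) \<le> alpha_curvature G \<beta> x y / (1 - \<beta>)"
proof -
  define t where "t = (1 - \<beta>) / (1 - \<alpha>)"
  have t: "0 < t" "t \<le> 1" "1 - t * (1 - \<alpha>) = \<beta>" "1 - \<beta> = t * (1 - \<alpha>)"
    using assms by (auto simp: t_def field_simps)
  have "transport \<beta> x y \<le> t * transport \<alpha> x y + (1 - t)"
    using transport_mix[OF xy _ _ t(1,2), of \<alpha>] assms t(3) by simp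
  then have "t * alpha_curvature G \<alpha> x y \<le> alpha_curvature G \<beta> x y"
    using dist_adj[OF xy] by (simp add: alpha_curvature_def algebra_simps)
  then have "t * alpha_curvature G \<alpha> x y / (1 - \<beta>) \<le> alpha_curvature G \<beta> x y / (1 - \<beta>)"
    using assms by (intro divide_right_mono) auto
  then show ?thesis using t(1) by (simp add: t(4))
qed

text \<open>The difference quotient increases with \<open>\<alpha>\<close> because mixing with the trivial transport from
  \<open>x\<close> to \<open>y\<close> turns a coupling for \<open>\<alpha>\<close> into one for every larger idleness.\<close>

lemma lly_curvature_tendsto:
  assumes xy: "adj x y"
  shows "((\<lambda>\<alpha>. alpha_curvature G \<alpha> x y / (1 - \<alpha>)) \<longlongrightarrow> lly_curvature G x y) (at_left 1)"
proof -
  let ?g = "\<lambda>\<alpha>. alpha_curvature G \<alpha> x y / (1 - \<alpha>)"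
  \<comment> \<open>The indicator of \<open>y\<close> is a crude admissible potential; it serves to
    bound the quotient from above.\<close>
  let ?f = "\<lambda>z. if z = y then 1 else 0 :: real"
  have bound: "?g \<alpha> \<le> laplacian ?f x - laplacian ?f y" if "0 \<le> \<alpha>" "\<alpha> < 1" for \<alpha>
  proof (rule alpha_curvature_le[OF xy that])
    fix u v assume "u \<in> insert x (N x)" "v \<in> insert y (N y)"
    then have "u \<in> verts G" "v \<in> verts G" using xy adj_verts by auto
    then show "?f v - ?f u \<le> gdist u v" using dist_ge_1[of u v] by (cases "u = v") auto
  qed (use adj_neq[OF xy] in auto)
  have "(?g \<longlongrightarrow> Sup (?g ` ({..<1} \<inter> {0..}))) (at 1 within ({..<1} \<inter> {0..}))"
    by (rule Lim_left_bound[where K = "laplacian ?f x - laplacian ?f y"])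
       (use alpha_curvature_mono[OF xy] bound in auto)
  \<comment> \<open>Monotonicity holds for idleness in [0, 1), so the limit is first taken within
    that interval; near 1 this is the left-sided limit of the definition.\<close>
  moreover have "at 1 within ({..<1} \<inter> {0..}) = at_left (1::real)"
    by (rule at_within_nhd[of _ "{0<..}"]) auto
  ultimately have "(?g \<longlongrightarrow> Sup (?g ` ({..<1} \<inter> {0..}))) (at_left 1)" by simp
  moreover from this have "lly_curvature G x y = Sup (?g ` ({..<1} \<inter> {0..}))"
    unfolding lly_curvature_def by (rule tendsto_Lim[rotated]) simp
  ultimately show ?thesis by simp
qed

lemma alpha_curvature_le_lly_curvature:
  assumes xy: "adj x y" and \<alpha>: "0 \<le> \<alpha>" "\<alpha> < 1"
  shows "alpha_curvature G \<alpha> x y / (1 - \<alpha>) \<le> lly_curvature G x y"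
proof (rule tendsto_lowerbound[OF lly_curvature_tendsto[OF xy]])
  have "\<forall>\<^sub>F \<beta> in at_left 1. \<beta> \<in> {\<alpha><..<1}" by (rule eventually_at_left_real) fact
  then show "\<forall>\<^sub>F \<beta> in at_left 1. alpha_curvature G \<alpha> x y / (1 - \<alpha>) \<le> alpha_curvature G \<beta> x y / (1 - \<beta>)"
    by eventually_elim (use alpha_curvature_mono[OF xy \<alpha>(1)] in auto)
qed simp

lemma lly_curvature_le_laplacian:
  assumes xy: "adj x y" and f: "f y = f x + 1"
    and lip: "\<And>u v. u \<in> insert x (N x) \<Longrightarrow> v \<in> insert y (N y) \<Longrightarrow> f v - f u \<le> gdist u v"
  shows "lly_curvature G x y \<le> laplacian f x - laplacian f y"
proof (rule tendsto_upperbound[OF lly_curvature_tendsto[OF xy]])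
  have "\<forall>\<^sub>F \<beta> in at_left 1. \<beta> \<in> {0<..<1::real}" by (rule eventually_at_left_real) simp
  then show "\<forall>\<^sub>F \<beta> in at_left 1. alpha_curvature G \<beta> x y / (1 - \<beta>) \<le> laplacian f x - laplacian f y"
    by eventually_elim (use alpha_curvature_le[OF xy _ _ f lip] in auto)
qed simp

end

section \<open>Local structure\<close>

locale flat_graph = conn_graph +
  assumes nonempty: "edges G \<noteq> {}"
    and flat: "ricci_flat G"
    and girth5: "girth G \<ge> 5"
begin

lemma cycle_length_ge_5: "cycle G c \<Longrightarrow> length c \<ge> 5"
proof -
  assume "cycle G c"
  then have "girth G \<le> enat (length c)" unfolding girth_def by (auto intro: INF_lower)
  then have "5 \<le> enat (length c)" using girth5 by (rule order_trans[rotated])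
  then show ?thesis by (simp add: numeral_eq_enat)
qed

lemma no_triangle: "adj u v \<Longrightarrow> adj v w \<Longrightarrow> adj w u \<Longrightarrow> False"
proof -
  assume *: "adj u v" "adj v w" "adj w u"
  have "cycle G [u, v, w]"
    using * adj_verts[OF *(1)] adj_verts[OF *(2)] adj_neq[OF *(1)] adj_neq[OF *(2)] adj_neq[OF *(3)]
    by (auto simp: cycle_def walk_def)
  then show False using cycle_length_ge_5 by fastforce
qed

lemma no_square: "adj a b \<Longrightarrow> adj b c \<Longrightarrow> adj c d \<Longrightarrow> adj d a \<Longrightarrow> a = c \<or> b = d"
proof (rule ccontr)
  assume *: "adj a b" "adj b c" "adj c d" "adj d a" and ne: "\<not> (a = c \<or> b = d)"
  have "cycle G [a, b, c, d]"
    using * ne adj_verts[OF *(1)] adj_verts[OF *(3)]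
      adj_neq[OF *(1)] adj_neq[OF *(2)] adj_neq[OF *(3)] adj_neq[OF *(4)]
    by (auto simp: cycle_def walk_def)
  then show False using cycle_length_ge_5 by fastforce
qed

lemma common_unique: "adj p u \<Longrightarrow> adj u q \<Longrightarrow> adj p v \<Longrightarrow> adj v q \<Longrightarrow> p \<noteq> q \<Longrightarrow> u = v"
  using no_square[of p u q v] adj_sym by blast

abbreviation common :: "'a \<Rightarrow> 'a \<Rightarrow> bool" where "common p q \<equiv> \<exists>w. adj p w \<and> adj w q"

lemma common_sym: "common p q \<Longrightarrow> common q p"
  using adj_sym by blast

lemma flat_edge: "adj x y \<Longrightarrow> lly_curvature G x y = 0"
  using flat by (simp add: ricci_flat_def)

text \<open>The curvature is bounded by a Kantorovich potential with values \<open>0\<close> at \<open>x\<close>, \<open>1\<close> at \<open>y\<close>, \<open>a\<close> on the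
  other neighbours of \<open>x\<close> and \<open>b\<close> on those of \<open>y\<close>; by the girth bound the latter two kinds of
  vertices are at distance \<open>2\<close> or \<open>3\<close>.\<close>

lemma potential_ineq:
  assumes xy: "adj x y"
    and a: "\<And>u. u \<in> N x - {y} \<Longrightarrow> a u \<ge> -1"
    and b: "\<And>v. v \<in> N y - {x} \<Longrightarrow> b v \<le> 2"
    and ab: "\<And>u v. u \<in> N x - {y} \<Longrightarrow> v \<in> N y - {x} \<Longrightarrow> common u v \<Longrightarrow> b v - a u \<le> 2"
  shows "((\<Sum>v\<in>N y - {x}. b v - 1) - 1) / card (N y) \<le> ((\<Sum>u\<in>N x - {y}. a u) + 1) / card (N x)"
proof -
  have yx: "adj y x" by (rule adj_sym[OF xy])
  define f where "f z = (if z = x then 0 else if z = y then 1 else if adj x z then a z else b z)" for z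
  \<comment> \<open>Without triangles, the neighbours of \<open>y\<close> other than
    \<open>x\<close> reach the last branch of \<open>f\<close>.\<close>
  have disj: "\<not> adj x z" if "adj y z" for z
    using no_triangle[of x y z] xy that adj_sym by blast
  have fx: "f x = 0" and fy: "f y = 1" using adj_neq[OF xy] by (auto simp: f_def)
  have fa: "f u = a u" if "u \<in> N x - {y}" for u
    using that adj_neq[of x u] by (auto simp: f_def)
  have fb: "f v = b v" if "v \<in> N y - {x}" for v
    using that adj_neq[of y v] disj by (auto simp: f_def)
  have "lly_curvature G x y \<le> laplacian f x - laplacian f y"
  proof (rule lly_curvature_le_laplacian[OF xy])
    fix u v assume u: "u \<in> insert x (N x)" and v: "v \<in> insert y (N y)"
    have uV: "u \<in> verts G" "v \<in> verts G" using u v xy adj_verts by auto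
    consider "u = x" "v = y" | "u = x" "v = x" | "u = y" "v = y" | "u = y" "v = x"
      | "u = x" "v \<in> N y - {x}" | "u = y" "v \<in> N y - {x}" | "u \<in> N x - {y}" "v = y"
      | "u \<in> N x - {y}" "v = x" | "u \<in> N x - {y}" "v \<in> N y - {x}"
      using u v by blast
    then show "f v - f u \<le> gdist u v"
    proof cases
      case 5
      then have "gdist u v \<ge> 2" using disj adj_neq[of y v] uV by (intro dist_ge_2) auto
      then show ?thesis using 5 b[of v] by (simp add: fx fb)
    next
      case 6
      then have "gdist u v \<ge> 1" using adj_neq[of y v] uV by (intro dist_ge_1) auto
      then show ?thesis using 6 b[of v] by (simp add: fy fb)
    next
      case 7
      then have "gdist u v \<ge> 2" using disj adj_sym uV by (intro dist_ge_2) auto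
      then show ?thesis using 7 a[of u] by (simp add: fy fa)
    next
      case 8
      then have "gdist u v \<ge> 1" using adj_neq[of x u] uV by (intro dist_ge_1) auto
      then show ?thesis using 8 a[of u] by (simp add: fx fa)
    next
      case 9
      have ne: "u \<noteq> v" using 9 disj by auto
      have na: "\<not> adj u v"
      proof
        assume "adj u v"
        then have "x = v \<or> y = u"
          using 9 xy no_square[of x u v y] adj_sym[of y v] adj_sym[of x y] by (metis DiffD1 mem_N)
        then show False using 9 by auto
      qed
      show ?thesis
      proof (cases "common u v")
        case True
        have "gdist u v \<ge> 2" by (intro dist_ge_2 uV ne na)
        then show ?thesis using ab[OF 9 True] 9 by (simp add: fa fb)
      next
        \<comment> \<open>At distance 3 the bounds \<open>a u \<ge> -1\<close> and
          \<open>b v \<le> 2\<close> already give the Lipschitz condition.\<close>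
        case False
        have "gdist u v \<ge> 3" by (intro dist_ge_3 uV ne na False)
        then show ?thesis using a[OF 9(1)] b[OF 9(2)] 9 by (simp add: fa fb)
      qed
    qed (use uV dist_ge_1[of u v] adj_neq[OF xy] fx fy in auto)
  qed (simp add: fx fy)
  moreover have "(\<Sum>z\<in>N x. f z - f x) = (\<Sum>u\<in>N x - {y}. a u) + 1"
    using xy by (subst sum.remove[of _ y]) (auto simp: fx fy intro!: sum.cong fa)
  moreover have "(\<Sum>z\<in>N y. f z - f y) = (\<Sum>v\<in>N y - {x}. b v - 1) - 1"
    using yx by (subst sum.remove[of _ x]) (auto simp: fx fy intro!: sum.cong fb)
  ultimately show ?thesis using flat_edge[OF xy] by simp
qed

lemma card_index_eq_count_list: "card ({..<length xs} \<inter> {i. xs ! i = z}) = count_list xs z"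
  by (auto simp: count_list_eq_length_filter length_filter_conv_card intro!: arg_cong[of _ _ card])

text \<open>The list \<open>L\<close> is a coupling: each entry moves the mass \<open>1 / length L\<close> from its first to its
  second component.\<close>

lemma coupling_cost_ge:
  assumes xy: "adj x y" and \<alpha>: "0 \<le> \<alpha>" "\<alpha> < 1" and ne: "L \<noteq> []"
    and \<mu>: "\<And>z. real (count_list (map fst L) z) = length L * pmf (lazy_walk_pmf G \<alpha> x) z"
    and \<nu>: "\<And>z. real (count_list (map snd L) z) = length L * pmf (lazy_walk_pmf G \<alpha> y) z"
  shows "(\<Sum>(u, v)\<leftarrow>L. gdist u v) \<ge> length L"
proof -
  let ?U = "pmf_of_set {..<length L}"
  let ?\<pi> = "map_pmf ((!) L) ?U"
  have U: "{..<length L} \<noteq> {}" "finite {..<length L}" using ne by (auto simp: lessThan_empty_iff)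
  have m: "map_pmf f ?\<pi> = \<kappa>"
    if "\<And>z. real (count_list (map f L) z) = length L * pmf \<kappa> z" for f and \<kappa> :: "'a pmf"
  proof (rule pmf_eqI)
    fix z
    have "pmf (map_pmf f ?\<pi>) z = card ({..<length L} \<inter> {i. f (L ! i) = z}) / length L"
      using U by (simp add: pmf.map_comp pmf_map measure_pmf_of_set vimage_def)
    also have "{..<length L} \<inter> {i. f (L ! i) = z} = {..<length (map f L)} \<inter> {i. map f L ! i = z}"
      by auto
    finally show "pmf (map_pmf f ?\<pi>) z = pmf \<kappa> z"
      using that[of z] ne by (simp add: card_index_eq_count_list del: length_map)
  qed
  have "?\<pi> \<in> couplings (lazy_walk_pmf G \<alpha> x) (lazy_walk_pmf G \<alpha> y)"
    using m[OF \<mu>] m[OF \<nu>] by (simp add: couplings_def)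
  then have "transport \<alpha> x y \<le> measure_pmf.expectation ?\<pi> (\<lambda>(u, v). gdist u v)"
    by (rule wasserstein_le_coupling)
       (use \<alpha> xy adj_sym[OF xy] in \<open>auto intro!: finite_set_lazy_walk\<close>)
  also have "\<dots> = (\<Sum>(u, v)\<leftarrow>L. gdist u v) / length L"
    using U by (simp add: integral_pmf_of_set sum_list_sum_nth lessThan_atLeast0)
  finally have "transport \<alpha> x y \<le> (\<Sum>(u, v)\<leftarrow>L. gdist u v) / length L" .
  \<comment> \<open>The quotients increase to the limit 0, so none is positive: no coupling is
    cheaper than the cost 1 of moving all mass along the edge.\<close>
  moreover have "alpha_curvature G \<alpha> x y / (1 - \<alpha>) \<le> 0"
    using alpha_curvature_le_lly_curvature[OF xy \<alpha>] flat_edge[OF xy] by simp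
  then have "transport \<alpha> x y \<ge> 1"
    using \<alpha> dist_adj[OF xy] by (simp add: alpha_curvature_def divide_le_0_iff)
  ultimately have "1 \<le> (\<Sum>(u, v)\<leftarrow>L. gdist u v) / length L" by simp
  then show ?thesis using ne by (simp add: le_divide_eq)
qed

abbreviation deg :: "'a \<Rightarrow> nat" where "deg x \<equiv> card (N x)"

lemma count_list_replicate: "count_list (replicate n x) z = (if x = z then n else 0)"
  by (induction n) auto

lemma deg_neq_1:
  assumes xy: "adj x y"
  shows "deg x \<noteq> 1"
proof
  assume "deg x = 1"
  then have Nx: "N x = {y}" using xy by (metis card_1_singletonE mem_N singletonD)
  have ax: "adj x z \<longleftrightarrow> z = y" for z using Nx by (metis mem_N singleton_iff)
  obtain vs where vs: "set vs = N y" "distinct vs" using finite_distinct_list[OF finite_N] by blast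
  have len: "length vs = deg y" using vs distinct_card by metis
  have pos: "deg y > 0" using adj_sym[OF xy] by (metis card_gt_0_iff empty_iff finite_N mem_N)
  \<comment> \<open>At idleness 1/2 both measures give \<open>y\<close> mass 1/2, which stays. The
    rest, at the leaf \<open>x\<close>, is spread evenly over the neighbours of \<open>y\<close>:
    the share of \<open>x\<close> is free and every other share costs at most 2. The total is at
    most 2 (\<open>deg y\<close> - 1), below the length 2 \<open>deg y\<close>.\<close>
  let ?L = "replicate (deg y) (y, y) @ map (Pair x) vs"
  have c: "count_list vs z = (if adj y z then 1 else 0)" for z
    using vs by (auto simp: distinct_count_atmost_1 count_list_0_iff simp flip: count_mset)
  have "(\<Sum>(u, v)\<leftarrow>?L. gdist u v) \<ge> length ?L"
  proof (rule coupling_cost_ge[OF xy, where \<alpha> = "1/2"])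
    fix z
    show "real (count_list (map fst ?L) z) = length ?L * pmf (lazy_walk_pmf G (1/2) x) z"
      using pos adj_neq[OF xy]
      by (auto simp: pmf_lazy_walk Nx ax len comp_def map_replicate_const count_list_replicate count_list_0_iff)
    show "real (count_list (map snd ?L) z) = length ?L * pmf (lazy_walk_pmf G (1/2) y) z"
      using pos adj_sym[OF xy]
      by (subst pmf_lazy_walk) (auto simp: len comp_def c map_replicate_const count_list_replicate count_list_0_iff)
  qed (use pos in auto)
  moreover have "(\<Sum>(u, v)\<leftarrow>?L. gdist u v) = (\<Sum>v\<in>N y. gdist x v)"
    using adj_verts(2)[OF xy] vs by (simp add: sum_list_distinct_conv_sum_set comp_def sum_list_replicate)
  moreover have "\<dots> = (\<Sum>v\<in>N y - {x}. gdist x v)"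
    using adj_sym[OF xy] adj_verts(1)[OF xy] by (subst sum.remove[of _ x]) auto
  moreover have "\<dots> \<le> (\<Sum>v\<in>N y - {x}. 2)"
  proof (rule sum_mono)
    fix v assume "v \<in> N y - {x}"
    then show "gdist x v \<le> 2" using dist_common[OF xy, of v] by auto
  qed
  moreover have "(\<Sum>v\<in>N y - {x}. 2::real) = 2 * (real (deg y) - 1)"
    using adj_sym[OF xy] pos by (simp add: card_Diff_singleton of_nat_diff)
  ultimately show False by (simp add: len)
qed

end

section \<open>Degrees and pentagons at an edge\<close>

context flat_graph begin

lemma deg_pos: "adj x y \<Longrightarrow> deg x > 0"
  by (metis card_gt_0_iff empty_iff finite_N mem_N)

text \<open>The potential is 0 on the other neighbours of \<open>x\<close> and 2 on those of
  \<open>y\<close>: a difference of 2 is admissible whether or not there are pentagons.\<close>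

lemma deg_ineq:
  assumes xy: "adj x y"
  shows "1 \<le> 1 / real (deg x) + 2 / real (deg y)"
proof -
  have yx: "adj y x" by (rule adj_sym[OF xy])
  have pos: "deg x > 0" "deg y > 0" using deg_pos xy yx by auto
  have "((\<Sum>v\<in>N y - {x}. 2 - 1) - 1) / real (deg y) \<le> ((\<Sum>u\<in>N x - {y}. 0) + 1) / real (deg x)"
    by (rule potential_ineq[OF xy]) auto
  moreover have "(\<Sum>v\<in>N y - {x}. 2 - 1 :: real) = real (deg y) - 1"
    using yx pos by (simp add: card_Diff_singleton of_nat_diff)
  moreover have "N y \<noteq> {}" using yx by auto
  ultimately show ?thesis using pos by (simp add: diff_divide_distrib)
qed

lemma deg_ge_2: "adj x y \<Longrightarrow> deg x \<ge> 2"
  using deg_pos[of x y] deg_neq_1[of x y] by linarith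

text \<open>With leaves excluded, \<open>deg_ineq\<close> in both directions leaves only these
  pairs. Degree at least 5 gives at most 1/2 + 2/5, and a degree at least 4 next to one at least 3
  gives at most 1/3 + 2/4 in one direction and 1/4 + 2/3 in the other, all below 1.\<close>

lemma deg_cases:
  assumes xy: "adj x y"
  shows "(deg x, deg y) \<in> {(2,2), (2,3), (3,2), (2,4), (4,2), (3,3)}"
proof -
  have b: "deg u \<le> 4 \<and> (deg u \<ge> 3 \<longrightarrow> deg v \<le> 3) \<and> (deg u \<ge> 4 \<longrightarrow> deg v \<le> 2)" if uv: "adj u v" for u v
  proof -
    have d: "2 \<le> deg u" "2 \<le> deg v" using deg_ge_2 uv adj_sym[OF uv] by blast+
    have 1: "1 \<le> 1 / real (deg u) + 2 * (1 / real (deg v))" and 2: "1 \<le> 1 / real (deg v) + 2 * (1 / real (deg u))"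
      using deg_ineq[OF uv] deg_ineq[OF adj_sym[OF uv]] by auto
    have inv: "1 / real n \<le> 1 / real k" if "k \<le> n" "0 < k" for n k
      using that by (simp add: frac_le)
    have "deg u \<le> 4"
    proof (rule ccontr)
      assume "\<not> deg u \<le> 4"
      then have "1 / real (deg u) \<le> 1 / 5" "1 / real (deg v) \<le> 1 / 2"
        using inv[of 5 "deg u"] inv[of 2 "deg v"] d by auto
      then show False using 2 by linarith
    qed
    moreover have "deg v \<le> 3" if "deg u \<ge> 3"
    proof (rule ccontr)
      assume "\<not> deg v \<le> 3"
      then have "1 / real (deg v) \<le> 1 / 4" "1 / real (deg u) \<le> 1 / 3"
        using inv[of 4 "deg v"] inv[of 3 "deg u"] that by auto
      then show False using 1 by linarith
    qed
    moreover have "deg v \<le> 2" if "deg u \<ge> 4"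
    proof (rule ccontr)
      assume "\<not> deg v \<le> 2"
      then have "1 / real (deg v) \<le> 1 / 3" "1 / real (deg u) \<le> 1 / 4"
        using inv[of 3 "deg v"] inv[of 4 "deg u"] that by auto
      then show False using 2 by linarith
    qed
    ultimately show ?thesis by blast
  qed
  have "deg x \<ge> 2" "deg y \<ge> 2" using deg_ge_2 xy adj_sym[OF xy] by blast+
  moreover note b[OF xy] b[OF adj_sym[OF xy]]
  ultimately have "(deg x = 2 \<or> deg x = 3 \<or> deg x = 4) \<and> (deg y = 2 \<or> deg y = 3 \<or> deg y = 4)
    \<and> (deg x \<ge> 3 \<longrightarrow> deg y \<le> 3) \<and> (deg x \<ge> 4 \<longrightarrow> deg y \<le> 2) \<and> (deg y \<ge> 4 \<longrightarrow> deg x \<le> 2)"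
    by linarith
  then show ?thesis by auto
qed

lemma edge_22:
  assumes Nx: "N x = {y, x1}" and Ny: "N y = {x, y1}" and ne: "x1 \<noteq> y" "y1 \<noteq> x"
  shows "\<not> common x1 y1"
proof
  assume c: "common x1 y1"
  have ax: "adj x z \<longleftrightarrow> z = y \<or> z = x1" for z using Nx by (metis mem_N insert_iff singleton_iff)
  have ay: "adj y z \<longleftrightarrow> z = x \<or> z = y1" for z using Ny by (metis mem_N insert_iff singleton_iff)
  have xy: "adj x y" using ax by simp
  \<comment> \<open>Idleness 1/3 makes all six masses equal. Only \<open>x1\<close> moves, at cost
    at most 2, against the required 3.\<close>
  let ?L = "[(x, x), (y, y), (x1, y1)]"
  have dist: "x \<noteq> y" "x \<noteq> x1" "y \<noteq> y1"
    using adj_neq[of x y] adj_neq[of x x1] adj_neq[of y y1] ax ay by auto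
  have card: "card {y, x1} = 2" "card {x, y1} = 2" using ne by auto
  have "(\<Sum>(u, v)\<leftarrow>?L. gdist u v) \<ge> length ?L"
  proof (rule coupling_cost_ge[OF xy, where \<alpha> = "1/3"])
    fix z
    show "real (count_list (map fst ?L) z) = length ?L * pmf (lazy_walk_pmf G (1/3) x) z"
      using dist ne card by (subst pmf_lazy_walk) (auto simp: Nx ax)
    show "real (count_list (map snd ?L) z) = length ?L * pmf (lazy_walk_pmf G (1/3) y) z"
      using dist ne card by (subst pmf_lazy_walk) (auto simp: Ny ay)
  qed auto
  moreover have "gdist x1 y1 \<le> 2" using c dist_common by fastforce
  ultimately show False using adj_verts[OF xy] by simp
qed

lemma edge_23:
  assumes Nx: "N x = {y, x1}" and Ny: "N y = {x, y1, y2}"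
    and ne: "x1 \<noteq> y" "y1 \<noteq> x" "y2 \<noteq> x" "y1 \<noteq> y2"
  shows "common x1 y1 \<longleftrightarrow> \<not> common x1 y2"
proof (rule ccontr)
  have ax: "adj x z \<longleftrightarrow> z = y \<or> z = x1" for z using Nx by (metis mem_N insert_iff singleton_iff)
  have ay: "adj y z \<longleftrightarrow> z = x \<or> z = y1 \<or> z = y2" for z
    using Ny by (metis mem_N insert_iff singleton_iff)
  have xy: "adj x y" using ax by simp
  have dist: "x \<noteq> y" "x \<noteq> x1" "y \<noteq> y1" "y \<noteq> y2"
    using adj_neq[of x y] adj_neq[of x x1] adj_neq[of y y1] adj_neq[of y y2] ax ay by auto
  have card: "card {y, x1} = 2" "card {x, y1, y2} = 3" using ne by auto
  assume "\<not> (common x1 y1 \<longleftrightarrow> \<not> common x1 y2)"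
  then consider "common x1 y1" "common x1 y2" | "\<not> common x1 y1" "\<not> common x1 y2" by blast
  then show False
  proof cases
    case 1
    \<comment> \<open>In units of 1/8, idleness 1/4 puts 2, 3, 3 on \<open>x\<close>,
      \<open>y\<close>, \<open>x1\<close> and, for the other walk, 2 on each of \<open>x\<close>,
      \<open>y\<close>, \<open>y1\<close>, \<open>y2\<close>. With both pentagons present the moves
      cost 1 + 2 + 2 + 2 = 7 < 8.\<close>
    let ?L = "[(x, x), (x, x), (y, y), (y, y), (y, y1), (x1, y1), (x1, y2), (x1, y2)]"
    have "(\<Sum>(u, v)\<leftarrow>?L. gdist u v) \<ge> length ?L"
    proof (rule coupling_cost_ge[OF xy, where \<alpha> = "1/4"])
      fix z
      show "real (count_list (map fst ?L) z) = length ?L * pmf (lazy_walk_pmf G (1/4) x) z"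
        using dist ne card by (subst pmf_lazy_walk) (auto simp: Nx ax)
      show "real (count_list (map snd ?L) z) = length ?L * pmf (lazy_walk_pmf G (1/4) y) z"
        using dist ne card by (subst pmf_lazy_walk) (auto simp: Ny ay)
    qed auto
    moreover have "gdist x1 y1 \<le> 2" "gdist x1 y2 \<le> 2" using 1 dist_common by fastforce+
    moreover have "gdist y y1 = 1" using dist_adj[of y y1] ay by simp
    ultimately show False using adj_verts[OF xy] by simp
  next
    case 2
    \<comment> \<open>Without a pentagon the steepest potential, -1 at \<open>x1\<close> and 2 at
      \<open>y1\<close>, \<open>y2\<close>, is admissible; it would give 1/3 \<le> 0.\<close>
    have "((\<Sum>v\<in>N y - {x}. 2 - 1) - 1) / real (deg y) \<le> ((\<Sum>u\<in>N x - {y}. - 1) + 1) / real (deg x)"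
      by (rule potential_ineq[OF xy]) (use 2 in \<open>auto simp: ax ay\<close>)
    moreover have "N y - {x} = {y1, y2}" "N x - {y} = {x1}" using Nx Ny ne dist by auto
    ultimately show False using ne card by (simp add: Nx Ny)
  qed
qed

lemma edge_24:
  assumes Nx: "N x = {y, x1}" and Ny: "N y = {x, y1, y2, y3}" and "x1 \<noteq> y"
    and ne: "distinct [x, y1, y2, y3]" and nc: "\<not> common x1 y1"
  shows "common x1 y2 \<and> common x1 y3"
proof (rule ccontr)
  assume n: "\<not> (common x1 y2 \<and> common x1 y3)"
  have ax: "adj x z \<longleftrightarrow> z = y \<or> z = x1" for z using Nx by (metis mem_N insert_iff singleton_iff)
  have ay: "adj y z \<longleftrightarrow> z = x \<or> z = y1 \<or> z = y2 \<or> z = y3" for z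
    using Ny by (metis mem_N insert_iff singleton_iff)
  have xy: "adj x y" using ax by simp
  have card: "card {y, x1} = 2" "card {x, y1, y2, y3} = 4" using ne \<open>x1 \<noteq> y\<close> by auto
  \<comment> \<open>The potential drops from 2 to 1 exactly where the distance to \<open>x1\<close>
    is only 2. The inequality says that the three values add up to at most 4, so at least two of
    them are 1.\<close>
  let ?b = "\<lambda>v. if common x1 v then 1 else 2 :: real"
  have "((\<Sum>v\<in>N y - {x}. ?b v - 1) - 1) / real (deg y) \<le> ((\<Sum>u\<in>N x - {y}. - 1) + 1) / real (deg x)"
    by (rule potential_ineq[OF xy]) (auto simp: ax)
  moreover have "N y - {x} = {y1, y2, y3}" "N x - {y} = {x1}" using Nx Ny ne \<open>x1 \<noteq> y\<close> by auto
  ultimately have "?b y1 + ?b y2 + ?b y3 \<le> 4"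
    using ne card by (simp add: Nx Ny del: bex_simps ex_simps)
  then show False using n nc by (auto split: if_splits)
qed

lemma edge_33_common:
  assumes Nx: "N x = {y, x1, x2}" and Ny: "N y = {x, y1, y2}"
    and ne: "distinct [y, x1, x2]" "distinct [x, y1, y2]"
  shows "common x1 y1 \<or> common x1 y2"
proof (rule ccontr)
  assume n: "\<not> (common x1 y1 \<or> common x1 y2)"
  have ax: "adj x z \<longleftrightarrow> z = y \<or> z = x1 \<or> z = x2" for z
    using Nx by (metis mem_N insert_iff singleton_iff)
  have ay: "adj y z \<longleftrightarrow> z = x \<or> z = y1 \<or> z = y2" for z
    using Ny by (metis mem_N insert_iff singleton_iff)
  have xy: "adj x y" using ax by simp
  \<comment> \<open>The value -1 is admissible at \<open>x1\<close> precisely when it is at distance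
    3 from both \<open>y1\<close> and \<open>y2\<close>; the outcome is again 1/3 \<le> 0.\<close>
  let ?a = "\<lambda>u. if u = x1 then -1 else 0 :: real"
  have "((\<Sum>v\<in>N y - {x}. 2 - 1) - 1) / real (deg y) \<le> ((\<Sum>u\<in>N x - {y}. ?a u) + 1) / real (deg x)"
    by (rule potential_ineq[OF xy]) (use n in \<open>auto simp: ax ay\<close>)
  moreover have "N y - {x} = {y1, y2}" "N x - {y} = {x1, x2}" using Nx Ny ne by auto
  ultimately show False using ne by (auto simp: Nx Ny)
qed

text \<open>By \<open>edge_33_common\<close>, applied from both ends of the edge, none of the four
  outer vertices is without a partner; in a bipartite graph on 2 + 2 vertices this forces a perfect
  matching.\<close>

lemma edge_33:
  assumes Nx: "N x = {y, x1, x2}" and Ny: "N y = {x, y1, y2}"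
    and ne: "distinct [y, x1, x2]" "distinct [x, y1, y2]"
  shows "common x1 y1 \<and> common x2 y2 \<or> common x1 y2 \<and> common x2 y1"
proof -
  have 1: "common x1 y1 \<or> common x1 y2" by (rule edge_33_common[OF assms])
  have 2: "common x2 y1 \<or> common x2 y2"
    by (rule edge_33_common[of x y x2 x1 y1 y2]) (use assms in auto)
  have 3: "common y1 x1 \<or> common y1 x2"
    by (rule edge_33_common[of y x y1 y2 x1 x2]) (use assms in auto)
  have 4: "common y2 x1 \<or> common y2 x2"
    by (rule edge_33_common[of y x y2 y1 x1 x2]) (use assms in auto)
  show ?thesis using 1 2 3 4 common_sym by blast
qed

end

section \<open>Isomorphisms recognised from neighbourhoods\<close>

context conn_graph begin

lemma closed_eq_verts:
  assumes "s \<in> S" "S \<subseteq> verts G" and closed: "\<And>x. x \<in> S \<Longrightarrow> N x \<subseteq> S"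
  shows "S = verts G"
proof
  show "verts G \<subseteq> S"
  proof
    fix v assume "v \<in> verts G"
    then obtain p where p: "walk G p" "hd p = s" "last p = v"
      using connected assms(1,2) unfolding connected_graph_def by blast
    have "successively adj p \<Longrightarrow> p \<noteq> [] \<Longrightarrow> hd p \<in> S \<Longrightarrow> set p \<subseteq> S" for p
    proof (induction p)
      case (Cons x p)
      then have "a \<in> S" if "adj x a" for a using closed[of x] that by auto
      then show ?case using Cons by (cases p) auto
    qed simp
    then show "v \<in> S" using p assms(1) unfolding walk_def by (metis last_in_set subsetD)
  qed
qed fact

text \<open>Surjectivity need not be checked: the neighbourhood condition makes the image of
  \<open>g\<close> closed under adjacency, and \<open>G\<close> is connected.\<close>

lemma graph_isomorphicI:
  fixes g :: "'i \<Rightarrow> 'a" and h :: "'i \<Rightarrow> 'b"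
  assumes "I \<noteq> {}" and g: "inj_on g I" and h: "bij_betw h I (verts H)" and V: "g ` I \<subseteq> verts G"
    and nb: "\<And>i. i \<in> I \<Longrightarrow> N (g i) = g ` {j\<in>I. {h i, h j} \<in> edges H}"
  shows "graph_isomorphic G H"
proof -
  obtain i0 where "i0 \<in> I" using assms(1) by blast
  then have "g ` I = verts G"
    by (intro closed_eq_verts[of "g i0"]) (use V nb in auto)
  then have bij: "bij_betw g I (verts G)" using g by (simp add: bij_betw_def)
  let ?k = "inv_into I g"
  have k: "bij_betw ?k (verts G) I" by (rule bij_betw_inv_into[OF bij])
  have gk: "g (?k x) = x" if "x \<in> verts G" for x
    using that bij by (simp add: bij_betw_inv_into_right)
  have kI: "?k x \<in> I" if "x \<in> verts G" for x using that k by (auto simp: bij_betw_def)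
  show ?thesis unfolding graph_isomorphic_def
  proof (intro exI[of _ "h \<circ> ?k"] conjI ballI)
    show "bij_betw (h \<circ> ?k) (verts G) (verts H)" by (rule bij_betw_trans[OF k h])
    fix x y assume x: "x \<in> verts G" and y: "y \<in> verts G"
    have "adj x y \<longleftrightarrow> y \<in> N (g (?k x))" by (simp add: gk x)
    also have "\<dots> \<longleftrightarrow> (\<exists>j\<in>I. {h (?k x), h j} \<in> edges H \<and> g j = y)" by (auto simp: nb kI x)
    also have "\<dots> \<longleftrightarrow> {h (?k x), h (?k y)} \<in> edges H"
      using gk[OF y] kI[OF y] g by (metis inj_onD)
    finally show "adj x y \<longleftrightarrow> {(h \<circ> ?k) x, (h \<circ> ?k) y} \<in> edges H" by simp
  qed
qed

lemma N_eq_2E: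
  assumes "adj x y" "card (N x) = 2"
  obtains z where "N x = {y, z}" "z \<noteq> y"
proof -
  have "card (N x - {y}) = 1" using assms by (simp add: card_Diff_singleton)
  then obtain z where "N x - {y} = {z}" by (rule card_1_singletonE)
  then show ?thesis using assms(1) that[of z] by (metis Diff_iff insert_Diff mem_N singletonI)
qed

lemma N_eq_3E:
  assumes "adj x y" "card (N x) = 3"
  obtains z w where "N x = {y, z, w}" "distinct [y, z, w]"
proof -
  have "card (N x - {y}) = 2" using assms by (simp add: card_Diff_singleton)
  then obtain z w where "N x - {y} = {z, w}" "z \<noteq> w" by (metis card_2_iff)
  moreover from this have "N x = {y, z, w}" "y \<noteq> z" "y \<noteq> w"
    using assms(1) by (metis insert_Diff mem_N, blast+)
  ultimately show ?thesis using that by auto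
qed

lemma N_eq_3E':
  assumes "adj x y" "adj x y'" "y \<noteq> y'" "card (N x) = 3"
  obtains z where "N x = {y, y', z}" "distinct [y, y', z]"
proof -
  obtain z w where zw: "N x = {y, z, w}" "distinct [y, z, w]" by (rule N_eq_3E[OF assms(1,4)])
  then have "y' = z \<or> y' = w" using assms(2,3) by (metis insertE mem_N singletonD)
  then show ?thesis using zw that[of z] that[of w] by (auto simp: insert_commute)
qed

lemma adj_N_eq: "N x = A \<Longrightarrow> adj x z \<longleftrightarrow> z \<in> A"
  by (metis mem_N)

end

context flat_graph begin

subsection \<open>Degree four\<close>

text \<open>The neighbours of \<open>y\<close> have degree two. By \<open>edge_24\<close> each of
  their four far ends is adjacent to at least two of the others, and a graph on four vertices with
  this property contains a 4-cycle.\<close>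

lemma deg_neq_4: "deg y \<noteq> 4"
proof
  assume y4: "deg y = 4"
  obtain xs where xs: "set xs = N y" "distinct xs" using finite_distinct_list[OF finite_N] by blast
  then have "length xs = 4" using y4 distinct_card by metis
  then obtain x1 x2 x3 x4 where "xs = [x1, x2, x3, x4]"
    by (auto simp: numeral_eq_Suc length_Suc_conv)
  then have Ny: "N y = {x1, x2, x3, x4}" and ds: "distinct [x1, x2, x3, x4]" using xs by auto
  have "\<exists>z. N x = {y, z} \<and> z \<noteq> y" if "x \<in> N y" for x
  proof -
    have "deg x = 2" using deg_cases[of y x] that y4 by auto
    then show ?thesis using N_eq_2E[of x y] that adj_sym[of y x] by (metis mem_N)
  qed
  then obtain z where z: "\<And>x. x \<in> N y \<Longrightarrow> N x = {y, z x}" "\<And>x. x \<in> N y \<Longrightarrow> z x \<noteq> y" by metis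
  have zadj: "adj x (z x)" "adj (z x) x" if "x \<in> N y" for x
  proof -
    show "adj x (z x)" using z(1)[OF that] by (simp add: adj_N_eq)
    then show "adj (z x) x" by (rule adj_sym)
  qed
  have yz: "\<not> adj y (z x)" if "x \<in> N y" for x
    using no_triangle[of y x "z x"] that zadj[OF that] adj_sym[of y "z x"] by auto
  \<comment> \<open>The only neighbours of \<open>v\<close> are \<open>y\<close> and
    \<open>z v\<close>, and \<open>z u\<close> is not adjacent to \<open>y\<close>.\<close>
  have cz: "common (z u) v \<longleftrightarrow> adj (z u) (z v)" if "u \<in> N y" "v \<in> N y" for u v
    using that zadj(1)[of v] adj_N_eq[OF z(1)[OF that(2)]] yz[of u] adj_sym
    by (metis insertE singletonD)
  have zinj: "z u \<noteq> z v" if "u \<in> N y" "v \<in> N y" "u \<noteq> v" for u v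
    using that z(2)[of u] zadj no_square[of y u "z u" v] adj_sym by (metis mem_N)
  have two: "adj (z a) (z b) \<or> adj (z a) (z c) \<and> adj (z a) (z d)"
    if "distinct [a, b, c, d]" "N y = {a, b, c, d}" for a b c d
    using edge_24[of a y "z a" b c d] that z[of a] cz[of a] by auto
  have sym: "adj (z a) (z b) \<longleftrightarrow> adj (z b) (z a)" for a b using adj_sym by blast
  have tri: "\<not> (adj (z a) (z b) \<and> adj (z b) (z c) \<and> adj (z c) (z a))" for a b c
    using no_triangle by blast
  have sq: "\<not> (adj (z a) (z b) \<and> adj (z b) (z c) \<and> adj (z c) (z d) \<and> adj (z d) (z a))"
    if "a \<in> N y" "b \<in> N y" "c \<in> N y" "d \<in> N y" "a \<noteq> c" "b \<noteq> d" for a b c d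
    using no_square[of "z a" "z b" "z c" "z d"] zinj that by blast
  let ?r = "\<lambda>a b. adj (z a) (z b)"
  have perm: "N y = {x1, x3, x2, x4}" "N y = {x1, x4, x2, x3}"
    "N y = {x2, x1, x3, x4}" "N y = {x2, x3, x1, x4}" "N y = {x2, x4, x1, x3}"
    "N y = {x3, x1, x2, x4}" "N y = {x3, x2, x1, x4}" "N y = {x3, x4, x1, x2}"
    "N y = {x4, x1, x2, x3}" "N y = {x4, x2, x1, x3}" "N y = {x4, x3, x1, x2}"
    unfolding Ny by auto
  have v1: "?r x1 x2 \<and> ?r x1 x3 \<or> ?r x1 x2 \<and> ?r x1 x4 \<or> ?r x1 x3 \<and> ?r x1 x4"
    using two[OF _ Ny] two[OF _ perm(1)] two[OF _ perm(2)] ds by auto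
  have v2: "?r x2 x1 \<and> ?r x2 x3 \<or> ?r x2 x1 \<and> ?r x2 x4 \<or> ?r x2 x3 \<and> ?r x2 x4"
    using two[OF _ perm(3)] two[OF _ perm(4)] two[OF _ perm(5)] ds by auto
  have v3: "?r x3 x1 \<and> ?r x3 x2 \<or> ?r x3 x1 \<and> ?r x3 x4 \<or> ?r x3 x2 \<and> ?r x3 x4"
    using two[OF _ perm(6)] two[OF _ perm(7)] two[OF _ perm(8)] ds by auto
  have v4: "?r x4 x1 \<and> ?r x4 x2 \<or> ?r x4 x1 \<and> ?r x4 x3 \<or> ?r x4 x2 \<and> ?r x4 x3"
    using two[OF _ perm(9)] two[OF _ perm(10)] two[OF _ perm(11)] ds by auto
  \<comment> \<open>These are the three 4-cycles on four labelled vertices.\<close>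
  have "\<not> (?r x1 x2 \<and> ?r x2 x3 \<and> ?r x3 x4 \<and> ?r x4 x1)" "\<not> (?r x1 x2 \<and> ?r x2 x4 \<and> ?r x4 x3 \<and> ?r x3 x1)"
    "\<not> (?r x1 x3 \<and> ?r x3 x2 \<and> ?r x2 x4 \<and> ?r x4 x1)"
    using sq ds Ny by auto
  moreover have "?r x2 x1 = ?r x1 x2" "?r x3 x1 = ?r x1 x3" "?r x4 x1 = ?r x1 x4"
    "?r x3 x2 = ?r x2 x3" "?r x4 x2 = ?r x2 x4" "?r x4 x3 = ?r x3 x4" by (rule sym)+
  moreover note tri[of x1 x2 x3] tri[of x1 x2 x4] tri[of x1 x3 x4] tri[of x2 x3 x4]
  ultimately show False using v1 v2 v3 v4 by argo
qed

lemma deg_23: "adj x y \<Longrightarrow> deg x = 2 \<or> deg x = 3"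
  using deg_cases[of x y] deg_neq_4[of x] by auto


subsection \<open>Two-regular graphs\<close>

lemma track_exists:
  assumes reg: "\<And>x. x \<in> verts G \<Longrightarrow> deg x = 2" and uv: "adj u v"
  obtains s :: "nat \<Rightarrow> 'a" where "s 0 = u" "s 1 = v"
    "\<And>n. N (s (Suc n)) = {s n, s (Suc (Suc n))}" "\<And>n. s n \<noteq> s (Suc (Suc n))"
proof -
  \<comment> \<open>A pair of consecutive vertices is what determines the next step of a walk that
    never turns back.\<close>
  have "\<exists>f. \<forall>n. (adj (fst (f n)) (snd (f n)) \<and> (n = (0::nat) \<longrightarrow> f n = (u, v))) \<and>
    (fst (f (Suc n)) = snd (f n) \<and> N (snd (f n)) = {fst (f n), snd (f (Suc n))}
      \<and> fst (f n) \<noteq> snd (f (Suc n)))"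
  proof (rule dependent_nat_choice)
    show "\<exists>p. adj (fst p) (snd p) \<and> ((0::nat) = 0 \<longrightarrow> p = (u, v))" using uv by auto
  next
    fix p :: "'a \<times> 'a" and n :: nat assume "adj (fst p) (snd p) \<and> (n = 0 \<longrightarrow> p = (u, v))"
    then have p: "adj (snd p) (fst p)" using adj_sym by blast
    obtain w where w: "N (snd p) = {fst p, w}" "w \<noteq> fst p"
      using N_eq_2E[OF p] reg[OF adj_verts(1)[OF p]] by blast
    then have "adj (snd p) w" by (simp add: adj_N_eq)
    then show "\<exists>q. (adj (fst q) (snd q) \<and> (Suc n = 0 \<longrightarrow> q = (u, v))) \<and>
      fst q = snd p \<and> N (snd p) = {fst p, snd q} \<and> fst p \<noteq> snd q"
      using w by (intro exI[of _ "(snd p, w)"]) auto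
  qed
  then obtain f where f: "f 0 = (u, v)" "\<And>n. fst (f (Suc n)) = snd (f n)"
    "\<And>n. N (snd (f n)) = {fst (f n), snd (f (Suc n))}" "\<And>n. fst (f n) \<noteq> snd (f (Suc n))" by blast
  show ?thesis
    by (rule that[of "\<lambda>n. fst (f n)"]) (simp_all add: f)
qed

definition track :: "(int \<Rightarrow> 'a) \<Rightarrow> bool" where
  "track g \<longleftrightarrow> (\<forall>i. N (g i) = {g (i - 1), g (i + 1)} \<and> g (i - 1) \<noteq> g (i + 1))"

lemma track_adj: "track g \<Longrightarrow> adj (g i) (g (i + 1))"
  unfolding track_def by (metis insertCI mem_N)

lemma track_eqI:
  assumes p: "track p" and q: "track q" and "p 0 = q 0" "p 1 = q 1"
  shows "p k = q k"
proof -
  have N: "N (p i) = {p (i - 1), p (i + 1)}" "p (i - 1) \<noteq> p (i + 1)"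
    "N (q i) = {q (i - 1), q (i + 1)}" "q (i - 1) \<noteq> q (i + 1)" for i
    using p q by (auto simp: track_def)
  have "p k = q k \<and> p (k + 1) = q (k + 1)"
  proof (induction k rule: int_induct[of _ 0])
    case (step1 i)
    then have "p (i + 1 + 1) = q (i + 1 + 1)"
      using N(1,2)[of "i + 1"] N(3,4)[of "i + 1"] by (auto simp: doubleton_eq_iff)
    then show ?case using step1 by simp
  next
    case (step2 i)
    then have "p (i - 1) = q (i - 1)"
      using N(1,2)[of i] N(3,4)[of i] by (auto simp: doubleton_eq_iff)
    then show ?case using step2 by simp
  qed (use assms in auto)
  then show ?thesis ..
qed

lemma track_shift:
  assumes "track g"
  shows "track (\<lambda>k. g (i + k))"
  unfolding track_def
proof
  fix k
  have "i + (k - 1) = i + k - 1" "i + (k + 1) = i + k + 1" by simp_all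
  then show "N (g (i + k)) = {g (i + (k - 1)), g (i + (k + 1))} \<and> g (i + (k - 1)) \<noteq> g (i + (k + 1))"
    using assms unfolding track_def by metis
qed

lemma track_reflect:
  assumes "track g"
  shows "track (\<lambda>k. g (i - k))"
  unfolding track_def
proof
  fix k
  have "i - (k - 1) = i - k + 1" "i - (k + 1) = i - k - 1" by simp_all
  then show "N (g (i - k)) = {g (i - (k - 1)), g (i - (k + 1))} \<and> g (i - (k - 1)) \<noteq> g (i - (k + 1))"
    using assms unfolding track_def by (metis insert_commute)
qed

lemma bi_infinite_track:
  assumes reg: "\<And>x. x \<in> verts G \<Longrightarrow> deg x = 2"
  obtains g where "track g"
proof -
  obtain e where "e \<in> edges G" using nonempty by blast
  then obtain u v where uv: "adj u v" using simple unfolding simple_graph_def by (metis card_2_iff)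
  obtain s where s: "s 0 = u" "s 1 = v" "\<And>n. N (s (Suc n)) = {s n, s (Suc (Suc n))}"
    "\<And>n. s n \<noteq> s (Suc (Suc n))"
    by (rule track_exists[OF reg uv]) auto
  obtain t where t: "t 0 = v" "t 1 = u" "\<And>n. N (t (Suc n)) = {t n, t (Suc (Suc n))}"
    "\<And>n. t n \<noteq> t (Suc (Suc n))"
    by (rule track_exists[OF reg adj_sym[OF uv]]) auto
  \<comment> \<open>The two one-sided walks leave the edge \<open>uv\<close> in opposite directions.
    They overlap at the indices 0 and 1, where \<open>t 1 = s 0\<close> and
    \<open>t 0 = s 1\<close>.\<close>
  define g where "g i = (if i \<ge> 0 then s (nat i) else t (nat (1 - i)))" for i
  have gs: "g (int n) = s n" for n by (simp add: g_def)
  have gt: "g (1 - int n) = t n" for n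
  proof -
    consider "n = 0" | "n = 1" | "n \<ge> 2" by linarith
    then show ?thesis using s(1,2) t(1,2) by cases (auto simp: g_def)
  qed
  have "N (g i) = {g (i - 1), g (i + 1)} \<and> g (i - 1) \<noteq> g (i + 1)" for i
  proof (cases "i \<ge> 1")
    case True
    then have "i = int (Suc (nat (i - 1)))" by simp
    then obtain n where "i = int (Suc n)" ..
    then show ?thesis using s(3,4)[of n] gs[of n] gs[of "Suc n"] gs[of "Suc (Suc n)"]
      by (simp add: algebra_simps)
  next
    case False
    then have "1 - i = int (Suc (nat (- i)))" by simp
    then obtain n where "1 - i = int (Suc n)" ..
    then have i: "i = 1 - int (Suc n)" "i + 1 = 1 - int n" "i - 1 = 1 - int (Suc (Suc n))" by auto
    show ?thesis unfolding i(2,3) unfolding i(1) gt using t(3,4)[of n] by (auto simp: insert_commute)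
  qed
  then show ?thesis using that unfolding track_def by blast
qed

text \<open>On a repeated vertex the track continues either in the same direction, which is
  periodicity, or reversed. A reversal is a reflection about (i + j)/2: an integral centre makes the
  track turn back there, a half-integral one gives a loop.\<close>

lemma track_period:
  assumes g: "track g" and ij: "i < j" "g i = g j"
  shows "g (k + (j - i)) = g k"
proof -
  have N: "N (g i) = {g (i - 1), g (i + 1)}" "g (i - 1) \<noteq> g (i + 1)" for i
    using g by (auto simp: track_def)
  have "g (i + 1) \<in> N (g i)" by (subst N(1)) simp
  then have "g (i + 1) \<in> {g (j - 1), g (j + 1)}" by (simp only: ij(2) N(1))
  then have "g (i + 1) = g (j + 1) \<or> g (i + 1) = g (j - 1)" by blast
  then show ?thesis
  proof
    assume "g (i + 1) = g (j + 1)"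
    then have "g (i + (k - i)) = g (j + (k - i))"
      using track_eqI[OF track_shift[OF g] track_shift[OF g], of i j "k - i"] ij(2) by simp
    then show ?thesis by (simp add: algebra_simps)
  next
    assume "g (i + 1) = g (j - 1)"
    then have refl: "g (i + l) = g (j - l)" for l
      using track_eqI[OF track_shift[OF g] track_reflect[OF g], of i j l] ij(2) by simp
    have False
    proof (cases "even (i + j)")
      case True
      then obtain m where m: "i + j = 2 * m" by blast
      have "g (m + 1) = g (j - (m + 1 - i))" using refl[of "m + 1 - i"] by simp
      also have "j - (m + 1 - i) = m - 1" using m by simp
      finally show False using N(2)[of m] by simp
    next
      case False
      then obtain m where m: "i + j = 2 * m + 1" by (rule oddE)
      have "g (m + 1) = g (j - (m + 1 - i))" using refl[of "m + 1 - i"] by simp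
      also have "j - (m + 1 - i) = m" using m by simp
      finally show False using track_adj[OF g, of m] by simp
    qed
    then show ?thesis ..
  qed
qed

lemma edges_infinite_path: "{i, j} \<in> edges infinite_path \<longleftrightarrow> j = i - 1 \<or> j = i + 1"
  by (auto simp: infinite_path_def doubleton_eq_iff) presburger

lemma edges_cycle_graph:
  assumes "i < n" "j < n" "n \<ge> 2"
  shows "{i, j} \<in> edges (cycle_graph n) \<longleftrightarrow> j = Suc i mod n \<or> j = (i + n - 1) mod n"
proof -
  have "{i, j} \<in> edges (cycle_graph n) \<longleftrightarrow> j = Suc i mod n \<or> i = Suc j mod n"
    using assms by (auto simp: cycle_graph_def doubleton_eq_iff)
  moreover have "i = Suc j mod n \<longleftrightarrow> j = (i + n - 1) mod n"
    using assms by (auto simp: mod_Suc mod_if split: if_splits)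
  ultimately show ?thesis by simp
qed

lemma two_regular:
  assumes reg: "\<And>x. x \<in> verts G \<Longrightarrow> deg x = 2"
  shows "graph_isomorphic G infinite_path \<or> (\<exists>n\<ge>6. graph_isomorphic G (cycle_graph n))"
proof -
  obtain g where g: "track g" using bi_infinite_track[OF reg] by blast
  have N: "N (g i) = {g (i - 1), g (i + 1)}" "g (i - 1) \<noteq> g (i + 1)" for i
    using g by (auto simp: track_def)
  have V: "g i \<in> verts G" for i using adj_verts track_adj[OF g] by blast
  show ?thesis
  proof (cases "inj g")
    case True
    have "graph_isomorphic G infinite_path"
      by (rule graph_isomorphicI[of UNIV g id])
         (use True V N in \<open>auto simp: edges_infinite_path infinite_path_def[THEN arg_cong[where f = verts]]\<close>)
    then show ?thesis ..
  next
    case False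
    define per where "per n \<longleftrightarrow> n > 0 \<and> (\<forall>k. g (k + int n) = g k)" for n :: nat
    have perI: "per (nat (j - i))" if "i < j" "g i = g j" for i j
      using track_period[OF g that] that(1) by (simp add: per_def)
    obtain i j where "i < j" "g i = g j"
      using False by (metis injI linorder_less_linear)
    then have ex: "per (nat (j - i))" by (rule perI)
    define n where "n = (LEAST n. per n)"
    have n: "per n" unfolding n_def by (rule LeastI[of per, OF ex])
    have least: "n \<le> m" if "per m" for m unfolding n_def by (rule Least_le[of per, OF that])
    have period: "g (k + int n) = g k" for k using n by (simp add: per_def)
    have a: "adj (g k) (g (k + 1))" for k by (rule track_adj[OF g])
    have "n \<noteq> 0" using n by (simp add: per_def)
    moreover have "n \<noteq> 1" using a[of 0] period[of 0] by auto
    moreover have "n \<noteq> 2" using N(2)[of 1] period[of 0] by auto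
    moreover have "n \<noteq> 3" using no_triangle[of "g 0" "g 1" "g 2"] a[of 0] a[of 1] a[of 2] period[of 0] by auto
    moreover have "n \<noteq> 4"
      using no_square[of "g 0" "g 1" "g 2" "g 3"] a[of 0] a[of 1] a[of 2] a[of 3] period[of 0]
        N(2)[of 1] N(2)[of 2] by auto
    \<comment> \<open>The girth allows a pentagon; it is the curvature condition
      \<open>edge_22\<close> that excludes it.\<close>
    moreover have "n \<noteq> 5"
    proof
      assume "n = 5"
      then have "g 4 = g (-1)" using period[of "-1"] by simp
      then have "common (g 0) (g 3)"
        using a[of 3] a[of "-1"] adj_sym by (intro exI[of _ "g 4"]) auto
      then show False
        using edge_22[of "g 1" "g 2" "g 0" "g 3"] N[of 1] N[of 2] by (auto simp: insert_commute)
    qed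
    ultimately have "n \<ge> 6" by linarith
    have pm: "g (int (k mod n)) = g (int k)" for k
    proof -
      have shift: "g (int l + int n * int q) = g (int l)" for l q
      proof (induction q)
        case (Suc q)
        then show ?case using period[of "int l + int n * int q"] by (simp add: algebra_simps)
      qed simp
      have "int k = int (k mod n) + int n * int (k div n)"
        by (simp flip: of_nat_mult of_nat_add)
      then show ?thesis using shift[of "k mod n" "k div n"] by simp
    qed
    have "graph_isomorphic G (cycle_graph n)"
    proof (rule graph_isomorphicI[of "{..<n}" "\<lambda>i. g (int i)" id])
      show "inj_on (\<lambda>i. g (int i)) {..<n}"
      proof (rule linorder_inj_onI')
        fix i j assume "i \<in> {..<n}" "j \<in> {..<n}" "i < j"
        then show "g (int i) \<noteq> g (int j)" using perI[of "int i" "int j"] least[of "j - i"]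
          by (auto simp: nat_diff_distrib)
      qed
    next
      fix i assume i: "i \<in> {..<n}"
      have "g (int ((i + n - 1) mod n)) = g (int i - 1)"
        using pm[of "i + n - 1"] period[of "int i - 1"] \<open>n \<ge> 6\<close> by (simp add: of_nat_diff algebra_simps)
      moreover have "g (int (Suc i mod n)) = g (int i + 1)" using pm[of "Suc i"] by (simp add: algebra_simps)
      moreover have "{j \<in> {..<n}. {i, j} \<in> edges (cycle_graph n)} = {Suc i mod n, (i + n - 1) mod n}"
        using i \<open>n \<ge> 6\<close> edges_cycle_graph[of i n] by auto
      ultimately show "N (g (int i)) = (\<lambda>i. g (int i)) ` {j \<in> {..<n}. {id i, id j} \<in> edges (cycle_graph n)}"
        using N[of "int i"] by auto
    qed (use V \<open>n \<ge> 6\<close> in \<open>auto simp: cycle_graph_def lessThan_empty_iff\<close>)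
    then show ?thesis using \<open>n \<ge> 6\<close> by blast
  qed
qed

end

context flat_graph begin

subsection \<open>Degrees two and three\<close>

text \<open>The edge \<open>xy\<close> needs a pentagon, which must run through \<open>x\<close>,
  \<open>x1\<close> and the second neighbour \<open>w\<close> of \<open>x1\<close> if
  \<open>deg x1\<close> is 2. But \<open>edge_22\<close> forbids such a pentagon across the edge
  from \<open>x\<close> to \<open>x1\<close>.\<close>

lemma deg_2_neighbour_deg_3:
  assumes Nx: "N x = {y, x1}" "x1 \<noteq> y" and y3: "deg y = 3"
  shows "deg x1 = 3"
proof (rule ccontr)
  have ax: "adj x y" "adj x x1" by (simp_all add: adj_N_eq[OF Nx(1)])
  assume "deg x1 \<noteq> 3"
  then have "deg x1 = 2" using deg_23[OF adj_sym[OF ax(2)]] by simp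
  then obtain w where w: "N x1 = {x, w}" "w \<noteq> x" using N_eq_2E[OF adj_sym[OF ax(2)]] by blast
  obtain y1 y2 where y12: "N y = {x, y1, y2}" "distinct [x, y1, y2]"
    using N_eq_3E[OF adj_sym[OF ax(1)] y3] by blast
  have nc: "\<not> common y w"
    by (rule edge_22[of x x1 y w]) (use Nx w in auto)
  have "common x1 y1 \<longleftrightarrow> \<not> common x1 y2"
    by (rule edge_23[OF Nx(1) y12(1)]) (use Nx(2) y12(2) in auto)
  then have "common x1 y1 \<or> common x1 y2" by blast
  moreover have "adj y y1" "adj y y2" by (simp_all add: adj_N_eq[OF y12(1)])
  ultimately obtain v yj where v: "adj x1 v" "adj v yj" "adj y yj" "yj \<noteq> x"
    using y12(2) by (metis distinct_length_2_or_more)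
  have "v = x \<or> v = w" using v(1) by (simp add: adj_N_eq[OF w(1)])
  then show False
  proof
    assume "v = x"
    then have "yj = x1" using v(2,3) adj_neq[of y yj] v(2) by (auto simp: adj_N_eq[OF Nx(1)])
    then show False using no_triangle[of x x1 y] ax v(3) adj_sym by blast
  next
    assume "v = w"
    then show False using nc v adj_sym by blast
  qed
qed

text \<open>If \<open>y2\<close> had degree 3, the matching across the edge from \<open>y\<close> to
  \<open>y2\<close> would give \<open>x\<close> a partner, reachable only through \<open>x1\<close>,
  hence a common neighbour of \<open>x1\<close> and \<open>y2\<close>. If \<open>y1\<close> had
  degree 2, its second neighbour would be adjacent to \<open>x1\<close>, and then neither pentagon
  allowed by \<open>edge_23\<close> across the edge from \<open>y2\<close> to \<open>y\<close> could
  exist.\<close>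

lemma deg_2_pentagon_half:
  assumes Nx: "N x = {y, x1}" "x1 \<noteq> y" and y3: "deg y = 3"
    and Ny: "N y = {x, y1, y2}" "distinct [x, y1, y2]"
    and c1: "common x1 y1" and c2: "\<not> common x1 y2"
  shows "deg y1 = 3 \<and> deg y2 = 2"
proof -
  have ax: "adj x z \<longleftrightarrow> z = y \<or> z = x1" for z by (simp add: adj_N_eq[OF Nx(1)])
  have ay: "adj y z \<longleftrightarrow> z = x \<or> z = y1 \<or> z = y2" for z by (simp add: adj_N_eq[OF Ny(1)])
  have yy: "adj y1 y" "adj y2 y" using ay adj_sym by blast+
  have y2: "deg y2 = 2"
  proof (rule ccontr)
    assume "deg y2 \<noteq> 2"
    then have "deg y2 = 3" using deg_23[OF yy(2)] by simp
    then obtain u1 u2 where u: "N y2 = {y, u1, u2}" "distinct [y, u1, u2]"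
      using N_eq_3E[OF yy(2)] by blast
    have "common x u1 \<or> common x u2"
      by (rule edge_33_common[of y y2 x y1]) (use Ny u in auto)
    moreover have "adj y2 u1" "adj y2 u2" by (simp_all add: adj_N_eq[OF u(1)])
    ultimately obtain v u' where v: "adj x v" "adj v u'" "adj y2 u'" "u' \<noteq> y"
      using u(2) by (metis distinct_length_2_or_more)
    then have "v = y \<or> v = x1" using ax by blast
    then show False
    proof
      assume "v = y"
      then show False using no_triangle[of y u' y2] v yy adj_sym by blast
    next
      assume "v = x1"
      then show False using c2 v adj_sym by blast
    qed
  qed
  moreover have "deg y1 = 3"
  proof (rule ccontr)
    assume "deg y1 \<noteq> 3"
    then have "deg y1 = 2" using deg_23[OF yy(1)] by simp
    then obtain w where w: "N y1 = {y, w}" "w \<noteq> y" using N_eq_2E[OF yy(1)] by blast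
    have ay1: "adj y1 z \<longleftrightarrow> z = y \<or> z = w" for z by (simp add: adj_N_eq[OF w(1)])
    obtain v where v: "adj x1 v" "adj v y1" using c1 by blast
    then have "v = y \<or> v = w" using ay1 adj_sym by blast
    moreover have "v \<noteq> y" using v no_triangle[of x x1 y] ax adj_sym by blast
    ultimately have x1w: "adj x1 w" using v by auto
    have "common w x" using x1w ax adj_sym by blast
    moreover have "common w x \<longleftrightarrow> \<not> common w y2"
      by (rule edge_23[of y1 y]) (use w Ny in auto)
    ultimately have ncw: "\<not> common w y2" by blast
    obtain z where z: "N y2 = {y, z}" "z \<noteq> y" using N_eq_2E[OF yy(2) y2] by blast
    have y2z: "adj y2 z" by (simp add: adj_N_eq[OF z(1)])
    have ncy: "\<not> adj z y" using no_triangle[of z y y2] y2z yy adj_sym by blast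
    have "common z x \<longleftrightarrow> \<not> common z y1"
      by (rule edge_23[of y2 y]) (use z Ny in auto)
    then consider "common z x" | "common z y1" by blast
    then show False
    proof cases
      case 1
      then have "adj z x1" using ax ncy adj_sym by metis
      then show False using c2 y2z adj_sym by blast
    next
      case 2
      then have "adj z w" using ay1 ncy adj_sym by metis
      then show False using ncw y2z adj_sym by blast
    qed
  qed
  ultimately show ?thesis by blast
qed

text \<open>Both sides of \<open>c\<close> are treated by the previous lemma. The common neighbour
  of \<open>b'\<close> and \<open>a\<close> cannot be \<open>c\<close> (triangle) or
  \<open>d'\<close> (no pentagon), so it is \<open>a'\<close> and the pentagon closes.\<close>

lemma deg_2_pentagon:
  assumes Nc: "N c = {b, b'}" "b \<noteq> b'" and b3: "deg b = 3"
  obtains a a' d d' where "N b = {c, a, d}" "distinct [c, a, d]" "N b' = {c, a', d'}" "distinct [c, a', d']"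
    "adj a a'" "deg a = 3" "deg a' = 3" "deg d = 2" "deg d' = 2" "deg b' = 3"
proof -
  have bc: "adj b c" "adj b' c" using adj_N_eq[OF Nc(1)] adj_sym by blast+
  have b'3: "deg b' = 3" using deg_2_neighbour_deg_3[of c b b'] Nc b3 by auto
  have half: "\<exists>a d. N b = {c, a, d} \<and> distinct [c, a, d] \<and> common b' a \<and> \<not> common b' d \<and> deg a = 3 \<and> deg d = 2"
    if Nc: "N c = {b, b'}" and ne: "b' \<noteq> b" and b3: "deg b = 3" for b b'
  proof -
    have "adj b c" using adj_N_eq[OF Nc] adj_sym by blast
    then obtain y1 y2 where y: "N b = {c, y1, y2}" "distinct [c, y1, y2]"
      using N_eq_3E b3 by blast
    have "common b' y1 \<longleftrightarrow> \<not> common b' y2" by (rule edge_23[OF Nc y(1)]) (use ne y in auto)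
    moreover have "N b = {c, y2, y1}" using y by auto
    ultimately show ?thesis
      using deg_2_pentagon_half[OF Nc ne b3, of y1 y2] deg_2_pentagon_half[OF Nc ne b3, of y2 y1] y
      by (metis distinct_length_2_or_more distinct_singleton)
  qed
  obtain a d where a: "N b = {c, a, d}" "distinct [c, a, d]" "common b' a" "\<not> common b' d" "deg a = 3" "deg d = 2"
    using half[of b b'] Nc b3 by auto
  obtain a' d' where a': "N b' = {c, a', d'}" "distinct [c, a', d']" "common b a'" "\<not> common b d'" "deg a' = 3" "deg d' = 2"
    using half[of b' b] Nc b'3 by (auto simp: insert_commute)
  obtain w where w: "adj b' w" "adj w a" using a(3) by blast
  have ba: "adj b a" "adj b' a'" by (simp_all add: adj_N_eq[OF a(1)] adj_N_eq[OF a'(1)])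
  have "w = c \<or> w = a' \<or> w = d'" using w(1) by (simp add: adj_N_eq[OF a'(1)])
  moreover have "w \<noteq> c" using w no_triangle[of c a b] bc ba adj_sym by blast
  moreover have "w \<noteq> d'" using w ba a'(4) adj_sym by blast
  ultimately have "adj a a'" using w adj_sym by blast
  then show ?thesis using that a a' b'3 by blast
qed

text \<open>By \<open>deg_2_pentagon\<close> a neighbour of degree 2 brings along a second one,
  leaving room for only one neighbour of degree 3.\<close>

lemma deg_3_neighbours:
  assumes x: "adj x y" "adj x z" "y \<noteq> z" "deg x = 3" "deg y = 3" "deg z = 3" and "adj x t"
  shows "deg t = 3"
proof (rule ccontr)
  assume "deg t \<noteq> 3"
  then have "deg t = 2" using deg_23[OF adj_sym[OF assms(7)]] by simp
  then obtain t1 where t: "N t = {x, t1}" "t1 \<noteq> x" using N_eq_2E[OF adj_sym[OF assms(7)]] by blast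
  obtain a a' d d' where a: "N x = {t, a, d}" "deg d = 2"
    using deg_2_pentagon[of t x t1] t x(4) by metis
  then have "y \<in> {t, a, d}" "z \<in> {t, a, d}" using x by (simp_all add: adj_N_eq[OF a(1)])
  then show False using a \<open>deg t = 2\<close> x by auto
qed

text \<open>A path \<open>b c b'\<close> of the outer cycle with \<open>deg c = 2\<close>, together with the edge \<open>a a'\<close> of the inner
  cycle that closes it to a pentagon.\<close>

definition tile :: "'a \<Rightarrow> 'a \<Rightarrow> 'a \<Rightarrow> 'a \<Rightarrow> 'a \<Rightarrow> bool" where
  "tile b c b' a a' \<longleftrightarrow> N c = {b, b'} \<and> b \<noteq> b' \<and> adj b a \<and> adj b' a' \<and> adj a a'
    \<and> deg b = 3 \<and> deg b' = 3 \<and> deg a = 3 \<and> deg a' = 3"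

lemma tile_exists:
  assumes "N c = {b, b'}" "b \<noteq> b'" "deg b = 3"
  obtains a a' where "tile b c b' a a'"
proof -
  obtain a a' d d' where a: "N b = {c, a, d}" "N b' = {c, a', d'}"
    and "adj a a'" "deg a = 3" "deg a' = 3" "deg b' = 3"
    using deg_2_pentagon[OF assms] by metis
  moreover have "adj b a" "adj b' a'" by (simp_all add: adj_N_eq[OF a(1)] adj_N_eq[OF a(2)])
  ultimately show ?thesis using that assms by (simp add: tile_def)
qed

lemma tile_flip: "tile b c b' a a' \<Longrightarrow> tile b' c b a' a"
  by (auto simp: tile_def insert_commute)

lemma tileD:
  assumes "tile b c b' a a'"
  shows "N c = {b, b'}" "b \<noteq> b'" "adj b a" "adj b' a'" "adj a a'" "adj b c" "adj b' c"
    "deg c = 2" "deg b = 3" "deg b' = 3" "deg a = 3" "deg a' = 3"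
proof -
  show *: "N c = {b, b'}" "b \<noteq> b'" "adj b a" "adj b' a'" "adj a a'"
    "deg b = 3" "deg b' = 3" "deg a = 3" "deg a' = 3" using assms by (auto simp: tile_def)
  show "adj b c" "adj b' c" using adj_N_eq[OF *(1)] adj_sym by blast+
  show "deg c = 2" using * by simp
qed

lemma tile_outer_neighbour:
  assumes t: "tile b c b' a a'" and "adj b z" "deg z = 3"
  shows "z = a"
proof -
  note t' = tileD[OF t]
  obtain \<alpha> \<alpha>' d d' where a: "N b = {c, \<alpha>, d}" "deg d = 2"
    using deg_2_pentagon[of c b b'] t' by metis
  have "z \<in> {c, \<alpha>, d}" "a \<in> {c, \<alpha>, d}" using assms(2) t'(3) by (simp_all add: adj_N_eq[OF a(1)])
  then show ?thesis using a(2) t'(8,11) assms(3) by auto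
qed

lemma tile_inner_neighbour:
  assumes t: "tile b c b' a a'" and "adj a z"
  shows "deg z = 3"
proof -
  note t' = tileD[OF t]
  have "b \<noteq> a'" using no_triangle[of b b' c] t' adj_sym by metis
  then show ?thesis using deg_3_neighbours[of a b a' z] t' assms(2) adj_sym by blast
qed

text \<open>The third neighbour \<open>d\<close> of \<open>b'\<close> has degree 2 because
  \<open>a'\<close> is its only neighbour of degree 3. In the matching across the edge from
  \<open>b'\<close> to \<open>a'\<close>, \<open>c\<close> cannot be paired with the third neighbour
  of \<open>a'\<close>, so \<open>d\<close> is; this pentagon is the next tile.\<close>

lemma tile_extend:
  assumes t: "tile b c b' a a'"
  obtains d b'' a'' where "tile b' d b'' a' a''" "d \<noteq> c" "a'' \<noteq> a"
proof -
  note t' = tileD[OF t]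
  have "c \<noteq> a'" using t'(8,12) by auto
  then obtain d where d: "N b' = {c, a', d}" "distinct [c, a', d]"
    using N_eq_3E'[of b' c a'] t' by metis
  have d3: "deg d \<noteq> 3" using tile_outer_neighbour[OF tile_flip[OF t], of d] d(2) by (auto simp: adj_N_eq[OF d(1)])
  have b'd: "adj d b'" using adj_N_eq[OF d(1)] adj_sym by blast
  then have "deg d = 2" using d3 deg_23 by blast
  then obtain b'' where b'': "N d = {b', b''}" "b'' \<noteq> b'" using N_eq_2E[OF b'd] by blast
  have "b' \<noteq> a" using no_triangle[of b b' c] t' adj_sym by metis
  then obtain u where u: "N a' = {b', a, u}" "distinct [b', a, u]"
    using N_eq_3E'[of a' b' a] t' adj_sym by metis
  have a'u: "adj a' u" by (simp add: adj_N_eq[OF u(1)])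
  have u3: "deg u = 3" by (rule tile_inner_neighbour[OF tile_flip[OF t] a'u])
  have "common c a \<and> common d u \<or> common c u \<and> common d a"
    by (rule edge_33[of b' a']) (use d u in auto)
  moreover have "\<not> common c u"
  proof
    assume "common c u"
    then have "adj b u \<or> adj b' u" by (auto simp: adj_N_eq[OF t'(1)])
    then show False
    proof
      assume "adj b u"
      then show False using tile_outer_neighbour[OF t _ u3] u(2) by auto
    next
      assume "adj b' u"
      then show False using no_triangle[of b' u a'] a'u t'(4) adj_sym by blast
    qed
  qed
  ultimately have "common d u" by blast
  then have "adj b' u \<or> adj b'' u" by (auto simp: adj_N_eq[OF b''(1)])
  moreover have "\<not> adj b' u" using no_triangle[of b' u a'] a'u t'(4) adj_sym by blast
  ultimately have b''u: "adj b'' u" by blast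
  obtain \<alpha> \<alpha>' where \<alpha>: "tile b' d b'' \<alpha> \<alpha>'" using tile_exists[OF b''(1) b''(2)[symmetric] t'(10)] .
  have "\<alpha> = a'" using tile_outer_neighbour[OF \<alpha> t'(4,12)] ..
  moreover have "\<alpha>' = u" using tile_outer_neighbour[OF tile_flip[OF \<alpha>] b''u u3] ..
  ultimately show ?thesis using that \<alpha> d u by auto
qed

lemma tile_sequence:
  assumes c: "deg c = 2" "adj b c" "deg b = 3"
  obtains \<beta> \<gamma> \<alpha> :: "nat \<Rightarrow> 'a" where
    "\<And>i. tile (\<beta> i) (\<gamma> i) (\<beta> (Suc i)) (\<alpha> i) (\<alpha> (Suc i))"
    "\<And>i. \<gamma> (Suc i) \<noteq> \<gamma> i" "\<And>i. \<alpha> (Suc (Suc i)) \<noteq> \<alpha> i"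
proof -
  define P where "P = (\<lambda>(b, c, b', a, a'). tile b c b' a a')"
  define Q where "Q = (\<lambda>(b::'a, c::'a, b'::'a, a::'a, a'::'a) (e::'a, d::'a, e'::'a, \<alpha>::'a, \<alpha>'::'a).
    e = b' \<and> \<alpha> = a' \<and> d \<noteq> c \<and> \<alpha>' \<noteq> a)"
  have "\<exists>f. \<forall>n. P (f n) \<and> Q (f n) (f (Suc n))"
  proof (rule dependent_nat_choice)
    obtain b' where "N c = {b, b'}" "b' \<noteq> b" using N_eq_2E[OF adj_sym[OF c(2)] c(1)] by blast
    then obtain a a' where "tile b c b' a a'" using tile_exists[of c b b'] c(3) by metis
    then show "\<exists>p. P p" by (intro exI[of _ "(b, c, b', a, a')"]) (simp add: P_def)
  next
    fix p and n :: nat assume "P p"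
    moreover obtain b c b' a a' where p: "p = (b, c, b', a, a')" by (cases p)
    ultimately obtain d b'' a'' where "tile b' d b'' a' a''" "d \<noteq> c" "a'' \<noteq> a"
      using tile_extend[of b c b' a a'] by (auto simp: P_def)
    then show "\<exists>q. P q \<and> Q p q"
      by (intro exI[of _ "(b', d, b'', a', a'')"]) (auto simp: P_def Q_def p)
  qed
  then obtain f where f: "\<And>n. P (f n)" "\<And>n. Q (f n) (f (Suc n))" by blast
  show ?thesis
  proof (rule that[of "\<lambda>n. fst (f n)" "\<lambda>n. fst (snd (f n))" "\<lambda>n. fst (snd (snd (snd (f n))))"])
    fix i
    show "tile (fst (f i)) (fst (snd (f i))) (fst (f (Suc i))) (fst (snd (snd (snd (f i)))))
        (fst (snd (snd (snd (f (Suc i))))))"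
      using f[of i] by (auto simp: P_def Q_def split: prod.splits)
    show "fst (snd (f (Suc i))) \<noteq> fst (snd (f i))"
      using f(2)[of i] by (auto simp: Q_def split: prod.splits)
    show "fst (snd (snd (snd (f (Suc (Suc i)))))) \<noteq> fst (snd (snd (snd (f i))))"
      using f(2)[of i] f(2)[of "Suc i"] by (auto simp: Q_def split: prod.splits)
  qed
qed

lemma lt_5_iff: "i < 5 \<longleftrightarrow> i = 0 \<or> i = 1 \<or> i = 2 \<or> i = 3 \<or> i = (4::nat)"
  by linarith

lemma half_dodecahedral_neighbours:
  assumes "i < 5"
  defines "S v \<equiv> {w \<in> verts half_dodecahedral_graph. {v, w} \<in> edges half_dodecahedral_graph}"
  shows "S (Va i) = {Va ((i + 4) mod 5), Va ((i + 1) mod 5), Vb i}"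
    and "S (Vb i) = {Vc ((i + 4) mod 5), Vc i, Va i}"
    and "S (Vc i) = {Vb i, Vb ((i + 1) mod 5)}"
proof -
  have prev: "i = Suc j mod 5 \<longleftrightarrow> j = (i + 4) mod 5" if "j < 5" for j
    using \<open>i < 5\<close> that unfolding lt_5_iff by (elim disjE) simp_all
  have "{Va i, w} \<in> edges half_dodecahedral_graph \<longleftrightarrow>
    w = Vb i \<or> w = Va ((i + 1) mod 5) \<or> (\<exists>j<5. w = Va j \<and> i = Suc j mod 5)" for w
    using \<open>i < 5\<close> by (auto simp: half_dodecahedral_graph_def doubleton_eq_iff)
  then show "S (Va i) = {Va ((i + 4) mod 5), Va ((i + 1) mod 5), Vb i}"
    unfolding S_def using prev \<open>i < 5\<close> by (auto simp: half_dodecahedral_graph_def)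
  have "{Vb i, w} \<in> edges half_dodecahedral_graph \<longleftrightarrow>
    w = Va i \<or> w = Vc i \<or> (\<exists>j<5. w = Vc j \<and> i = Suc j mod 5)" for w
    using \<open>i < 5\<close> by (auto simp: half_dodecahedral_graph_def doubleton_eq_iff)
  then show "S (Vb i) = {Vc ((i + 4) mod 5), Vc i, Va i}"
    unfolding S_def using prev \<open>i < 5\<close> by (auto simp: half_dodecahedral_graph_def)
  have "{Vc i, w} \<in> edges half_dodecahedral_graph \<longleftrightarrow> w = Vb i \<or> w = Vb ((i + 1) mod 5)" for w
    using \<open>i < 5\<close> by (auto simp: half_dodecahedral_graph_def doubleton_eq_iff)
  then show "S (Vc i) = {Vb i, Vb ((i + 1) mod 5)}"
    unfolding S_def using \<open>i < 5\<close> by (auto simp: half_dodecahedral_graph_def)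
qed

lemma mixed_degrees:
  assumes c: "deg c = 2" "adj b c" "deg b = 3"
  shows "graph_isomorphic G half_dodecahedral_graph"
proof -
  obtain \<beta> \<gamma> \<alpha> :: "nat \<Rightarrow> 'a" where T: "\<And>i. tile (\<beta> i) (\<gamma> i) (\<beta> (Suc i)) (\<alpha> i) (\<alpha> (Suc i))"
    and \<gamma>2: "\<And>i. \<gamma> (Suc i) \<noteq> \<gamma> i" and \<alpha>2: "\<And>i. \<alpha> (Suc (Suc i)) \<noteq> \<alpha> i"
    using tile_sequence[OF c] by blast
  note T' = tileD[OF T]
  have aa: "adj (\<alpha> i) (\<alpha> (Suc i))" "adj (\<alpha> (Suc i)) (\<alpha> i)" for i using T'(5)[of i] adj_sym by blast+
  have ba: "adj (\<alpha> i) (\<beta> i)" "adj (\<beta> i) (\<alpha> i)" for i using T'(3)[of i] adj_sym by blast+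
  \<comment> \<open>Inner vertices have only neighbours of degree 3, whereas each \<beta> has a
    neighbour of degree 2.\<close>
  have notb: "\<alpha> i \<noteq> \<beta> j" for i j
    using tile_inner_neighbour[OF T, of i "\<gamma> j"] T'(6)[of j] T'(8)[of j] by auto
  have Na: "N (\<alpha> (Suc i)) = {\<alpha> i, \<alpha> (Suc (Suc i)), \<beta> (Suc i)}" for i
    using N_eq_3E'[OF aa(2)[of i] aa(1)[of "Suc i"]] \<alpha>2[of i] T'(11)[of "Suc i"] ba(1)[of "Suc i"] notb
    by (metis insertE mem_N singletonD)
  have Nb: "N (\<beta> (Suc i)) = {\<gamma> i, \<gamma> (Suc i), \<alpha> (Suc i)}" for i
  proof -
    have "\<gamma> j \<noteq> \<alpha> (Suc i)" for j using T'(8)[of j] T'(11)[of "Suc i"] by auto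
    then show ?thesis
      using N_eq_3E'[OF T'(7)[of i] T'(6)[of "Suc i"]] \<gamma>2[of i] T'(9)[of "Suc i"] ba(2)[of "Suc i"]
      by (metis insertE mem_N singletonD)
  qed
  have Nc: "N (\<gamma> i) = {\<beta> i, \<beta> (Suc i)}" for i by (rule T'(1))
  have \<alpha>3: "\<alpha> (Suc (Suc (Suc i))) \<noteq> \<alpha> i" for i
    using no_triangle[of "\<alpha> i" "\<alpha> (Suc i)" "\<alpha> (Suc (Suc i))"] aa(1)[of i] aa(1)[of "Suc i"] aa(1)[of "Suc (Suc i)"]
    by auto
  have \<alpha>1: "\<alpha> (Suc i) \<noteq> \<alpha> i" for i using aa(1)[of i] by auto
  have \<beta>\<alpha>: "\<alpha> i = \<alpha> j" if "\<beta> i = \<beta> j" for i j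
    using tile_outer_neighbour[OF T[of j], of "\<alpha> i"] ba(2)[of i] T'(11)[of i] that by auto

  text \<open>The matching across \<open>\<alpha>\<^sub>i \<alpha>\<^sub>i\<^sub>+\<^sub>1\<close> must pair \<open>\<alpha>\<^sub>i\<^sub>-\<^sub>1\<close> with \<open>\<alpha>\<^sub>i\<^sub>+\<^sub>2\<close>, and their common
    neighbour can only be \<open>\<alpha>\<^sub>i\<^sub>-\<^sub>2 = \<alpha>\<^sub>i\<^sub>+\<^sub>3\<close>.\<close>
  have per\<alpha>: "\<alpha> (i + 5) = \<alpha> i" for i
  proof -
    let ?a = "\<lambda>k. \<alpha> (k + i)" and ?b = "\<lambda>k. \<beta> (k + i)"
    have A: "N (?a 1) = {?a 0, ?a 2, ?b 1}" "N (?a 2) = {?a 1, ?a 3, ?b 2}"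
      "N (?a 3) = {?a 2, ?a 4, ?b 3}" "N (?a 4) = {?a 3, ?a 5, ?b 4}"
      using Na[of i] Na[of "Suc i"] Na[of "i + 2"] Na[of "i + 3"]
      by (simp_all add: numeral_eq_Suc)
    have B: "N (?b 2) = {\<gamma> (1 + i), \<gamma> (2 + i), ?a 2}"
      using Nb[of "Suc i"] by (simp add: numeral_eq_Suc)
    have d2: "?a 2 \<noteq> ?a 0" "?a 3 \<noteq> ?a 1" "?a 4 \<noteq> ?a 2" "?a 5 \<noteq> ?a 3"
      using \<alpha>2[of i] \<alpha>2[of "Suc i"] \<alpha>2[of "2 + i"] \<alpha>2[of "3 + i"] by (simp_all add: numeral_eq_Suc)
    have d3: "?a 3 \<noteq> ?a 0" "?a 4 \<noteq> ?a 1" "?a 5 \<noteq> ?a 2"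
      using \<alpha>3[of i] \<alpha>3[of "Suc i"] \<alpha>3[of "2 + i"] by (simp_all add: numeral_eq_Suc)
    have d1: "?a 1 \<noteq> ?a 0" "?a 2 \<noteq> ?a 1" "?a 3 \<noteq> ?a 2" "?a 4 \<noteq> ?a 3" "?a 5 \<noteq> ?a 4"
      using \<alpha>1[of i] \<alpha>1[of "Suc i"] \<alpha>1[of "2 + i"] \<alpha>1[of "3 + i"] \<alpha>1[of "4 + i"] by (simp_all add: numeral_eq_Suc)
    have "common (?a 1) (?a 4) \<and> common (?b 2) (?b 3) \<or> common (?a 1) (?b 3) \<and> common (?b 2) (?a 4)"
      by (rule edge_33[of "?a 2" "?a 3"]) (use A d2 notb in \<open>auto simp: insert_commute\<close>)
    \<comment> \<open>A neighbour of the inner vertex \<open>?a 4\<close> has degree 3; the only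
      such neighbour of \<open>?b 2\<close> is \<open>?a 2\<close>, which is not adjacent to
      \<open>?a 4\<close>.\<close>
    moreover have "\<not> common (?b 2) (?a 4)"
    proof
      assume "common (?b 2) (?a 4)"
      then obtain w where w: "w \<in> N (?b 2)" "w \<in> N (?a 4)" using adj_sym by auto
      from w(2) have "deg w = 3" using tile_inner_neighbour[OF T, of "4 + i" w] by simp
      then have "w = ?a 2" using w(1) tile_outer_neighbour[OF T, of "2 + i" w] by simp
      then show False using w(2) d1 d2 d3 notb[of "2 + i" "4 + i"] unfolding A(4) by auto
    qed
    ultimately obtain w where w: "w \<in> N (?a 1)" "w \<in> N (?a 4)" using adj_sym by auto
    have "?b 1 \<noteq> ?b 4" using \<beta>\<alpha>[of "1 + i" "4 + i"] d3(2) by auto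
    then have "?a 0 = ?a 5" using w d1 d2 d3 notb unfolding A(1,4) by auto metis+
    then show ?thesis by (simp add: add.commute)
  qed
  have per\<beta>: "\<beta> (Suc i + 5) = \<beta> (Suc i)" for i
  proof -
    have "N (\<alpha> (Suc i)) = {\<alpha> i, \<alpha> (Suc (Suc i)), \<beta> (Suc i + 5)}"
      using Na[of "i + 5"] per\<alpha>[of i] per\<alpha>[of "Suc i"] per\<alpha>[of "Suc (Suc i)"] by simp
    moreover have "\<beta> (Suc i) \<in> N (\<alpha> (Suc i))" unfolding Na by simp
    ultimately show ?thesis using notb by (metis insertE singletonD)
  qed
  have per\<gamma>: "\<gamma> (Suc i + 5) = \<gamma> (Suc i)" for i
  proof (rule common_unique[of "\<beta> (Suc i)" _ "\<beta> (Suc (Suc i))"])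
    show "adj (\<beta> (Suc i)) (\<gamma> (Suc i + 5))" using T'(6)[of "Suc i + 5"] per\<beta>[of i] by simp
    show "adj (\<gamma> (Suc i + 5)) (\<beta> (Suc (Suc i)))"
      using T'(7)[of "Suc i + 5"] per\<beta>[of "Suc i"] adj_sym by simp
  qed (use T'(6,7)[of "Suc i"] T'(2)[of "Suc i"] adj_sym in auto)
  have p: "\<alpha> 7 = \<alpha> 2" "\<alpha> 1 = \<alpha> 6" "\<beta> 7 = \<beta> 2" "\<gamma> 1 = \<gamma> 6"
    using per\<alpha>[of 2] per\<alpha>[of 1] per\<beta>[of 1] per\<gamma>[of 0] by (simp_all add: numeral_eq_Suc)
  have ne: "\<alpha> 2 \<noteq> \<alpha> 3" "\<alpha> 2 \<noteq> \<alpha> 4" "\<alpha> 2 \<noteq> \<alpha> 5" "\<alpha> 2 \<noteq> \<alpha> 6" "\<alpha> 3 \<noteq> \<alpha> 4"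
    "\<alpha> 3 \<noteq> \<alpha> 5" "\<alpha> 3 \<noteq> \<alpha> 6" "\<alpha> 4 \<noteq> \<alpha> 5" "\<alpha> 4 \<noteq> \<alpha> 6" "\<alpha> 5 \<noteq> \<alpha> 6"
    using \<alpha>1[of 1] \<alpha>1[of 2] \<alpha>1[of 3] \<alpha>1[of 4] \<alpha>1[of 5] \<alpha>2[of 2] \<alpha>2[of 3] \<alpha>2[of 4]
      \<alpha>3[of 2] \<alpha>3[of 3] p(2) by (simp_all add: numeral_eq_Suc)
  have inj\<alpha>: "i = j" if "\<alpha> (i + 2) = \<alpha> (j + 2)" "i < 5" "j < 5" for i j
    using that ne ne[symmetric] unfolding lt_5_iff by (elim disjE) (simp_all add: numeral_eq_Suc)
  have inj\<beta>: "i = j" if "\<beta> (i + 2) = \<beta> (j + 2)" "i < 5" "j < 5" for i j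
    using inj\<alpha>[of i j] \<beta>\<alpha>[of "i + 2" "j + 2"] that by simp
  have inj\<gamma>: "i = j" if "\<gamma> (i + 2) = \<gamma> (j + 2)" "i < 5" "j < 5" for i j
  proof (rule ccontr)
    assume "i \<noteq> j"
    then have "\<beta> (i + 2) \<noteq> \<beta> (j + 2)" using inj\<beta> that by blast
    moreover have "{\<beta> (i + 2), \<beta> (i + 3)} = {\<beta> (j + 2), \<beta> (j + 3)}"
      using Nc[of "i + 2"] Nc[of "j + 2"] that(1) by (simp add: numeral_eq_Suc)
    ultimately have "\<beta> (i + 2) = \<beta> (j + 3)" "\<beta> (j + 2) = \<beta> (i + 3)"
      by (auto simp: doubleton_eq_iff)
    then have "\<alpha> (i + 2) = \<alpha> (j + 3)" "\<alpha> (j + 2) = \<alpha> (i + 3)"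
      using \<beta>\<alpha> by blast+
    then show False
      using that(2,3) \<open>i \<noteq> j\<close> ne ne[symmetric] p(1) unfolding lt_5_iff by (elim disjE) (simp_all add: numeral_eq_Suc)
  qed
  \<comment> \<open>The window starts at 2: neighbourhoods are known only from index 1 on, and the
    predecessor \<gamma> 1 must wrap around to \<gamma> 6, while periodicity of \<beta> and \<gamma>
    is available only from index 1.\<close>
  define g where "g v = (case v of Va i \<Rightarrow> \<alpha> (i + 2) | Vb i \<Rightarrow> \<beta> (i + 2) | Vc i \<Rightarrow> \<gamma> (i + 2))" for v
  show ?thesis
  proof (rule graph_isomorphicI[of "verts half_dodecahedral_graph" g id])
    have neq: "\<gamma> i \<noteq> \<alpha> j" "\<gamma> i \<noteq> \<beta> j" for i j
      using T'(8)[of i] T'(11)[of j] T'(9)[of j] by auto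
    show "inj_on g (verts half_dodecahedral_graph)"
    proof (rule inj_onI)
      fix u v assume "u \<in> verts half_dodecahedral_graph" "v \<in> verts half_dodecahedral_graph" "g u = g v"
      then show "u = v"
        using neq neq[symmetric] notb notb[symmetric]
        by (cases u; cases v) (auto simp: half_dodecahedral_graph_def g_def
            simp del: add_2_eq_Suc' dest: inj\<alpha> inj\<beta> inj\<gamma>)
    qed
    show "g ` verts half_dodecahedral_graph \<subseteq> verts G"
      using adj_verts(1)[OF ba(1)] adj_verts(1)[OF ba(2)] adj_verts(2)[OF T'(6)]
      by (auto simp: half_dodecahedral_graph_def g_def)
    fix v assume v: "v \<in> verts half_dodecahedral_graph"
    have n: "N (g (Va i)) = {\<alpha> (i + 1), \<alpha> (i + 3), \<beta> (i + 2)}" "N (g (Vb i)) = {\<gamma> (i + 1), \<gamma> (i + 2), \<alpha> (i + 2)}"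
      "N (g (Vc i)) = {\<beta> (i + 2), \<beta> (i + 3)}" for i
      using Na[of "i + 1"] Nb[of "i + 1"] Nc[of "i + 2"] by (simp_all add: g_def numeral_eq_Suc)
    have mods: "(i + 4) mod 5 + 2 = (if i = 0 then 6 else i + 1)" "(i + 1) mod 5 + 2 = (if i = 4 then 2 else i + 3)"
      if "i < 5" for i :: nat
      using that unfolding lt_5_iff by (elim disjE; simp)+
    have "v \<in> Va ` {..<5} \<union> Vb ` {..<5} \<union> Vc ` {..<5}"
      using v by (simp add: half_dodecahedral_graph_def)
    then consider i where "v = Va i" "i < 5" | i where "v = Vb i" "i < 5" | i where "v = Vc i" "i < 5"
      by blast
    then show "N (g v) = g ` {w \<in> verts half_dodecahedral_graph. {id v, id w} \<in> edges half_dodecahedral_graph}"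
    proof cases
      case 1
      have "\<alpha> ((i + 4) mod 5 + 2) = \<alpha> (i + 1)"
        by (simp only: mods[OF 1(2)] split: if_split) (simp add: p p[unfolded One_nat_def])
      moreover have "\<alpha> ((i + 1) mod 5 + 2) = \<alpha> (i + 3)"
        by (simp only: mods[OF 1(2)] split: if_split) (simp add: p p[unfolded One_nat_def])
      ultimately show ?thesis unfolding id_apply 1(1) half_dodecahedral_neighbours[OF 1(2)] n
        by (simp add: g_def)
    next
      case 2
      have "\<gamma> ((i + 4) mod 5 + 2) = \<gamma> (i + 1)"
        by (simp only: mods[OF 2(2)] split: if_split) (simp add: p p[unfolded One_nat_def])
      then show ?thesis unfolding id_apply 2(1) half_dodecahedral_neighbours[OF 2(2)] n
        by (simp add: g_def)
    next
      case 3
      have "\<beta> ((i + 1) mod 5 + 2) = \<beta> (i + 3)"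
        by (simp only: mods[OF 3(2)] split: if_split) (simp add: p p[unfolded One_nat_def])
      then show ?thesis unfolding id_apply 3(1) half_dodecahedral_neighbours[OF 3(2)] n
        by (simp add: g_def)
    qed
  qed (auto simp: half_dodecahedral_graph_def lessThan_empty_iff)
qed

end

section \<open>Cubic graphs: a certified case analysis\<close>

text \<open>A state is a list of adjacency lists on the vertices \<open>0, 1, \<dots>\<close>: a partial cubic graph of
  girth at least five, to be embedded in \<open>G\<close>.\<close>

type_synonym state = "nat list list"

text \<open>The empty list of outcomes signals that the new edge would violate the degree or girth bound.\<close>

definition add_edge :: "nat \<Rightarrow> nat \<Rightarrow> state \<Rightarrow> state list" where
  "add_edge i j A =
    (if j \<in> set (A ! i) then [A]
     else if i = j \<or> 3 \<le> length (A ! i) \<or> 3 \<le> length (A ! j)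
       \<or> (\<exists>k\<in>set (A ! i). k \<in> set (A ! j))
       \<or> (\<exists>k\<in>set (A ! i). k \<noteq> j \<and> (\<exists>l\<in>set (A ! k). l \<noteq> i \<and> l \<in> set (A ! j))) then []
     else [A[i := j # A ! i, j := i # A ! j]])"

text \<open>An unknown vertex of \<open>G\<close> is either already numbered or new; one new number
  covers all new vertices.\<close>

definition candidates :: "state \<Rightarrow> (nat \<times> state) list" where
  "candidates A = map (\<lambda>k. (k, A)) [0..<length A] @ [(length A, A @ [[]])]"

definition vertex_branches :: "nat \<Rightarrow> state \<Rightarrow> state list" where
  "vertex_branches i A =
    concat (map (\<lambda>(k, B). if k \<in> set (A ! i) then [] else add_edge i k B) (candidates A))"

definition common_branches :: "nat \<Rightarrow> nat \<Rightarrow> state \<Rightarrow> state list" where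
  "common_branches p q A =
    (if \<exists>k\<in>set (A ! p). k \<in> set (A ! q) then [A]
     else concat (map (\<lambda>(k, B). concat (map (add_edge k q) (add_edge p k B))) (candidates A)))"

text \<open>The two halves are the two matchings of \<open>edge_33\<close>; they may overlap, as
  only exhaustiveness matters.\<close>

definition edge_branches :: "nat \<Rightarrow> nat \<Rightarrow> nat \<Rightarrow> nat \<Rightarrow> state \<Rightarrow> state list" where
  "edge_branches x1 x2 y1 y2 A =
    concat (map (common_branches x2 y2) (common_branches x1 y1 A)) @
    concat (map (common_branches x2 y1) (common_branches x1 y2 A))"

datatype move = Vertex nat | Edge nat nat | Final nat "nat list"

text \<open>Length 3 everywhere means that no edge of \<open>G\<close> leaves the state, so that
  agreement of the neighbourhoods under \<open>\<sigma>\<close> determines all of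
  \<open>G\<close>.\<close>

definition iso_check :: "state \<Rightarrow> nat list \<Rightarrow> state \<Rightarrow> bool" where
  "iso_check T \<sigma> A \<longleftrightarrow> length \<sigma> = length A \<and> length T = length A \<and> distinct \<sigma>
    \<and> list_all2 (\<lambda>s js. s < length T \<and> length js = 3 \<and> set (map ((!) \<sigma>) js) = set (T ! s)) \<sigma> A"

fun expand :: "state list \<Rightarrow> move \<Rightarrow> state \<Rightarrow> state list option" where
  "expand Ts (Vertex i) A =
    (if i < length A \<and> length (A ! i) < 3 then Some (vertex_branches i A) else None)"
| "expand Ts (Edge x y) A =
    (if x < length A \<and> y \<in> set (A ! x) \<and> x \<in> set (A ! y)
     then case (remove1 y (A ! x), remove1 x (A ! y)) of
       ([x1, x2], [y1, y2]) \<Rightarrow> Some (edge_branches x1 x2 y1 y2 A) | _ \<Rightarrow> None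
     else None)"
| "expand Ts (Final t \<sigma>) A =
    (if t < length Ts \<and> iso_check (Ts ! t) \<sigma> A then Some [] else None)"

text \<open>The states form a stack and each move treats the top one. A branch dies when its
  expansion is empty; a move that does not fit the state makes the whole run fail.\<close>

fun run :: "state list \<Rightarrow> move list \<Rightarrow> state list \<Rightarrow> bool" where
  "run Ts ms [] \<longleftrightarrow> True"
| "run Ts [] (A # As) \<longleftrightarrow> False"
| "run Ts (m # ms) (A # As) \<longleftrightarrow>
    (case expand Ts m A of None \<Rightarrow> False | Some Bs \<Rightarrow> run Ts ms (Bs @ As))"

text \<open>The edge \<open>{0, 1}\<close> with its two pentagons \<open>0 2 6 4 1\<close> and \<open>0 3 7 5 1\<close>.\<close>

definition start_state :: state where
  "start_state = [[3, 2, 1], [5, 4, 0], [6, 0], [7, 0], [6, 1], [7, 1], [4, 2], [5, 3]]"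

text \<open>The numbering is that of the coordinate list \<open>dod_coords\<close>, so that
  adjacency can be compared with inner products.\<close>

definition dodecahedral_adj :: state where
  "dodecahedral_adj =
    [[8, 12, 16], [9, 12, 18], [10, 13, 16], [11, 13, 18], [8, 14, 17], [9, 14, 19], [10, 15, 17],
    [11, 15, 19], [0, 4, 10], [1, 5, 11], [2, 6, 8], [3, 7, 9], [0, 1, 14], [2, 3, 15], [4, 5,
    12], [6, 7, 13], [0, 2, 18], [4, 6, 19], [1, 3, 16], [5, 7, 17]]"

definition petersen_adj :: state where
  "petersen_adj =
    [[1, 5, 4], [0, 2, 6], [1, 3, 7], [2, 4, 8], [3, 0, 9], [0, 7, 8], [1, 8, 9], [5, 2, 9], [6,
    3, 5], [7, 4, 6]]"

definition triplex_adj :: state where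
  "triplex_adj =
    [[1, 11, 6], [0, 2, 9], [1, 3, 7], [2, 4, 11], [3, 5, 8], [4, 6, 10], [5, 7, 0], [6, 8, 2],
    [7, 9, 4], [8, 10, 1], [9, 11, 5], [10, 0, 3]]"

text \<open>The moves of a computer-generated search tree in depth-first order; \<open>Final t \<sigma>\<close> closes a branch
  whose state is carried onto the \<open>t\<close>-th target graph by \<open>\<sigma>\<close>.\<close>

definition certificate :: "move list" where
  "certificate =
    [Vertex 2, Vertex 3, Vertex 4, Vertex 5, Edge 0 3, Vertex 6, Final 1 [0, 4, 5, 1, 3, 9, 8, 6,
    7, 2], Edge 2 6, Vertex 8, Final 1 [0, 4, 5, 1, 3, 9, 8, 6, 7, 2], Edge 2 8, Edge 0 2, Edge 5
    7, Edge 1 5, Edge 3 7, Final 2 [0, 11, 6, 1, 10, 3, 5, 2, 7, 9, 4, 8], Edge 4 9, Edge 1 5,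
    Edge 2 6, Edge 3 9, Edge 0 3, Edge 4 6, Edge 0 2, Edge 1 4, Edge 2 6, Final 2 [0, 6, 11, 1, 5,
    7, 10, 2, 3, 9, 4, 8], Edge 2 6, Edge 5 7, Edge 1 5, Edge 5 8, Edge 2 6, Final 2 [0, 11, 1, 6,
    3, 10, 2, 5, 9, 7, 4, 8], Edge 1 4, Vertex 6, Edge 2 6, Edge 3 9, Edge 3 7, Final 2 [3, 11, 4,
    2, 10, 0, 5, 1, 8, 7, 9, 6], Edge 3 7, Edge 4 10, Vertex 5, Edge 1 5, Edge 1 5, Vertex 6, Edge
    2 6, Edge 3 7, Edge 2 6, Edge 3 9, Edge 4 6, Vertex 8, Edge 2 8, Edge 2 8, Edge 4 6, Edge 5
    11, Vertex 9, Edge 3 9, Edge 3 9, Edge 8 13, Vertex 7, Edge 3 7, Edge 3 7, Vertex 7, Edge 5 7,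
    Edge 3 7, Edge 3 7, Edge 5 7, Edge 9 16, Edge 8 9, Edge 10 11, Edge 12 14, Final 0 [0, 16, 12,
    8, 18, 2, 1, 10, 14, 4, 3, 13, 9, 5, 11, 6, 17, 15, 19, 7]]"

lemma run_certificate:
  "run [dodecahedral_adj, petersen_adj, triplex_adj] certificate [start_state]"
  by code_simp

section \<open>Soundness of the search\<close>

definition represents :: "state \<Rightarrow> 'b list \<Rightarrow> 'b graph \<Rightarrow> bool" where
  "represents T ws H \<longleftrightarrow> length ws = length T \<and> distinct ws \<and> set ws = verts H
    \<and> (\<forall>i<length ws. \<forall>j<length ws. {ws ! i, ws ! j} \<in> edges H \<longleftrightarrow> j \<in> set (T ! i))"

locale cubic_flat_graph = flat_graph +
  assumes cubic: "x \<in> verts G \<Longrightarrow> card (neighbours G x) = 3"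
begin

text \<open>Recorded edges must exist in \<open>G\<close>; an unrecorded pair may or may not be
  adjacent.\<close>

definition realizes :: "'a list \<Rightarrow> state \<Rightarrow> bool" where
  "realizes vs A \<longleftrightarrow> length vs = length A \<and> distinct vs \<and> set vs \<subseteq> verts G
    \<and> (\<forall>i<length A. distinct (A ! i)
      \<and> (\<forall>j\<in>set (A ! i). j < length A \<and> i \<in> set (A ! j) \<and> adj (vs ! i) (vs ! j)))"

text \<open>Appending \<open>us\<close> leaves the numbers of the known vertices unchanged.\<close>

definition extends :: "'a list \<Rightarrow> state list \<Rightarrow> bool" where
  "extends vs Bs \<longleftrightarrow> (\<exists>B\<in>set Bs. \<exists>us. realizes (vs @ us) B)"

lemma realizesD:
  assumes "realizes vs A"
  shows "length vs = length A" "distinct vs" "set vs \<subseteq> verts G"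
    "i < length A \<Longrightarrow> distinct (A ! i)"
    "i < length A \<Longrightarrow> j \<in> set (A ! i) \<Longrightarrow> j < length A"
    "i < length A \<Longrightarrow> j \<in> set (A ! i) \<Longrightarrow> i \<in> set (A ! j)"
    "i < length A \<Longrightarrow> j \<in> set (A ! i) \<Longrightarrow> adj (vs ! i) (vs ! j)"
    "i < length A \<Longrightarrow> j < length A \<Longrightarrow> vs ! i = vs ! j \<longleftrightarrow> i = j"
    "i < length A \<Longrightarrow> vs ! i \<in> verts G"
proof -
  show *: "length vs = length A" "distinct vs" "set vs \<subseteq> verts G"
    "i < length A \<Longrightarrow> distinct (A ! i)"
    "i < length A \<Longrightarrow> j \<in> set (A ! i) \<Longrightarrow> j < length A"
    "i < length A \<Longrightarrow> j \<in> set (A ! i) \<Longrightarrow> i \<in> set (A ! j)"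
    "i < length A \<Longrightarrow> j \<in> set (A ! i) \<Longrightarrow> adj (vs ! i) (vs ! j)"
    using assms unfolding realizes_def by blast+
  show "i < length A \<Longrightarrow> j < length A \<Longrightarrow> vs ! i = vs ! j \<longleftrightarrow> i = j"
    using *(1,2) by (simp add: nth_eq_iff_index_eq)
  show "i < length A \<Longrightarrow> vs ! i \<in> verts G"
    using *(1,3) nth_mem[of i vs] by auto
qed

lemma realizes_neighbours:
  assumes r: "realizes vs A" and i: "i < length A"
  shows "(!) vs ` set (A ! i) \<subseteq> N (vs ! i)" "card ((!) vs ` set (A ! i)) = length (A ! i)"
proof -
  show "(!) vs ` set (A ! i) \<subseteq> N (vs ! i)" by (rule image_subsetI) (simp add: realizesD(7)[OF r i])
  have "inj_on ((!) vs) (set (A ! i))"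
    by (rule inj_onI) (use realizesD(5,8)[OF r] i in blast)
  then show "card ((!) vs ` set (A ! i)) = length (A ! i)"
    using distinct_card[OF realizesD(4)[OF r i]] by (simp add: card_image)
qed

text \<open>Here the degree turns positive information into negative: three recorded neighbours
  exclude every other one.\<close>

lemma realizes_full:
  assumes r: "realizes vs A" and i: "i < length A" and "length (A ! i) \<ge> 3"
  shows "N (vs ! i) = (!) vs ` set (A ! i)"
proof -
  have "card (N (vs ! i)) \<le> card ((!) vs ` set (A ! i))"
    using realizes_neighbours(2)[OF r i] cubic[OF realizesD(9)[OF r i]] assms(3) by simp
  then show ?thesis using card_seteq[OF finite_N realizes_neighbours(1)[OF r i]] by simp
qed

lemma realizes_full_mem:
  assumes r: "realizes vs A" and ij: "i < length A" "j < length A"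
    and "length (A ! i) \<ge> 3" "adj (vs ! i) (vs ! j)"
  shows "j \<in> set (A ! i)"
proof -
  have "vs ! j \<in> (!) vs ` set (A ! i)" using realizes_full[OF r ij(1) assms(4)] assms(5) by auto
  then show ?thesis using realizesD(5,8)[OF r] ij by auto
qed

lemma add_edge_sound:
  assumes r: "realizes vs A" and ij: "i < length A" "j < length A" and a: "adj (vs ! i) (vs ! j)"
  shows "\<exists>B\<in>set (add_edge i j A). realizes vs B"
proof (cases "j \<in> set (A ! i)")
  case True
  then show ?thesis using r by (simp add: add_edge_def)
next
  case False
  note R = realizesD[OF r]
  have ne: "i \<noteq> j" using a by auto
  have nji: "i \<notin> set (A ! j)" using False R(6) ij by blast
  have li: "\<not> 3 \<le> length (A ! i)" using realizes_full_mem[OF r ij _ a] False by blast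
  have lj: "\<not> 3 \<le> length (A ! j)"
    using realizes_full_mem[OF r ij(2,1) _ adj_sym[OF a]] nji by blast
  have tri: "\<not> (\<exists>k\<in>set (A ! i). k \<in> set (A ! j))"
    using R(7)[OF ij(1)] R(7)[OF ij(2)] no_triangle a adj_sym by blast
  have sq: "\<not> (\<exists>k\<in>set (A ! i). k \<noteq> j \<and> (\<exists>l\<in>set (A ! k). l \<noteq> i \<and> l \<in> set (A ! j)))"
  proof
    assume "\<exists>k\<in>set (A ! i). k \<noteq> j \<and> (\<exists>l\<in>set (A ! k). l \<noteq> i \<and> l \<in> set (A ! j))"
    then obtain k l where kl: "k \<in> set (A ! i)" "k \<noteq> j" "l \<in> set (A ! k)" "l \<noteq> i" "l \<in> set (A ! j)"
      by blast
    have kb: "k < length A" "l < length A" using R(5) ij kl by blast+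
    have "vs ! i = vs ! l \<or> vs ! k = vs ! j"
      using no_square[OF R(7)[OF ij(1) kl(1)] R(7)[OF kb(1) kl(3)] adj_sym[OF R(7)[OF ij(2) kl(5)]] adj_sym[OF a]] .
    then show False using R(8) ij kb kl by auto
  qed
  let ?B = "A[i := j # A ! i, j := i # A ! j]"
  have "add_edge i j A = [?B]" unfolding add_edge_def using False ne li lj tri sq by simp
  moreover have "realizes vs ?B"
    unfolding realizes_def
  proof (intro conjI allI impI ballI)
    show "length vs = length ?B" "distinct vs" "set vs \<subseteq> verts G" using R(1-3) by simp_all
    show "distinct (?B ! k)" if "k < length ?B" for k
      using that R(4)[of k] False nji ij ne by (cases "k = i"; cases "k = j") simp_all
    fix k l assume k: "k < length ?B" and l: "l \<in> set (?B ! k)"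
    then have "l \<in> set (A ! k) \<or> k = i \<and> l = j \<or> k = j \<and> l = i"
      using ij ne by (auto simp: nth_list_update split: if_splits)
    then show "l < length ?B" "adj (vs ! k) (vs ! l)" "k \<in> set (?B ! l)"
      using R(5-7)[of k l] k ij a ne adj_sym[OF a] by (auto simp: nth_list_update)
  qed
  ultimately show ?thesis by simp
qed

lemma realizes_new:
  assumes r: "realizes vs A" and w: "w \<in> verts G" "w \<notin> set vs"
  shows "realizes (vs @ [w]) (A @ [[]])"
  unfolding realizes_def
proof (intro conjI allI impI ballI)
  note R = realizesD[OF r]
  show "length (vs @ [w]) = length (A @ [[]])" "distinct (vs @ [w])" "set (vs @ [w]) \<subseteq> verts G"
    using R(1-3) w by simp_all
  fix i assume i: "i < length (A @ [[]])"
  show "distinct ((A @ [[]]) ! i)" using R(4)[of i] i by (cases "i < length A") (simp_all add: nth_append)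
  fix j assume j: "j \<in> set ((A @ [[]]) ! i)"
  then have i': "i < length A" using i by (cases "i < length A") (simp_all add: nth_append)
  then have j': "j \<in> set (A ! i)" using j by (simp add: nth_append)
  then show "j < length (A @ [[]])" "i \<in> set ((A @ [[]]) ! j)" "adj ((vs @ [w]) ! i) ((vs @ [w]) ! j)"
    using R(1) R(5-7)[OF i' j'] i' by (simp_all add: nth_append)
qed

lemma candidate_exists:
  assumes r: "realizes vs A" and w: "w \<in> verts G"
  obtains k B us where "(k, B) \<in> set (candidates A)" "realizes (vs @ us) B" "k < length B"
    "(vs @ us) ! k = w" "length A \<le> length B"
proof (cases "w \<in> set vs")
  case True
  then obtain k where "k < length A" "vs ! k = w" by (metis in_set_conv_nth realizesD(1)[OF r])
  then show ?thesis using that[of k A "[]"] r by (auto simp: candidates_def)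
next
  case False
  show ?thesis
    by (rule that[of "length A" "A @ [[]]" "[w]"])
       (use realizes_new[OF r w False] realizesD(1)[OF r] in \<open>auto simp: candidates_def nth_append\<close>)
qed

lemma length_add_edge: "B \<in> set (add_edge i j A) \<Longrightarrow> length B = length A"
  by (auto simp: add_edge_def split: if_splits)

lemma nth_extend: "realizes vs A \<Longrightarrow> i < length A \<Longrightarrow> (vs @ us) ! i = vs ! i"
  using realizesD(1) by (simp add: nth_append)

lemma mem_concat_map: "x \<in> set xs \<Longrightarrow> y \<in> set (f x) \<Longrightarrow> y \<in> set (concat (map f xs))"
  by auto

lemma vertex_branches_sound:
  assumes r: "realizes vs A" and i: "i < length A" "length (A ! i) < 3"
  shows "extends vs (vertex_branches i A)"
proof -
  have "(!) vs ` set (A ! i) \<noteq> N (vs ! i)"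
    using realizes_neighbours(2)[OF r i(1)] i(2) cubic[OF realizesD(9)[OF r i(1)]] by auto
  then obtain w where "w \<in> N (vs ! i)" and w2: "w \<notin> (!) vs ` set (A ! i)"
    using realizes_neighbours(1)[OF r i(1)] by blast
  then have w: "adj (vs ! i) w" by simp
  obtain k B us where k: "(k, B) \<in> set (candidates A)" "realizes (vs @ us) B" "k < length B"
    "(vs @ us) ! k = w" "length A \<le> length B"
    by (rule candidate_exists[OF r adj_verts(2)[OF w]])
  have ki: "k \<notin> set (A ! i)"
    using w2 realizesD(5)[OF r i(1)] nth_extend[OF r] k(4) by (metis image_eqI)
  obtain C where C: "C \<in> set (add_edge i k B)" "realizes (vs @ us) C"
    using add_edge_sound[OF k(2) _ k(3), of i] i(1) k(4,5) nth_extend[OF r i(1)] w by auto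
  have "C \<in> set (vertex_branches i A)"
    unfolding vertex_branches_def by (rule mem_concat_map[OF k(1)]) (simp add: ki C(1))
  then show ?thesis using C(2) unfolding extends_def by blast
qed

lemma common_branches_sound:
  assumes r: "realizes vs A" and pq: "p < length A" "q < length A" and c: "common (vs ! p) (vs ! q)"
  shows "extends vs (common_branches p q A)"
proof (cases "\<exists>k\<in>set (A ! p). k \<in> set (A ! q)")
  case True
  then show ?thesis using r by (auto simp: common_branches_def extends_def intro: exI[of _ "[]"])
next
  case False
  obtain w where w: "adj (vs ! p) w" "adj w (vs ! q)" using c by blast
  obtain k B us where k: "(k, B) \<in> set (candidates A)" "realizes (vs @ us) B" "k < length B"
    "(vs @ us) ! k = w" "length A \<le> length B"
    by (rule candidate_exists[OF r adj_verts(2)[OF w(1)]])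
  obtain C where C: "C \<in> set (add_edge p k B)" "realizes (vs @ us) C"
    using add_edge_sound[OF k(2) _ k(3), of p] pq(1) k(4,5) nth_extend[OF r pq(1)] w(1) by auto
  obtain D where D: "D \<in> set (add_edge k q C)" "realizes (vs @ us) D"
    using add_edge_sound[OF C(2), of k q] pq(2) k(3,4,5) length_add_edge[OF C(1)]
      nth_extend[OF r pq(2)] w(2) by auto
  have "D \<in> set (common_branches p q A)"
    unfolding common_branches_def if_not_P[OF False]
    by (rule mem_concat_map[OF k(1)]) (use C(1) D(1) in auto)
  then show ?thesis using D(2) unfolding extends_def by blast
qed

lemma length_common_branches: "B \<in> set (common_branches p q A) \<Longrightarrow> length A \<le> length B"
  by (auto simp: common_branches_def candidates_def split: if_splits dest!: length_add_edge)

lemma common_branches_twice_sound: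
  assumes r: "realizes vs A" and b: "p < length A" "q < length A" "s < length A" "t < length A"
    and c: "common (vs ! p) (vs ! q)" "common (vs ! s) (vs ! t)"
  shows "extends vs (concat (map (common_branches s t) (common_branches p q A)))"
proof -
  obtain B us where B: "B \<in> set (common_branches p q A)" "realizes (vs @ us) B"
    using common_branches_sound[OF r b(1,2) c(1)] unfolding extends_def by blast
  have "extends (vs @ us) (common_branches s t B)"
    by (rule common_branches_sound[OF B(2)])
       (use length_common_branches[OF B(1)] b c(2) nth_extend[OF r] in auto)
  then obtain C us' where C: "C \<in> set (common_branches s t B)" "realizes (vs @ us @ us') C"
    unfolding extends_def by auto
  then show ?thesis using mem_concat_map[of B _ C "common_branches s t", OF B(1)]
    unfolding extends_def by blast
qed

lemma edge_branches_sound: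
  assumes r: "realizes vs A" and xy: "x < length A" "y \<in> set (A ! x)"
    and Ax: "remove1 y (A ! x) = [x1, x2]" and Ay: "remove1 x (A ! y) = [y1, y2]"
  shows "extends vs (edge_branches x1 x2 y1 y2 A)"
proof -
  note R = realizesD[OF r]
  have y: "y < length A" "x \<in> set (A ! y)" using R(5,6) xy by blast+
  have sx: "set (A ! x) = {y, x1, x2}" and dx: "distinct [y, x1, x2]"
    and sy: "set (A ! y) = {x, y1, y2}" and dy: "distinct [x, y1, y2]"
    using Ax Ay R(4)[OF xy(1)] R(4)[OF y(1)] xy(2) y(2)
      set_remove1_eq[of "A ! x" y] set_remove1_eq[of "A ! y" x]
      distinct_remove1[of "A ! x" y] distinct_remove1[of "A ! y" x] by auto
  have lx: "length (A ! x) \<ge> 3" and ly: "length (A ! y) \<ge> 3"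
    using length_remove1[of y "A ! x"] length_remove1[of x "A ! y"] Ax Ay xy(2) y(2) by auto
  have Nx: "N (vs ! x) = {vs ! y, vs ! x1, vs ! x2}" and Ny: "N (vs ! y) = {vs ! x, vs ! y1, vs ! y2}"
    using realizes_full[OF r xy(1) lx] realizes_full[OF r y(1) ly] sx sy by auto
  have b: "x1 < length A" "x2 < length A" "y1 < length A" "y2 < length A"
    using R(5)[OF xy(1)] R(5)[OF y(1)] sx sy by auto
  have "distinct [vs ! y, vs ! x1, vs ! x2]" "distinct [vs ! x, vs ! y1, vs ! y2]"
    using dx dy R(8) b xy(1) y(1) by auto
  from edge_33[OF Nx Ny this] show ?thesis
    using common_branches_twice_sound[OF r b(1,3,2,4)] common_branches_twice_sound[OF r b(1,4,2,3)]
    unfolding edge_branches_def extends_def by (metis Un_iff set_append)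
qed

lemma iso_check_sound:
  assumes r: "realizes vs A" and chk: "iso_check T \<sigma> A" and ne: "A \<noteq> []" and rep: "represents T ws H"
  shows "graph_isomorphic G H"
proof -
  let ?n = "length A"
  have \<sigma>: "length \<sigma> = ?n" "length T = ?n" "distinct \<sigma>"
    and l: "\<And>i. i < ?n \<Longrightarrow> \<sigma> ! i < ?n" "\<And>i. i < ?n \<Longrightarrow> length (A ! i) = 3"
    and s: "\<And>i. i < ?n \<Longrightarrow> (!) \<sigma> ` set (A ! i) = set (T ! (\<sigma> ! i))"
    using chk by (auto simp: iso_check_def list_all2_conv_all_nth)
  have ws: "length ws = ?n" "distinct ws" "set ws = verts H"
    and e: "\<And>i j. i < ?n \<Longrightarrow> j < ?n \<Longrightarrow> {ws ! i, ws ! j} \<in> edges H \<longleftrightarrow> j \<in> set (T ! i)"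
    using rep \<sigma>(2) by (auto simp: represents_def)
  note R = realizesD[OF r]
  have inj\<sigma>: "inj_on ((!) \<sigma>) {..<?n}" using \<sigma> by (auto simp: inj_on_nth)
  have "(!) \<sigma> ` {..<?n} = {..<?n}"
    using l(1) by (intro endo_inj_surj inj\<sigma>) auto
  then have bij: "bij_betw ((!) \<sigma>) {..<?n} {..<?n}" using inj\<sigma> by (simp add: bij_betw_def)
  have "bij_betw ((!) ws) {..<?n} (verts H)" by (rule bij_betw_nth) (use ws in auto)
  then have h: "bij_betw (\<lambda>i. ws ! (\<sigma> ! i)) {..<?n} (verts H)"
    using bij_betw_trans[OF bij, of "(!) ws" "verts H"] by (simp add: comp_def)
  show ?thesis
  proof (rule graph_isomorphicI[OF _ _ h, of "(!) vs"])
    show "inj_on ((!) vs) {..<?n}" using R(8) by (auto intro: inj_onI)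
    show "(!) vs ` {..<?n} \<subseteq> verts G" using R(9) by auto
    fix i assume "i \<in> {..<?n}"
    then have i: "i < ?n" by simp
    have "{j \<in> {..<?n}. {ws ! (\<sigma> ! i), ws ! (\<sigma> ! j)} \<in> edges H} = {j \<in> {..<?n}. \<sigma> ! j \<in> (!) \<sigma> ` set (A ! i)}"
      using e l(1) i s by auto
    also have "\<dots> = set (A ! i)" using inj\<sigma> R(5)[OF i] by (auto simp: inj_on_def)
    finally show "N (vs ! i) = (!) vs ` {j \<in> {..<?n}. {ws ! (\<sigma> ! i), ws ! (\<sigma> ! j)} \<in> edges H}"
      using realizes_full[OF r i] l(2)[OF i] by simp
  qed (use ne in \<open>auto simp: lessThan_empty_iff\<close>)
qed

lemma expand_sound:
  assumes r: "realizes vs A" and ne: "A \<noteq> []" and ex: "expand Ts m A = Some Bs"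
    and fin: "\<And>t \<sigma> A vs. t < length Ts \<Longrightarrow> iso_check (Ts ! t) \<sigma> A \<Longrightarrow> A \<noteq> [] \<Longrightarrow> realizes vs A \<Longrightarrow> Q t"
  shows "extends vs Bs \<or> (\<exists>t<length Ts. Q t)"
proof (cases m)
  case (Vertex i)
  then show ?thesis using ex vertex_branches_sound[OF r] by (auto split: if_splits)
next
  case (Edge x y)
  then show ?thesis using ex edge_branches_sound[OF r, of x y]
    by (auto split: if_splits list.splits)
next
  case (Final t \<sigma>)
  then have "t < length Ts" "iso_check (Ts ! t) \<sigma> A" using ex by (auto split: if_splits)
  then show ?thesis using fin[OF _ _ ne r] by blast
qed

text \<open>The invariant is that some state on the stack is realized in \<open>G\<close>. It
  contradicts an empty stack, so a successful run must meet a realized state that is closed by a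
  \<open>Final\<close> move.\<close>

lemma run_sound:
  assumes "run Ts ms As" and "\<exists>A\<in>set As. \<exists>vs. vs \<noteq> [] \<and> realizes vs A"
    and fin: "\<And>t \<sigma> A vs. t < length Ts \<Longrightarrow> iso_check (Ts ! t) \<sigma> A \<Longrightarrow> A \<noteq> [] \<Longrightarrow> realizes vs A \<Longrightarrow> Q t"
  shows "\<exists>t<length Ts. Q t"
  using assms(1,2)
proof (induction ms arbitrary: As)
  case Nil
  then show ?case by (cases As) auto
next
  case (Cons m ms As')
  then obtain A As where As: "As' = A # As" by (cases As') auto
  then obtain Bs where Bs: "expand Ts m A = Some Bs" "run Ts ms (Bs @ As)"
    using Cons.prems(1) by (auto split: option.splits)
  obtain B vs where B: "B \<in> set As'" "vs \<noteq> []" "realizes vs B" using Cons.prems(2) by blast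
  show ?case
  proof (cases "B \<in> set As")
    case True
    then show ?thesis using Cons.IH[OF Bs(2)] B by auto
  next
    case False
    then have r: "realizes vs A" using B As by auto
    have A: "A \<noteq> []" using B(2) realizesD(1)[OF r] by auto
    have "extends vs Bs \<or> (\<exists>t<length Ts. Q t)"
      by (rule expand_sound[OF r A Bs(1)]) (rule fin)
    then consider "extends vs Bs" | "\<exists>t<length Ts. Q t" by blast
    then show ?thesis
    proof cases
      case 1
      then obtain C us where "C \<in> set Bs" "realizes (vs @ us) C" unfolding extends_def by blast
      then show ?thesis using Cons.IH[OF Bs(2)] B(2) by (metis Un_iff append_is_Nil_conv set_append)
    qed
  qed
qed

lemma start_state_realized: "\<exists>vs. vs \<noteq> [] \<and> realizes vs start_state"
proof -
  obtain e where "e \<in> edges G" using nonempty by blast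
  then obtain x y where xy: "adj x y" using simple unfolding simple_graph_def by (metis card_2_iff)
  have yx: "adj y x" by (rule adj_sym[OF xy])
  obtain x1 x2 where Nx: "N x = {y, x1, x2}" "distinct [y, x1, x2]"
    using N_eq_3E[OF xy cubic[OF adj_verts(1)[OF xy]]] .
  obtain y1 y2 where Ny: "N y = {x, y1, y2}" "distinct [x, y1, y2]"
    using N_eq_3E[OF yx cubic[OF adj_verts(1)[OF yx]]] .
  have *: "\<exists>vs. vs \<noteq> [] \<and> realizes vs start_state"
    if Ny: "N y = {x, y1, y2}" "distinct [x, y1, y2]" and c: "common x1 y1" "common x2 y2" for y1 y2
  proof -
    obtain u v where u: "adj x1 u" "adj u y1" and v: "adj x2 v" "adj v y2" using c by blast
    have a: "adj x x1" "adj x x2" "adj y y1" "adj y y2"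
      by (simp_all add: adj_N_eq[OF Nx(1)] adj_N_eq[OF Ny(1)])
    note s = xy a u v
    note s' = s[THEN adj_sym]
    have n: "x1 \<noteq> y1" "x1 \<noteq> y2" "x2 \<noteq> y1" "x2 \<noteq> y2"
      using no_triangle[of x y] s s' by blast+
    have nu: "u \<noteq> x" "u \<noteq> y" "v \<noteq> x" "v \<noteq> y"
      using no_triangle[of x y] s s' by blast+
    have nu2: "u \<noteq> y2" "u \<noteq> x2" "v \<noteq> y1" "v \<noteq> x1"
      using no_triangle s s' by blast+
    \<comment> \<open>If the apexes of the two pentagons coincided, \<open>x\<close>,
      \<open>x1\<close>, \<open>u\<close>, \<open>x2\<close> would form a square.\<close>
    have "u \<noteq> v"
      using no_square[of x x1 u x2] s s' Nx(2) nu by auto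
    then have "distinct [x, y, x1, x2, y1, y2, u, v]"
      using Nx(2) Ny(2) n nu nu2 adj_neq[OF s(1)] adj_neq[OF s(2)] adj_neq[OF s(3)] adj_neq[OF s(4)]
        adj_neq[OF s(5)] adj_neq[OF s(6)] adj_neq[OF s(7)] adj_neq[OF s(8)] adj_neq[OF s(9)]
      by auto
    then have "realizes [x, y, x1, x2, y1, y2, u, v] start_state"
      unfolding realizes_def using s s' s[THEN adj_verts(1)] s[THEN adj_verts(2)]
      by (simp add: start_state_def All_less_Suc numeral_eq_Suc)
    then show ?thesis by blast
  qed
  have Ny': "N y = {x, y2, y1}" "distinct [x, y2, y1]" using Ny by auto
  show ?thesis using edge_33[OF Nx(1) Ny(1) Nx(2) Ny(2)] *[OF Ny] *[OF Ny'] by blast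
qed

lemma cubic_classification:
  assumes "represents dodecahedral_adj ws0 H0" "represents petersen_adj ws1 H1"
    "represents triplex_adj ws2 H2"
  shows "graph_isomorphic G H0 \<or> graph_isomorphic G H1 \<or> graph_isomorphic G H2"
proof -
  let ?Ts = "[dodecahedral_adj, petersen_adj, triplex_adj]"
  let ?Q = "\<lambda>t. t = 0 \<and> graph_isomorphic G H0 \<or> t = 1 \<and> graph_isomorphic G H1
    \<or> t = (2::nat) \<and> graph_isomorphic G H2"
  have "\<exists>t<length ?Ts. ?Q t"
  proof (rule run_sound[OF run_certificate])
    show "\<exists>A\<in>set [start_state]. \<exists>vs. vs \<noteq> [] \<and> realizes vs A"
      using start_state_realized by simp
    fix t \<sigma> A vs assume t: "t < length ?Ts" and A: "iso_check (?Ts ! t) \<sigma> A" "A \<noteq> []" "realizes vs A"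
    from t have "t = 0 \<or> t = 1 \<or> t = 2" by auto
    then show "?Q t"
      using iso_check_sound[OF A(3) _ A(2) assms(1)] iso_check_sound[OF A(3) _ A(2) assms(2)]
        iso_check_sound[OF A(3) _ A(2) assms(3)] A(1) by (elim disjE) auto
  qed
  then show ?thesis by blast
qed

end

section \<open>The dodecahedron\<close>

lemma face_of_convex_hull_maximizers:
  fixes S :: "'v::euclidean_space set"
  assumes "finite S" "T \<subseteq> S" and T: "\<And>x. x \<in> T \<Longrightarrow> c \<bullet> x = b"
    and less: "\<And>x. x \<in> S - T \<Longrightarrow> c \<bullet> x < b"
  shows "(convex hull T) face_of (convex hull S)"
proof (rule face_of_convex_hulls)
  have "affine hull T \<subseteq> {x. c \<bullet> x = b}"
    by (rule hull_minimal) (use T in \<open>auto simp: affine_hyperplane\<close>)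
  moreover have "convex hull (S - T) \<subseteq> {x. c \<bullet> x < b}"
    by (rule hull_minimal) (use less in \<open>auto simp: convex_halfspace_lt\<close>)
  ultimately show "affine hull T \<inter> convex hull (S - T) = {}" by fastforce
qed (use assms in auto)

text \<open>Elements \<open>a + b \<phi>\<close> of the ring generated by the golden ratio, as pairs \<open>(a, b)\<close>.\<close>

type_synonym zphi = "int \<times> int"

definition zphi_val :: "zphi \<Rightarrow> real" where
  "zphi_val x = of_int (fst x) + of_int (snd x) * golden_ratio"

definition zadd :: "zphi \<Rightarrow> zphi \<Rightarrow> zphi" where
  "zadd x y = (fst x + fst y, snd x + snd y)"

definition zsub :: "zphi \<Rightarrow> zphi \<Rightarrow> zphi" where
  "zsub x y = (fst x - fst y, snd x - snd y)"

definition zmul :: "zphi \<Rightarrow> zphi \<Rightarrow> zphi" where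
  "zmul x y = (fst x * fst y + snd x * snd y, fst x * snd y + snd x * fst y + snd x * snd y)"

lemma golden_ratio_sq: "golden_ratio * golden_ratio = golden_ratio + 1"
  by (simp add: golden_ratio_def field_simps)

lemma golden_ratio_bounds: "1 < golden_ratio" "golden_ratio < 2"
proof -
  have "1 < sqrt 5" by simp
  moreover have "sqrt 5 < 3" by (rule real_less_lsqrt) auto
  ultimately show "1 < golden_ratio" "golden_ratio < 2" by (auto simp: golden_ratio_def)
qed

lemma golden_ratio_inverse: "1 / golden_ratio = golden_ratio - 1"
  using golden_ratio_sq golden_ratio_bounds by (simp add: field_simps)

lemma zphi_val_ring:
  "zphi_val (zadd x y) = zphi_val x + zphi_val y"
  "zphi_val (zsub x y) = zphi_val x - zphi_val y"
  "zphi_val (zmul x y) = zphi_val x * zphi_val y"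
proof -
  show "zphi_val (zadd x y) = zphi_val x + zphi_val y" "zphi_val (zsub x y) = zphi_val x - zphi_val y"
    by (simp_all add: zphi_val_def zadd_def zsub_def algebra_simps)
  have "zphi_val x * zphi_val y = of_int (fst x * fst y)
    + of_int (fst x * snd y + snd x * fst y) * golden_ratio
    + of_int (snd x * snd y) * (golden_ratio * golden_ratio)"
    by (simp add: zphi_val_def algebra_simps)
  then show "zphi_val (zmul x y) = zphi_val x * zphi_val y"
    unfolding golden_ratio_sq by (simp add: zphi_val_def zmul_def algebra_simps)
qed

text \<open>A sufficient test obtained from 1 < \<phi> < 2: replace \<phi> by the bound that makes
  the value smaller.\<close>

definition znonneg :: "zphi \<Rightarrow> bool" where
  "znonneg x \<longleftrightarrow> 0 \<le> snd x \<and> 0 \<le> fst x + snd x \<or> snd x \<le> 0 \<and> 0 \<le> fst x + 2 * snd x"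

lemma zphi_val_nonneg: "znonneg x \<Longrightarrow> zphi_val x \<ge> 0"
  unfolding znonneg_def
proof (elim disjE conjE)
  assume "0 \<le> snd x" "0 \<le> fst x + snd x"
  moreover from this have "of_int (snd x) * 1 \<le> of_int (snd x) * golden_ratio"
    using golden_ratio_bounds by (intro mult_left_mono) auto
  ultimately show ?thesis unfolding zphi_val_def by linarith
next
  assume "snd x \<le> 0" "0 \<le> fst x + 2 * snd x"
  moreover from this have "of_int (snd x) * 2 \<le> of_int (snd x) * golden_ratio"
    using golden_ratio_bounds by (intro mult_left_mono_neg) auto
  ultimately show ?thesis unfolding zphi_val_def by linarith
qed

section \<open>Exact coordinates and faces of the dodecahedron\<close>

type_synonym zvec = "zphi \<times> zphi \<times> zphi"

definition zinner :: "zvec \<Rightarrow> zvec \<Rightarrow> zphi" where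
  "zinner u v = (case (u, v) of ((x, y, z), (x', y', z')) \<Rightarrow>
    zadd (zmul x x') (zadd (zmul y y') (zmul z z')))"

definition zvsub :: "zvec \<Rightarrow> zvec \<Rightarrow> zvec" where
  "zvsub u v = (case (u, v) of ((x, y, z), (x', y', z')) \<Rightarrow> (zsub x x', zsub y y', zsub z z'))"

definition zvadd :: "zvec \<Rightarrow> zvec \<Rightarrow> zvec" where
  "zvadd u v = (case (u, v) of ((x, y, z), (x', y', z')) \<Rightarrow> (zadd x x', zadd y y', zadd z z'))"

definition zscale :: "zphi \<Rightarrow> zvec \<Rightarrow> zvec" where
  "zscale c u = (case u of (x, y, z) \<Rightarrow> (zmul c x, zmul c y, zmul c z))"

definition zpoint :: "zvec \<Rightarrow> real ^ 3" where
  "zpoint u = (case u of (x, y, z) \<Rightarrow> vector [zphi_val x, zphi_val y, zphi_val z])"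

lemma vec3_eq_iff: "(u :: real ^ 3) = v \<longleftrightarrow> u $ 1 = v $ 1 \<and> u $ 2 = v $ 2 \<and> u $ 3 = v $ 3"
  by (simp add: vec_eq_iff forall_3)

lemma zpoint_inner: "zpoint u \<bullet> zpoint v = zphi_val (zinner u v)"
  by (auto simp: zpoint_def zinner_def inner_vec_def sum_3 zphi_val_ring split: prod.split)

lemma zpoint_linear:
  "zpoint (zvsub u v) = zpoint u - zpoint v"
  "zpoint (zvadd u v) = zpoint u + zpoint v"
  "zpoint (zscale c u) = zphi_val c *\<^sub>R zpoint u"
  by (cases u rule: prod_cases3; cases v rule: prod_cases3;
      simp add: zpoint_def zvsub_def zvadd_def zscale_def vec3_eq_iff zphi_val_ring)+

text \<open>The inverse of \<phi> is \<phi> - 1, so it appears as \<open>(-1, 1)\<close> and its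
  negative as \<open>(1, -1)\<close>.\<close>

definition dod_coords :: "zvec list" where
  "dod_coords =
    [((-1,0),(-1,0),(-1,0)), ((-1,0),(-1,0),(1,0)), ((-1,0),(1,0),(-1,0)), ((-1,0),(1,0),(1,0)),
    ((1,0),(-1,0),(-1,0)), ((1,0),(-1,0),(1,0)), ((1,0),(1,0),(-1,0)), ((1,0),(1,0),(1,0)),
    ((0,0),(1,-1),(0,-1)), ((0,0),(1,-1),(0,1)), ((0,0),(-1,1),(0,-1)), ((0,0),(-1,1),(0,1)),
    ((1,-1),(0,-1),(0,0)), ((1,-1),(0,1),(0,0)), ((-1,1),(0,-1),(0,0)), ((-1,1),(0,1),(0,0)),
    ((0,-1),(0,0),(1,-1)), ((0,1),(0,0),(1,-1)), ((0,-1),(0,0),(-1,1)), ((0,1),(0,0),(-1,1))]"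

definition dod_points :: "(real ^ 3) list" where
  "dod_points = map zpoint dod_coords"

text \<open>The inner products that occur are \<open>3\<close> (equal), \<open>\<surd>5 = 2 \<phi> - 1\<close> (adjacent), \<open>\<plusminus>1\<close>, \<open>-\<surd>5\<close>, \<open>-3\<close>.\<close>

lemma dod_inner_check:
  "list_all (\<lambda>i. list_all (\<lambda>j. (let s = zinner (dod_coords ! i) (dod_coords ! j) in
      if i = j then s = (3, 0)
      else if j \<in> set (dodecahedral_adj ! i) then s = (-1, 2)
      else s \<in> set [(1, 0), (-1, 0), (1, -2), (-3, 0)])) [0..<20]) [0..<20]"
  by code_simp

text \<open>The cone at a vertex \<open>u\<close> is spanned by the edges to its three neighbours \<open>n\<close>: solving for the
  coefficients of \<open>2 (v - u)\<close> with the Gram matrix of \<open>u\<close> and these neighbours gives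
  \<open>v \<bullet> n + 1 + \<phi> (1 - v \<bullet> u)\<close>.\<close>

definition cone_coeff :: "zvec \<Rightarrow> zvec \<Rightarrow> zvec \<Rightarrow> zphi" where
  "cone_coeff u v n = zadd (zadd (zinner v n) (1, 0)) (zmul (0, 1) (zsub (1, 0) (zinner v u)))"

lemma dod_cone_check:
  "list_all (\<lambda>i. list_all (\<lambda>j. i = j \<or> j \<in> set (dodecahedral_adj ! i) \<or>
      (let u = dod_coords ! i; v = dod_coords ! j; ns = map ((!) dod_coords) (dodecahedral_adj ! i) in
        list_all (\<lambda>n. znonneg (cone_coeff u v n)) ns \<and>
        zscale (2, 0) (zvsub v u) =
          foldr (\<lambda>n. zvadd (zscale (cone_coeff u v n) (zvsub n u))) ns ((0, 0), (0, 0), (0, 0)))) [0..<20]) [0..<20]"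
  by code_simp

lemma dod_adj_bound: "list_all (\<lambda>js. list_all (\<lambda>j. j < 20) js) dodecahedral_adj"
  by code_simp

lemma set_dod_points:
  "set dod_points =
     ({vector [x, y, z] |x y z. x \<in> {-1, 1} \<and> y \<in> {-1, 1} \<and> z \<in> {-1, 1}} \<union>
      {vector [0, s / golden_ratio, t * golden_ratio] |s t. s \<in> {-1, 1} \<and> t \<in> {-1, 1}} \<union>
      {vector [s / golden_ratio, t * golden_ratio, 0] |s t. s \<in> {-1, 1} \<and> t \<in> {-1, 1}} \<union>
      {vector [t * golden_ratio, 0, s / golden_ratio] |s t. s \<in> {-1, 1} \<and> t \<in> {-1, 1}})"
  (is "_ = ?A \<union> ?B \<union> ?C \<union> ?D")
proof -
  have A: "?A = (\<Union>x\<in>{-1, 1}. \<Union>y\<in>{-1, 1}. \<Union>z\<in>{-1, 1}. {vector [x, y, z]})" by blast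
  have B: "?B = (\<Union>s\<in>{-1, 1}. \<Union>t\<in>{-1, 1}. {vector [0, s / golden_ratio, t * golden_ratio]})" by blast
  have C: "?C = (\<Union>s\<in>{-1, 1}. \<Union>t\<in>{-1, 1}. {vector [s / golden_ratio, t * golden_ratio, 0]})" by blast
  have D: "?D = (\<Union>s\<in>{-1, 1}. \<Union>t\<in>{-1, 1}. {vector [t * golden_ratio, 0, s / golden_ratio]})" by blast
  have m: "- 1 / golden_ratio = 1 - golden_ratio" using golden_ratio_inverse by simp
  show ?thesis
    unfolding A B C D set_rev[of dod_points, symmetric]
    by (simp add: dod_points_def dod_coords_def zpoint_def zphi_val_def golden_ratio_inverse m
        del: divide_minus_left minus_divide_left[symmetric])
qed

lemma regular_dodecahedron_eq: "regular_dodecahedron = convex hull (set dod_points)"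
  unfolding regular_dodecahedron_def set_dod_points ..

lemma length_dod_points: "length dod_points = 20" "length dodecahedral_adj = 20"
  by (simp_all add: dod_points_def dod_coords_def dodecahedral_adj_def)

lemma dod_inner:
  assumes "i < 20" "j < 20"
  shows "dod_points ! i \<bullet> dod_points ! i = 3"
    and "i \<noteq> j \<Longrightarrow> dod_points ! i \<bullet> dod_points ! j \<le> 2 * golden_ratio - 1"
    and "j \<in> set (dodecahedral_adj ! i) \<Longrightarrow> i \<noteq> j \<and> dod_points ! i \<bullet> dod_points ! j = 2 * golden_ratio - 1"
proof -
  have ip: "dod_points ! i \<bullet> dod_points ! j = zphi_val (zinner (dod_coords ! i) (dod_coords ! j))"
    if "i < 20" "j < 20" for i j
    using that length_dod_points(1) by (simp add: dod_points_def zpoint_inner)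
  have chk: "let s = zinner (dod_coords ! i) (dod_coords ! j) in
      if i = j then s = (3, 0)
      else if j \<in> set (dodecahedral_adj ! i) then s = (-1, 2)
      else s \<in> set [(1, 0), (-1, 0), (1, -2), (-3, 0)]" if "i < 20" "j < 20" for i j
  proof -
    have "i \<in> set [0..<20]" "j \<in> set [0..<20]" using that by auto
    then show ?thesis using dod_inner_check unfolding list_all_iff by blast
  qed
  show 1: "dod_points ! i \<bullet> dod_points ! i = 3"
    using chk[OF assms(1,1)] ip[OF assms(1,1)] by (simp add: zphi_val_def)
  show "dod_points ! i \<bullet> dod_points ! j \<le> 2 * golden_ratio - 1" if "i \<noteq> j"
    using chk[OF assms] ip[OF assms] that golden_ratio_bounds
    by (auto simp: zphi_val_def Let_def split: if_splits)
  show "i \<noteq> j \<and> dod_points ! i \<bullet> dod_points ! j = 2 * golden_ratio - 1" if "j \<in> set (dodecahedral_adj ! i)"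
  proof -
    have "i \<notin> set (dodecahedral_adj ! i)"
    proof -
      have "list_all (\<lambda>i. i \<notin> set (dodecahedral_adj ! i)) [0..<20]" by code_simp
      then show ?thesis using assms(1) by (auto simp: list_all_iff)
    qed
    then show ?thesis
      using chk[OF assms] ip[OF assms] that
      by (auto simp: zphi_val_def Let_def split: if_splits)
  qed
qed

lemma dod_inner_less:
  assumes "i < 20" "j < 20" "i \<noteq> j"
  shows "dod_points ! i \<bullet> dod_points ! j < 3"
  using dod_inner(2)[OF assms] golden_ratio_bounds by simp

lemma distinct_dod_points: "distinct dod_points"
  unfolding distinct_conv_nth
proof (intro allI impI)
  fix i j assume "i < length dod_points" "j < length dod_points" "i \<noteq> j"
  then show "dod_points ! i \<noteq> dod_points ! j"
    using dod_inner_less[of i j] dod_inner(1)[of i i] by (auto simp: length_dod_points)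
qed

lemma dod_pointE:
  assumes "x \<in> set dod_points"
  obtains k where "k < 20" "x = dod_points ! k"
  using assms by (metis in_set_conv_nth length_dod_points(1))

text \<open>All points have squared norm 3, so the functional given by a point itself is maximal
  exactly there.\<close>

lemma verts_dodecahedral_graph: "verts dodecahedral_graph = set dod_points"
proof -
  have "x extreme_point_of (convex hull (set dod_points))" if x: "x \<in> set dod_points" for x
  proof -
    obtain i where i: "i < 20" "x = dod_points ! i" using dod_pointE[OF x] .
    have "(convex hull {x}) face_of (convex hull (set dod_points))"
    proof (rule face_of_convex_hull_maximizers[where c = x and b = 3])
      fix y assume "y \<in> set dod_points - {x}"
      then show "x \<bullet> y < 3" using i dod_inner_less[OF i(1)] by (metis DiffE dod_pointE singletonI)
    qed (use x i dod_inner(1)[of i i] in auto)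
    then show ?thesis by (simp add: face_of_singleton)
  qed
  then show ?thesis
    by (auto simp: dodecahedral_graph_def one_skeleton_def regular_dodecahedron_eq
        dest: extreme_point_of_convex_hull)
qed

text \<open>The functional \<open>u + v\<close> takes the value 3 + (2 \<phi> - 1) at both ends and
  at most 2 (2 \<phi> - 1) elsewhere, which is smaller since \<phi> < 2.\<close>

lemma dod_adjacent_edge:
  assumes i: "i < 20" and j: "j < 20" and a: "j \<in> set (dodecahedral_adj ! i)"
  shows "closed_segment (dod_points ! i) (dod_points ! j) edge_of regular_dodecahedron"
proof -
  let ?u = "dod_points ! i" and ?v = "dod_points ! j"
  have ne: "i \<noteq> j" and ip: "?u \<bullet> ?v = 2 * golden_ratio - 1" using dod_inner(3)[OF i j a] by auto
  then have uv: "?u \<noteq> ?v" using i j distinct_dod_points by (simp add: nth_eq_iff_index_eq length_dod_points)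
  have "(convex hull {?u, ?v}) face_of (convex hull (set dod_points))"
  proof (rule face_of_convex_hull_maximizers[where c = "?u + ?v" and b = "2 * golden_ratio + 2"])
    show "{?u, ?v} \<subseteq> set dod_points" using i j by (simp add: length_dod_points)
    show "(?u + ?v) \<bullet> x = 2 * golden_ratio + 2" if "x \<in> {?u, ?v}" for x
      using that ip dod_inner(1)[OF i i] dod_inner(1)[OF j j] by (auto simp: inner_add_left inner_commute[of ?v ?u])
    fix x assume x: "x \<in> set dod_points - {?u, ?v}"
    then obtain k where k: "k < 20" "x = dod_points ! k" by (metis DiffD1 dod_pointE)
    then have "i \<noteq> k" "j \<noteq> k" using x by auto
    then show "(?u + ?v) \<bullet> x < 2 * golden_ratio + 2"
      using dod_inner(2)[OF i k(1)] dod_inner(2)[OF j k(1)] golden_ratio_bounds k(2)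
      by (simp add: inner_add_left)
  qed auto
  then show ?thesis
    using uv by (simp add: edge_of_def regular_dodecahedron_eq segment_convex_hull aff_dim_convex_hull aff_dim_2)
qed

lemma inner_sum_list_right: "a \<bullet> (\<Sum>k\<leftarrow>ks. f k) = (\<Sum>k\<leftarrow>ks. a \<bullet> f k)"
  by (induction ks) (simp_all add: inner_add_right)

lemma cone_decomposition:
  assumes "\<And>n. n \<in> set ns \<Longrightarrow> znonneg (cone_coeff u v n)"
    and "zscale (2, 0) (zvsub v u) =
      foldr (\<lambda>n. zvadd (zscale (cone_coeff u v n) (zvsub n u))) ns ((0, 0), (0, 0), (0, 0))"
  shows "2 *\<^sub>R (zpoint v - zpoint u) = (\<Sum>n\<leftarrow>ns. zphi_val (cone_coeff u v n) *\<^sub>R (zpoint n - zpoint u))"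
proof -
  have z: "zpoint ((0, 0), (0, 0), (0, 0)) = 0"
    by (simp add: zpoint_def vec3_eq_iff zphi_val_def)
  have "zpoint (foldr (\<lambda>n. zvadd (zscale (cone_coeff u v n) (zvsub n u))) ns ((0, 0), (0, 0), (0, 0)))
      = (\<Sum>n\<leftarrow>ns. zphi_val (cone_coeff u v n) *\<^sub>R (zpoint n - zpoint u))"
    by (induction ns) (simp_all add: z zpoint_linear)
  moreover have "zpoint (zscale (2, 0) (zvsub v u)) = 2 *\<^sub>R (zpoint v - zpoint u)"
    by (simp add: zpoint_linear zphi_val_def)
  ultimately show ?thesis using assms(2) by simp
qed

text \<open>A functional exposing the segment vanishes on \<open>v - u\<close> but is negative along
  the three edges at \<open>u\<close> when \<open>v\<close> is not adjacent to \<open>u\<close>. As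
  2 (\<open>v - u\<close>) is a nonnegative combination of these edges, all coefficients vanish and
  \<open>v = u\<close>.\<close>

lemma dod_edge_adjacent:
  assumes i: "i < 20" and j: "j < 20" and ne: "i \<noteq> j"
    and e: "closed_segment (dod_points ! i) (dod_points ! j) edge_of regular_dodecahedron"
  shows "j \<in> set (dodecahedral_adj ! i)"
proof (rule ccontr)
  assume na: "j \<notin> set (dodecahedral_adj ! i)"
  let ?u = "dod_points ! i" and ?v = "dod_points ! j"
  let ?F = "closed_segment ?u ?v"
  let ?c = "\<lambda>k. zphi_val (cone_coeff (dod_coords ! i) (dod_coords ! j) (dod_coords ! k))"
  have "polyhedron regular_dodecahedron"
    unfolding regular_dodecahedron_eq by (intro polytope_imp_polyhedron polytope_convex_hull) simp
  then have "?F exposed_face_of regular_dodecahedron"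
    using e by (simp add: exposed_face_of_polyhedron edge_of_def)
  then obtain a b where ab: "regular_dodecahedron \<subseteq> {x. a \<bullet> x \<le> b}" "?F = regular_dodecahedron \<inter> {x. a \<bullet> x = b}"
    unfolding exposed_face_of_def by blast
  have in_P: "dod_points ! k \<in> regular_dodecahedron" if "k < 20" for k
    unfolding regular_dodecahedron_eq by (rule hull_inc) (use that in \<open>simp add: length_dod_points\<close>)
  have au: "a \<bullet> ?u = b" "a \<bullet> ?v = b" using ab(2) by auto
  have adj: "k < 20 \<and> k \<noteq> i \<and> k \<noteq> j" if "k \<in> set (dodecahedral_adj ! i)" for k
  proof -
    have "k < 20" using dod_adj_bound that i by (force simp: list_all_iff length_dod_points)
    then show ?thesis using dod_inner(3)[OF i _ that] na that by auto
  qed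
  \<comment> \<open>A neighbour is an extreme point different from both ends, hence lies off the
    segment and strictly below the supporting plane.\<close>
  have neg: "a \<bullet> (dod_points ! k - ?u) < 0" if k: "k \<in> set (dodecahedral_adj ! i)" for k
  proof -
    have "dod_points ! k \<notin> ?F"
    proof
      assume "dod_points ! k \<in> ?F"
      moreover have "dod_points ! k extreme_point_of regular_dodecahedron"
        using verts_dodecahedral_graph adj[OF k]
        by (auto simp: dodecahedral_graph_def one_skeleton_def length_dod_points set_eq_iff)
      ultimately have "dod_points ! k = ?u \<or> dod_points ! k = ?v"
        using in_P[OF i] in_P[OF j] unfolding extreme_point_of_def closed_segment_eq_open by blast
      then show False using adj[OF k] i j distinct_dod_points by (auto simp: nth_eq_iff_index_eq length_dod_points)
    qed
    then have "a \<bullet> dod_points ! k \<noteq> b" using ab(2) in_P adj[OF k] by blast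
    moreover have "a \<bullet> dod_points ! k \<le> b" using ab(1) in_P adj[OF k] by blast
    ultimately show ?thesis using au by (simp add: inner_diff_right)
  qed
  have pt: "zpoint (dod_coords ! k) = dod_points ! k" if "k < 20" for k
    using that length_dod_points(1) by (simp add: dod_points_def)
  have chk: "list_all (\<lambda>n. znonneg (cone_coeff (dod_coords ! i) (dod_coords ! j) n)) (map ((!) dod_coords) (dodecahedral_adj ! i))"
    "zscale (2, 0) (zvsub (dod_coords ! j) (dod_coords ! i)) =
      foldr (\<lambda>n. zvadd (zscale (cone_coeff (dod_coords ! i) (dod_coords ! j) n) (zvsub n (dod_coords ! i))))
        (map ((!) dod_coords) (dodecahedral_adj ! i)) ((0, 0), (0, 0), (0, 0))"
    using dod_cone_check i j ne na unfolding list_all_iff Let_def by force+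
  have c0: "?c k \<ge> 0" if "k \<in> set (dodecahedral_adj ! i)" for k
    using chk(1) that by (auto simp: list_all_iff intro: zphi_val_nonneg)
  have "2 *\<^sub>R (zpoint (dod_coords ! j) - zpoint (dod_coords ! i)) =
    (\<Sum>n\<leftarrow>map ((!) dod_coords) (dodecahedral_adj ! i).
      zphi_val (cone_coeff (dod_coords ! i) (dod_coords ! j) n) *\<^sub>R (zpoint n - zpoint (dod_coords ! i)))"
    by (rule cone_decomposition[OF _ chk(2)]) (use chk(1) in \<open>auto simp: list_all_iff\<close>)
  also have "\<dots> = (\<Sum>k\<leftarrow>dodecahedral_adj ! i. ?c k *\<^sub>R (dod_points ! k - ?u))"
    unfolding map_map comp_def by (rule arg_cong[where f = sum_list], rule map_cong) (use adj i pt in auto)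
  finally have eq: "2 *\<^sub>R (?v - ?u) = (\<Sum>k\<leftarrow>dodecahedral_adj ! i. ?c k *\<^sub>R (dod_points ! k - ?u))"
    using pt i j by simp
  have "0 = a \<bullet> (2 *\<^sub>R (?v - ?u))" using au by (simp add: inner_diff_right)
  also have "\<dots> = (\<Sum>k\<leftarrow>dodecahedral_adj ! i. ?c k * (a \<bullet> (dod_points ! k - ?u)))"
    unfolding eq inner_sum_list_right by simp
  finally have sum0: "(\<Sum>k\<leftarrow>dodecahedral_adj ! i. ?c k * (a \<bullet> (dod_points ! k - ?u))) = 0" ..
  have z: "?c k = 0" if k: "k \<in> set (dodecahedral_adj ! i)" for k
  proof -
    have np: "?c k * (a \<bullet> (dod_points ! k - ?u)) \<le> 0" if "k \<in> set (dodecahedral_adj ! i)" for k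
      using c0[OF that] neg[OF that] by (simp add: mult_nonneg_nonpos)
    have "(\<Sum>k\<leftarrow>dodecahedral_adj ! i. - (?c k * (a \<bullet> (dod_points ! k - ?u)))) = 0"
      using sum0 by (simp add: uminus_sum_list_map[symmetric, unfolded comp_def])
    then have "- (?c k * (a \<bullet> (dod_points ! k - ?u))) = 0"
      using np k by (subst (asm) sum_list_nonneg_eq_0_iff) auto
    then show ?thesis using neg[OF k] by auto
  qed
  have "(\<Sum>k\<leftarrow>dodecahedral_adj ! i. ?c k *\<^sub>R (dod_points ! k - ?u)) = (\<Sum>k\<leftarrow>dodecahedral_adj ! i. 0)"
    by (rule arg_cong[where f = sum_list], rule map_cong) (use z in auto)
  then have "?v = ?u" using eq by simp
  then show False using ne i j distinct_dod_points by (simp add: nth_eq_iff_index_eq length_dod_points)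
qed

lemma represents_dodecahedral: "represents dodecahedral_adj dod_points dodecahedral_graph"
  unfolding represents_def length_dod_points
proof (intro conjI allI impI)
  fix i j :: nat assume i: "i < 20" and j: "j < 20"
  let ?u = "dod_points ! i" and ?v = "dod_points ! j"
  have "{?u, ?v} \<in> edges dodecahedral_graph \<longleftrightarrow>
      ?u \<noteq> ?v \<and> closed_segment ?u ?v edge_of regular_dodecahedron"
    unfolding dodecahedral_graph_def one_skeleton_def
    by (auto simp: doubleton_eq_iff closed_segment_commute)
  also have "\<dots> \<longleftrightarrow> j \<in> set (dodecahedral_adj ! i)"
    using dod_edge_adjacent[OF i j] dod_adjacent_edge[OF i j] dod_inner(3)[OF i j] distinct_dod_points i j
    by (auto simp: nth_eq_iff_index_eq length_dod_points)
  finally show "{?u, ?v} \<in> edges dodecahedral_graph \<longleftrightarrow> j \<in> set (dodecahedral_adj ! i)" .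
qed (simp_all add: distinct_dod_points verts_dodecahedral_graph length_dod_points)

section \<open>The classification\<close>

definition adj_check :: "state \<Rightarrow> (nat \<times> nat) list \<Rightarrow> bool" where
  "adj_check T ps \<longleftrightarrow> list_all (\<lambda>(i, j). i < length T \<and> j < length T) ps
    \<and> list_all (\<lambda>i. list_all (\<lambda>j. j \<in> set (T ! i) \<longleftrightarrow> (i, j) \<in> set ps \<or> (j, i) \<in> set ps)
        [0..<length T]) [0..<length T]"

lemma representsI:
  assumes "length ws = length T" "distinct ws" "set ws = verts H"
    and E: "edges H = (\<lambda>(i, j). {ws ! i, ws ! j}) ` set ps" and chk: "adj_check T ps"
  shows "represents T ws H"
  unfolding represents_def
proof (intro conjI allI impI)
  fix i j assume ij: "i < length ws" "j < length ws"
  have ps: "k < length ws" "l < length ws" if "(k, l) \<in> set ps" for k l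
    using chk that assms(1) by (auto simp: adj_check_def list_all_iff)
  have "{ws ! i, ws ! j} \<in> edges H \<longleftrightarrow> (\<exists>(k, l)\<in>set ps. i = k \<and> j = l \<or> i = l \<and> j = k)"
    unfolding E image_iff using ps ij assms(2)
    by (intro bex_cong refl) (auto simp: doubleton_eq_iff nth_eq_iff_index_eq)
  also have "\<dots> \<longleftrightarrow> (i, j) \<in> set ps \<or> (j, i) \<in> set ps" by blast
  also have "\<dots> \<longleftrightarrow> j \<in> set (T ! i)"
    using chk ij assms(1) by (auto simp: adj_check_def list_all_iff)
  finally show "{ws ! i, ws ! j} \<in> edges H \<longleftrightarrow> j \<in> set (T ! i)" .
qed (use assms in auto)

definition petersen_edges :: "(nat \<times> nat) list" where
  "petersen_edges = map (\<lambda>i. (i, Suc i mod 5)) [0..<5] @ map (\<lambda>i. (i, i + 5)) [0..<5]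
    @ map (\<lambda>i. (i + 5, (i + 2) mod 5 + 5)) [0..<5]"

lemma represents_petersen: "represents petersen_adj (map Outer [0..<5] @ map Inner [0..<5]) petersen_graph"
proof (rule representsI)
  let ?ws = "map Outer [0..<5] @ map Inner [0..<5]"
  have o: "?ws ! i = Outer i" and n: "?ws ! (i + 5) = Inner i" if "i < 5" for i
    using that by (simp_all add: nth_append)
  have "(\<lambda>(i, j). {?ws ! i, ?ws ! j}) ` set petersen_edges =
    (\<lambda>i. {?ws ! i, ?ws ! (Suc i mod 5)}) ` {..<5} \<union> (\<lambda>i. {?ws ! i, ?ws ! (i + 5)}) ` {..<5} \<union>
    (\<lambda>i. {?ws ! (i + 5), ?ws ! ((i + 2) mod 5 + 5)}) ` {..<5}"
    unfolding petersen_edges_def by (simp add: image_Un image_image atLeast0LessThan Un_assoc)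
  also have "\<dots> = (\<lambda>i. {Outer i, Outer (Suc i mod 5)}) ` {..<5} \<union> (\<lambda>i. {Outer i, Inner i}) ` {..<5} \<union>
    (\<lambda>i. {Inner i, Inner ((i + 2) mod 5)}) ` {..<5}"
    by (intro arg_cong2[where f = "(\<union>)"] image_cong refl) (simp_all only: o n lessThan_iff mod_less_divisor zero_less_numeral)
  also have "\<dots> = edges petersen_graph" by (auto simp: petersen_graph_def)
  finally show "edges petersen_graph = (\<lambda>(i, j). {?ws ! i, ?ws ! j}) ` set petersen_edges" ..
  show "adj_check petersen_adj petersen_edges" by code_simp
qed (auto simp: petersen_adj_def petersen_graph_def distinct_map inj_on_def)

text \<open>Indices are shifted by one: vertex \<open>k\<close> of the graph has index
  \<open>k - 1\<close>.\<close>

definition triplex_edges :: "(nat \<times> nat) list" where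
  "triplex_edges = map (\<lambda>i. (i, Suc i)) [0..<11] @
    [(0, 6), (1, 9), (2, 7), (3, 11), (4, 8), (5, 10), (11, 0)]"

lemma represents_triplex: "represents triplex_adj [1..<13] triplex_graph"
proof (rule representsI)
  define ws where "ws = [1..<13::nat]"
  have w: "ws ! i = i + 1" if "i < 12" for i using that by (simp add: ws_def)
  have w': "ws ! 0 = 1" "ws ! Suc 0 = 2" "ws ! 2 = 3" "ws ! 3 = 4" "ws ! 4 = 5" "ws ! 5 = 6" "ws ! 6 = 7"
    "ws ! 7 = 8" "ws ! 8 = 9" "ws ! 9 = 10" "ws ! 10 = 11" "ws ! 11 = 12"
    by (simp_all add: w)
  have "(\<lambda>(i, j). {ws ! i, ws ! j}) ` set triplex_edges =
    (\<lambda>i. {ws ! i, ws ! Suc i}) ` {..<11} \<union>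
      {{1, 7}, {2, 10}, {3, 8}, {4, 12}, {5, 9}, {6, 11}, {12, 1}}"
    unfolding triplex_edges_def by (simp add: image_Un image_image atLeast0LessThan w' insert_commute)
  also have "(\<lambda>i. {ws ! i, ws ! Suc i}) ` {..<11} = (\<lambda>i. {Suc i, Suc i + 1}) ` {..<11}"
    by (intro image_cong refl) (simp add: w)
  also have "\<dots> = (\<lambda>i. {i, i + 1}) ` (Suc ` {..<11})" by (simp add: image_image)
  also have "Suc ` {..<11} = {i. 1 \<le> i \<and> i < 12}"
    unfolding image_Suc_lessThan by auto
  also have "(\<lambda>i. {i, i + 1}) ` \<dots> = {{i, i + 1} |i. 1 \<le> i \<and> i < 12}" by blast
  also have "\<dots> \<union> {{1, 7}, {2, 10}, {3, 8}, {4, 12}, {5, 9}, {6, 11}, {12, 1}} = edges triplex_graph"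
    by (simp add: triplex_graph_def insert_commute)
  finally show "edges triplex_graph = (\<lambda>(i, j). {[1..<13] ! i, [1..<13] ! j}) ` set triplex_edges"
    unfolding ws_def ..
  show "adj_check triplex_adj triplex_edges" by code_simp
qed (auto simp: triplex_adj_def triplex_graph_def)

context flat_graph begin

lemma neighbour_exists:
  assumes "x \<in> verts G"
  obtains y where "adj x y"
proof -
  obtain e where "e \<in> edges G" using nonempty by blast
  then obtain u v where uv: "adj u v" using simple unfolding simple_graph_def by (metis card_2_iff)
  have "{x \<in> verts G. N x \<noteq> {}} = verts G"
  proof (rule closed_eq_verts[of u])
    show "u \<in> {x \<in> verts G. N x \<noteq> {}}" using uv adj_verts by auto
    show "N x \<subseteq> {x \<in> verts G. N x \<noteq> {}}" for x
      using adj_sym adj_verts by fastforce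
  qed auto
  then show ?thesis using assms that by fastforce
qed

text \<open>If no edge joins degree 2 to degree 3, the vertices of degree 2 are closed under
  adjacency, so connectedness makes the degree constant.\<close>

lemma degrees:
  "(\<forall>x\<in>verts G. deg x = 2) \<or> (\<forall>x\<in>verts G. deg x = 3) \<or> (\<exists>b c. deg c = 2 \<and> adj b c \<and> deg b = 3)"
proof (cases "\<exists>b c. deg c = 2 \<and> adj b c \<and> deg b = 3")
  case False
  have d: "deg x = 2 \<or> deg x = 3" if "x \<in> verts G" for x
    using neighbour_exists[OF that] deg_23 by metis
  show ?thesis
  proof (cases "\<exists>x\<in>verts G. deg x = 2")
    case True
    then obtain x where x: "x \<in> verts G" "deg x = 2" by blast
    have "{x \<in> verts G. deg x = 2} = verts G"
    proof (rule closed_eq_verts[of x])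
      fix c assume c: "c \<in> {x \<in> verts G. deg x = 2}"
      show "N c \<subseteq> {x \<in> verts G. deg x = 2}"
      proof
        fix b assume "b \<in> N c"
        then have "adj b c" "b \<in> verts G" using adj_sym adj_verts by auto
        then show "b \<in> {x \<in> verts G. deg x = 2}" using False c d by blast
      qed
    qed (use x in auto)
    then show ?thesis by blast
  qed (use d in blast)
qed blast

end

theorem theorem1:
  fixes G :: "'a graph"
  assumes "simple_graph G"
    and "locally_finite_graph G"
    and "connected_graph G"
    and "edges G \<noteq> {}"
    and "ricci_flat G"
    and "girth G \<ge> 5"
  shows "graph_isomorphic G infinite_path
    \<or> (\<exists>n\<ge>6. graph_isomorphic G (cycle_graph n))
    \<or> graph_isomorphic G dodecahedral_graph
    \<or> graph_isomorphic G petersen_graph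
    \<or> graph_isomorphic G half_dodecahedral_graph
    \<or> graph_isomorphic G triplex_graph"
proof -
  interpret flat_graph G by unfold_locales (use assms in auto)
  consider "\<forall>x\<in>verts G. deg x = 2" | "\<forall>x\<in>verts G. deg x = 3"
    | b c where "deg c = 2" "adj b c" "deg b = 3" using degrees by blast
  then show ?thesis
  proof cases
    case 1
    then show ?thesis using two_regular by blast
  next
    case 2
    then interpret cubic_flat_graph G by unfold_locales auto
    show ?thesis
      using cubic_classification[OF represents_dodecahedral represents_petersen represents_triplex] by blast
  next
    case 3
    then show ?thesis using mixed_degrees by blast
  qed
qed

end
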